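(* Let $\Omega\subset\mathbb{RP}^n$ ($n\ge 2$) be any proper open convex set and fix $o\in\Omega$. Assume that $\partial\Omega$ is approximately regular at $x^+\in\partial\Omega$, with exponents $+\infty\ge\alpha_1>\cdots>\alpha_p\ge 1$ and filtration $$\{0\}=H_0\subsetneq H_1\subsetneq\cdots\subsetneq H_p=T_{x^+}\partial\Omega .$$ Then the horosphere $\mathcal H=\mathcal H_{x^+}(o)$ about $x^+$ passing through $o$ admits a filtration $$\{o\}=\mathcal H_0\subsetneq\mathcal H_1\subsetneq\cdots\subsetneq\mathcal H_p=\mathcal H,$$ given by $\mathcal H_i=\mathcal H\cap(H_i\oplus\mathbb R\cdot ox^+)$, $1\le i\le p$, such that for every $1\le i\le p$ $$\mathcal H_i\smallsetminus\mathcal H_{i-1}=\Big\{x\in\mathcal H\smallsetminus\{o\}:\ \lim_{t\to+\infty}\frac1t\log d_\Omega\big(\varphi^t_{x^+}(o),\varphi^t_{x^+}(x)\big)=\chi^s_i\Big\},\qquad \chi_i^s=-2+\frac{2}{\alpha_i}.$$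
   Context: Proper means that in some affine chart $\Omega$ is relatively compact. The Hilbert distance is $d_\Omega(x,y)=\frac12|\log[a,b,x,y]|$ for $x\ne y$, where $a,b$ are the intersection points of the line $(xy)$ with $\partial\Omega$ and $[a,b,x,y]=\frac{|ax|/|bx|}{|ay|/|by|}$. Radial flow: for $x^+\in\partial\Omega$ and $x\in\Omega$, let $(xx^+):\mathbb R\to\Omega$ denote the projective line through $x$ and $x^+$, parametrized by $d_\Omega$-arc length with $(xx^+)(0)=x$ and $(xx^+)(t)\to x^+$ as $t\to+\infty$; put $\varphi_{x^+}^t(x)=(xx^+)(t)$. Horosphere: for $x,y\in\Omega$ let $t_y$ be the time (unique, in the definition used) such that $$\lim_{t\to+\infty}d_\Omega\big((xx^+)(t),(yx^+)(t+t_y)\big)=\inf_{z\in(yx^+)}\lim_{t\to+\infty}d_\Omega\big((xx^+)(t),(zx^+)(t)\big);$$ the horosphere through $x$ about $x^+$ is the set of such minimal points, $\mathcal H_{x^+}(x)=\{(yx^+)(t_y): y\in\Omega\}$. Approximate regularity: choose an affine chart containing $x^+$ and a Euclidean metric on it. Let $T_{x^+}\partial\Omega$ be a supporting hyperplane of $\Omega$ at $x^+$ (the tangent hyperplane if $\partial\Omega$ is $C^1$ at $x^+$), viewed as a vector space with origin $x^+$. Near $x^+$, $\partial\Omega$ is the graph over a neighbourhood of $0$ in $T_{x^+}\partial\Omega$ of a convex function $f\ge 0$ with $f(0)=0$ (heights measured along the normal pointing to the side of $\Omega$). $\partial\Omega$ is approximately regular at $x^+$ if for every $v\in T_{x^+}\partial\Omega\smallsetminus\{0\}$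 the limit $$\alpha(v)=\lim_{t\to0}\frac{\log\frac{f(tv)+f(-tv)}{2}}{\log|t|}\in[1,+\infty]$$ exists (with value $+\infty$ if $f$ vanishes near $0$ on $\mathbb R v$). The exponents $\alpha_1>\cdots>\alpha_p$ are the values taken by $\alpha$, and the filtration is by the subspaces $H_i=\{0\}\cup\{v:\alpha(v)\ge\alpha_i\}$, so that $\alpha(v)=\alpha_i$ for $v\in H_i\smallsetminus H_{i-1}$. Convention: $2/(+\infty)=0$. $H_i\oplus\mathbb R\cdot ox^+$ denotes the affine subspace through $x^+$ directed by $H_i$ and by the line $(ox^+)$. *)

theory Defs
  imports "HOL-Analysis.Analysis"
begin

section \<open>Real projective space\<close>

text \<open>The points of the projective space of \<open>'v\<close> are the lines of \<open>'v\<close> through the origin. The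
  projective space of \<open>'a \<times> real\<close> is \<open>\<real>P\<^sup>n\<close> with \<open>n = DIM('a)\<close>.\<close>

typedef (overloaded) 'v projective = "{span {v} | v::'v::euclidean_space. v \<noteq> 0}"
  morphisms line_of Abs_projective
  using nonzero_Basis SOME_Basis by blast

definition pt :: "'v::euclidean_space \<Rightarrow> 'v projective"
  where "pt v = Abs_projective (span {v})"

text \<open>The quotient topology from the nonzero vectors.\<close>

instantiation projective :: (euclidean_space) topological_space
begin

definition open_projective :: "'a projective set \<Rightarrow> bool"
  where "open_projective U \<longleftrightarrow> open {v. v \<noteq> 0 \<and> pt v \<in> U}"

instance
proof
  show "open (UNIV :: 'a projective set)"
  proof -
    have "{v::'a. v \<noteq> 0} = - {0}" by auto
    then show ?thesis by (simp add: open_projective_def open_Compl)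
  qed
next
  fix S T :: "'a projective set"
  assume "open S" "open T"
  moreover have "{v. v \<noteq> 0 \<and> pt v \<in> S \<inter> T} = {v. v \<noteq> 0 \<and> pt v \<in> S} \<inter> {v. v \<noteq> 0 \<and> pt v \<in> T}"
    by auto
  ultimately show "open (S \<inter> T)" by (simp add: open_projective_def open_Int)
next
  fix K :: "'a projective set set"
  assume "\<forall>S\<in>K. open S"
  moreover have "{v. v \<noteq> 0 \<and> pt v \<in> \<Union>K} = (\<Union>S\<in>K. {v. v \<noteq> 0 \<and> pt v \<in> S})"
    by auto
  ultimately show "open (\<Union>K)" by (simp add: open_projective_def open_UN)
qed

end

text \<open>The smallest projective subspace containing a given set of points.\<close>

definition proj_span :: "'v::euclidean_space projective set \<Rightarrow> 'v projective set"
  where "proj_span X = {p. line_of p \<subseteq> span (\<Union>q\<in>X. line_of q)}"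

text \<open>An affine chart of \<open>\<real>P\<^sup>n\<close>, given by its inverse \<open>\<kappa>\<close>, which identifies the Euclidean space \<open>'a\<close>
  with the complement of a projective hyperplane. Composing \<open>\<kappa>\<close> with an affine automorphism of \<open>'a\<close>
  gives a chart again, so the choice of \<open>\<kappa>\<close> covers both the choice of the complement and
  that of a Euclidean metric on it.\<close>

definition affine_chart :: "('a::euclidean_space \<Rightarrow> ('a \<times> real) projective) \<Rightarrow> bool"
  where "affine_chart \<kappa> \<longleftrightarrow>
    (\<exists>A :: 'a \<times> real \<Rightarrow> 'a \<times> real. linear A \<and> bij A \<and> \<kappa> = (\<lambda>x. pt (A (x, 1))))"


section \<open>Hilbert geometry\<close>

definition proper_convex_chart ::
    "('a \<times> real) projective set \<Rightarrow> ('a::euclidean_space \<Rightarrow> ('a \<times> real) projective) \<Rightarrow> bool"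
  where "proper_convex_chart \<Omega> \<kappa> \<longleftrightarrow>
    affine_chart \<kappa> \<and> \<Omega> \<subseteq> range \<kappa> \<and> convex (\<kappa> -` \<Omega>) \<and> compact (closure (\<kappa> -` \<Omega>))"

definition proper_open_convex :: "('a::euclidean_space \<times> real) projective set \<Rightarrow> bool"
  where "proper_open_convex \<Omega> \<longleftrightarrow> open \<Omega> \<and> (\<exists>\<kappa>. proper_convex_chart \<Omega> \<kappa>)"

definition cross_ratio :: "'a::metric_space \<Rightarrow> 'a \<Rightarrow> 'a \<Rightarrow> 'a \<Rightarrow> real"
  where "cross_ratio a b x y = (dist a x / dist b x) / (dist a y / dist b y)"

text \<open>The lengths in the cross ratio are measured in a chart in which \<open>\<Omega>\<close> is convex and relatively
  compact. The value depends neither on the choice of this chart, by projective invariance of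
  the cross ratio, nor on the order of \<open>a\<close> and \<open>b\<close>, because of the absolute value.\<close>

definition hilbert_dist ::
    "('a::euclidean_space \<times> real) projective set \<Rightarrow> ('a \<times> real) projective \<Rightarrow> ('a \<times> real) projective \<Rightarrow> real"
  where "hilbert_dist \<Omega> x y =
    (if x = y then 0
     else let \<kappa> = (SOME \<kappa>. proper_convex_chart \<Omega> \<kappa>) in
       THE r. \<exists>a b. proj_span {x, y} \<inter> frontier \<Omega> = {a, b} \<and>
         r = \<bar>ln (cross_ratio (inv \<kappa> a) (inv \<kappa> b) (inv \<kappa> x) (inv \<kappa> y))\<bar> / 2)"

text \<open>\<open>radial_line \<Omega> x\<^sup>+ x\<close> is the line \<open>(xx\<^sup>+)\<close> with its arc length parametrization.\<close>

definition radial_line ::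
    "('a::euclidean_space \<times> real) projective set \<Rightarrow> ('a \<times> real) projective \<Rightarrow> ('a \<times> real) projective
      \<Rightarrow> real \<Rightarrow> ('a \<times> real) projective"
  where "radial_line \<Omega> xp x =
    (THE c. (\<forall>t. c t \<in> \<Omega> \<inter> proj_span {x, xp}) \<and>
       (\<forall>s t. hilbert_dist \<Omega> (c s) (c t) = \<bar>s - t\<bar>) \<and>
       c 0 = x \<and> (c \<longlongrightarrow> xp) at_top)"

definition radial_flow ::
    "('a::euclidean_space \<times> real) projective set \<Rightarrow> ('a \<times> real) projective \<Rightarrow> real
      \<Rightarrow> ('a \<times> real) projective \<Rightarrow> ('a \<times> real) projective"
  where "radial_flow \<Omega> xp t x = radial_line \<Omega> xp x t"

text \<open>All minimal points are taken: if \<open>\<partial>\<Omega>\<close> is not differentiable at \<open>x\<^sup>+\<close>, then a line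
  \<open>(yx\<^sup>+)\<close> may contain more than one.\<close>

definition horosphere ::
    "('a::euclidean_space \<times> real) projective set \<Rightarrow> ('a \<times> real) projective \<Rightarrow> ('a \<times> real) projective
      \<Rightarrow> ('a \<times> real) projective set"
  where "horosphere \<Omega> xp x =
    {radial_line \<Omega> xp y s | y s. y \<in> \<Omega> \<and>
       Lim at_top (\<lambda>t. hilbert_dist \<Omega> (radial_line \<Omega> xp x t) (radial_line \<Omega> xp y (t + s))) =
       (INF z\<in>range (radial_line \<Omega> xp y).
          Lim at_top (\<lambda>t. hilbert_dist \<Omega> (radial_line \<Omega> xp x t) (radial_line \<Omega> xp z t)))}"


section \<open>Approximate regularity\<close>

text \<open>The vector hyperplane with unit normal \<open>\<nu>\<close>, which directs the supporting hyperplane at \<open>x\<^sup>+\<close>.\<close>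

definition tangent :: "'a::euclidean_space \<Rightarrow> 'a set"
  where "tangent \<nu> = {v. v \<bullet> \<nu> = 0}"

text \<open>In the chart \<open>\<kappa>\<close>, near \<open>x\<^sup>+\<close>, \<open>\<partial>\<Omega>\<close> is the graph of the convex function \<open>f \<ge> 0\<close> over a
  neighbourhood of \<open>0\<close> in \<^term>\<open>tangent \<nu>\<close>, and \<open>\<Omega>\<close> lies above it; as \<open>f \<ge> 0\<close>, the hyperplane
  is supporting.\<close>

definition boundary_graph ::
    "('a::euclidean_space \<times> real) projective set \<Rightarrow> ('a \<Rightarrow> ('a \<times> real) projective)
      \<Rightarrow> ('a \<times> real) projective \<Rightarrow> 'a \<Rightarrow> ('a \<Rightarrow> real) \<Rightarrow> bool"
  where "boundary_graph \<Omega> \<kappa> xp \<nu> f \<longleftrightarrow>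
    norm \<nu> = 1 \<and> f 0 = 0 \<and>
    (\<exists>\<epsilon>>0. convex_on (tangent \<nu> \<inter> ball 0 \<epsilon>) f \<and> (\<forall>h\<in>tangent \<nu> \<inter> ball 0 \<epsilon>. 0 \<le> f h)) \<and>
    (\<forall>\<^sub>F z in nhds (inv \<kappa> xp).
       let s = (z - inv \<kappa> xp) \<bullet> \<nu>; h = (z - inv \<kappa> xp) - s *\<^sub>R \<nu>
       in (\<kappa> z \<in> frontier \<Omega> \<longleftrightarrow> s = f h) \<and> (\<kappa> z \<in> \<Omega> \<longleftrightarrow> s > f h))"

definition log_ratio :: "('a::euclidean_space \<Rightarrow> real) \<Rightarrow> 'a \<Rightarrow> real \<Rightarrow> ereal"
  where "log_ratio f v t =
    (if f (t *\<^sub>R v) + f (- t *\<^sub>R v) = 0 then \<infinity>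
     else ereal (ln ((f (t *\<^sub>R v) + f (- t *\<^sub>R v)) / 2) / ln \<bar>t\<bar>))"

definition approx_regular :: "'a::euclidean_space \<Rightarrow> ('a \<Rightarrow> real) \<Rightarrow> bool"
  where "approx_regular \<nu> f \<longleftrightarrow>
    (\<forall>v\<in>tangent \<nu> - {0}. \<exists>a\<in>{1..\<infinity>}. (log_ratio f v \<longlongrightarrow> a) (at 0))"

definition alpha :: "('a::euclidean_space \<Rightarrow> real) \<Rightarrow> 'a \<Rightarrow> ereal"
  where "alpha f v = Lim (at 0) (log_ratio f v)"

text \<open>\<open>e 1 > \<dots> > e p\<close> are the values of \<open>\<alpha>\<close>; the other values of \<open>e\<close> play no role.\<close>

definition exponents :: "'a::euclidean_space \<Rightarrow> ('a \<Rightarrow> real) \<Rightarrow> nat \<Rightarrow> (nat \<Rightarrow> ereal) \<Rightarrow> bool"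
  where "exponents \<nu> f p e \<longleftrightarrow>
    alpha f ` (tangent \<nu> - {0}) = e ` {1..p} \<and> (\<forall>i\<in>{1..p}. \<forall>j\<in>{1..p}. i < j \<longrightarrow> e j < e i)"

definition filtration ::
    "'a::euclidean_space \<Rightarrow> ('a \<Rightarrow> real) \<Rightarrow> (nat \<Rightarrow> ereal) \<Rightarrow> nat \<Rightarrow> 'a set"
  where "filtration \<nu> f e i =
    (if i = 0 then {0} else {0} \<union> {v \<in> tangent \<nu> - {0}. e i \<le> alpha f v})"

text \<open>For the direction \<open>H\<close>, the set \<open>{z + h | \<dots>}\<close> is the affine subspace \<open>H \<oplus> \<real>\<cdot>ox\<^sup>+\<close> of the chart
  \<open>\<kappa>\<close> through \<open>x\<^sup>+\<close>. The chart is only required to contain \<open>x\<^sup>+\<close>, so the horosphere may leave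
  it, and the projective completion of the affine subspace is taken; inside the chart the two agree.\<close>

definition directed_subspace ::
    "('a::euclidean_space \<Rightarrow> ('a \<times> real) projective) \<Rightarrow> 'a set \<Rightarrow> ('a \<times> real) projective
      \<Rightarrow> ('a \<times> real) projective \<Rightarrow> ('a \<times> real) projective set"
  where "directed_subspace \<kappa> H q xp =
    proj_span (\<kappa> ` {z + h | z h. \<kappa> z \<in> proj_span {q, xp} \<and> h \<in> H})"

definition horosphere_filtration ::
    "('a::euclidean_space \<times> real) projective set \<Rightarrow> ('a \<Rightarrow> ('a \<times> real) projective)
      \<Rightarrow> ('a \<times> real) projective \<Rightarrow> ('a \<times> real) projective \<Rightarrow> 'a \<Rightarrow> ('a \<Rightarrow> real) \<Rightarrow> (nat \<Rightarrow> ereal)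
      \<Rightarrow> nat \<Rightarrow> ('a \<times> real) projective set"
  where "horosphere_filtration \<Omega> \<kappa> q xp \<nu> f e i =
    horosphere \<Omega> xp q \<inter> directed_subspace \<kappa> (filtration \<nu> f e i) q xp"

definition lyapunov_exponent :: "ereal \<Rightarrow> ereal"
  where "lyapunov_exponent a = - 2 + 2 / a"

lemma lyapunov_exponent_infinity: "lyapunov_exponent \<infinity> = - 2"
  by (simp add: lyapunov_exponent_def)

end

theory Submission
  imports Defs
begin

text \<open>
  Lift \<open>\<Omega>\<close> to an open convex cone \<open>K\<close> and \<open>x\<^sup>+\<close> to \<open>X\<close>. The Hilbert distance becomes Birkhoff's formula
  \<open>d(x, y) = (ln M(x/y) + ln M(y/x)) / 2\<close>, where \<open>M(x/y)\<close> is the infimum of the \<open>r\<close> with \<open>r y - x \<in> K\<close>, and the radial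
  lines are \<open>t \<mapsto> X + exp(-2t) Q\<close>, where \<open>Q\<close> represents the other end point. As \<open>t \<rightarrow> \<infinity>\<close> the distance
  between two radial lines tends to the one in the tangent cone \<open>T = \<Union>\<^sub>c (K - c X)\<close>, so that \<open>X + Q\<close> lies on
  the horosphere of \<open>o = X + P\<close> iff neither \<open>u = P - Q\<close> nor \<open>- u\<close> lies in \<open>T\<close>.

  With \<open>\<epsilon> = exp(-2t)\<close>, one has \<open>M(x/y) < 1 + \<epsilon> m\<close> iff \<open>u + m (X + \<epsilon> P) \<in> K\<close>, and up to constants \<open>P\<close> may be replaced
  there by the normal vector. If \<open>v\<close> is the tangential part of \<open>u\<close>, the graph of \<open>f\<close> turns the two membership
  conditions for \<open>\<plusminus> u\<close> into \<open>f(v/m) + f(-v/m) \<lesssim> \<epsilon>\<close>, that is \<open>m \<approx> \<epsilon>\<^sup>-\<^sup>1\<^sup>/\<^sup>\<alpha>\<close>. Hence the distance is of order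
  \<open>\<epsilon> m\<close>, and its exponential rate in \<open>t\<close> is \<open>-2 + 2/\<alpha>\<close>.
\<close>

section \<open>Lifts of points\<close>

text \<open>The graph of f is taken over the normal \<nu>, whereas the subspaces of the filtration
  contain the line (ox+), which need not be parallel to \<nu>. Hence u has two tangential parts, one
  along each direction, and they may differ. They differ only if both have exponent 1: an exponent
  above 1 gives f(tv) + f(-tv) = o(t), so v and - v both belong to the closure of T, and u or - u
  would lie in T unless the transversal component vanishes. For the same reason the sharp upper
  bound is only required when u has no normal component; at exponent 1 a bounded distance already
  has the right rate. In the lower bound the symmetrised function f(tv) + f(-tv) appears because the
  conditions for u and - u carry opposite normal components, which cancel in the sum. The boundary
  need not be differentiable, so T need not be a half-space; and T contains the line through X in
  its saturation, so it is not a proper cone. Neither f nor its asymptotics is inverted: for each y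
  on one side of 1/\<alpha> the distance is compared with the power e^(1-y).\<close>

lemma line_of_pt: "v \<noteq> 0 \<Longrightarrow> line_of (pt v) = span {v}"
  unfolding pt_def by (rule Abs_projective_inverse) auto

lemma ex_pt: "\<exists>v. v \<noteq> 0 \<and> p = pt v"
proof -
  obtain v where "v \<noteq> 0" "line_of p = span {v}"
    using line_of[of p] by auto
  then show ?thesis by (metis line_of_inverse pt_def)
qed

lemma span_singleton_scaleR: 
  fixes v :: "'v::real_vector"
  assumes "c \<noteq> 0" shows "span {c *\<^sub>R v} = span {v}"
proof -
  have "v = (1/c) *\<^sub>R (c *\<^sub>R v)" using assms by simp
  then have "v \<in> span {c *\<^sub>R v}" by (metis insertI1 span_base span_scale)
  then show ?thesis
    by (intro span_eq[THEN iffD2]) (auto intro: span_scale span_base)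
qed

lemma pt_scaleR [simp]: "c \<noteq> 0 \<Longrightarrow> pt (c *\<^sub>R v) = pt v"
  unfolding pt_def by (simp add: span_singleton_scaleR)

lemma pt_uminus [simp]: "pt (- v) = pt v"
  using pt_scaleR[of "-1" v] by simp

lemma pt_eq_iff:
  assumes "v \<noteq> 0" "w \<noteq> 0"
  shows "pt v = pt w \<longleftrightarrow> (\<exists>c. c \<noteq> 0 \<and> v = c *\<^sub>R w)"
proof
  assume "pt v = pt w"
  then have "span {v} = span {w}" using assms by (metis line_of_pt)
  then have "v \<in> span {w}" by (metis insertI1 span_base)
  then obtain c where "v = c *\<^sub>R w" by (auto simp: span_singleton)
  then show "\<exists>c. c \<noteq> 0 \<and> v = c *\<^sub>R w" using assms by auto
qed auto

lemma pt_mem_proj_span: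
  assumes "v \<noteq> 0" "0 \<notin> W"
  shows "pt v \<in> proj_span (pt ` W) \<longleftrightarrow> v \<in> span W"
proof -
  have "(\<Union>q\<in>pt ` W. line_of q) = (\<Union>w\<in>W. span {w})"
  proof -
    have "line_of (pt w) = span {w}" if "w \<in> W" for w
      using that assms(2) by (metis line_of_pt)
    then show ?thesis by simp
  qed
  moreover have "span (\<Union>w\<in>W. span {w}) = span W"
  proof (intro span_eq[THEN iffD2] conjI subsetI)
    fix x assume "x \<in> (\<Union>w\<in>W. span {w})"
    then show "x \<in> span W" by (meson UN_E empty_subsetI insert_subset span_mono subsetD)
  next
    fix x assume "x \<in> W"
    then show "x \<in> span (\<Union>w\<in>W. span {w})"
      by (meson UN_iff insertI1 span_base)
  qed
  moreover have "span {v} \<subseteq> span W \<longleftrightarrow> v \<in> span W"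
    by (meson empty_subsetI insert_subset insertI1 span_base span_minimal subspace_span subsetD)
  ultimately show ?thesis by (simp add: proj_span_def line_of_pt assms)
qed

lemma pt_mem_proj_span_pair:
  assumes "v \<noteq> 0" "x \<noteq> 0" "y \<noteq> 0"
  shows "pt v \<in> proj_span {pt x, pt y} \<longleftrightarrow> v \<in> span {x, y}"
  using pt_mem_proj_span[of v "{x, y}"] assms by auto

lemma mem_span_pair: "v \<in> span {x, y} \<longleftrightarrow> (\<exists>a b. v = a *\<^sub>R x + b *\<^sub>R y)"
proof
  assume "v \<in> span {x, y}"
  then obtain a where "v - a *\<^sub>R x \<in> span {y}" by (auto simp: span_breakdown_eq[of _ x])
  then obtain b where "v - a *\<^sub>R x = b *\<^sub>R y" by (auto simp: span_singleton)
  then show "\<exists>a b. v = a *\<^sub>R x + b *\<^sub>R y" by (metis add.commute diff_add_cancel)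
next
  assume "\<exists>a b. v = a *\<^sub>R x + b *\<^sub>R y"
  then show "v \<in> span {x, y}" by (auto intro!: span_add intro: span_scale span_base)
qed

section \<open>The quotient topology in terms of lifts\<close>

lemma open_projective_iff: "open U \<longleftrightarrow> open {v. v \<noteq> 0 \<and> pt v \<in> U}"
  by (rule open_projective_def)

lemma tendsto_pt:
  fixes g :: "'b \<Rightarrow> 'v::euclidean_space"
  assumes "(g \<longlongrightarrow> v) F" "v \<noteq> 0"
  shows "((\<lambda>t. pt (g t)) \<longlongrightarrow> pt v) F"
proof (rule topological_tendstoI)
  fix U assume U: "open (U :: 'v projective set)" "pt v \<in> U"
  have "\<forall>\<^sub>F t in F. g t \<in> {v. v \<noteq> 0 \<and> pt v \<in> U}"
    using assms U open_projective_iff[of U] by (intro topological_tendstoD) auto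
  then show "\<forall>\<^sub>F t in F. pt (g t) \<in> U" by (rule eventually_mono) auto
qed

lemma open_pt_image:
  fixes W :: "'v::euclidean_space set"
  assumes "open W" "0 \<notin> W" "\<And>c w. c \<noteq> 0 \<Longrightarrow> w \<in> W \<Longrightarrow> c *\<^sub>R w \<in> W"
  shows "open (pt ` W)"
proof -
  have "{v. v \<noteq> 0 \<and> pt v \<in> pt ` W} = W"
  proof (intro set_eqI iffI)
    fix v assume "v \<in> {v. v \<noteq> 0 \<and> pt v \<in> pt ` W}"
    then obtain w where "v \<noteq> 0" "w \<in> W" "pt v = pt w" by auto
    then show "v \<in> W" using pt_eq_iff[of v w] assms by metis
  qed (use assms in auto)
  then show ?thesis using assms by (simp add: open_projective_iff)
qed

text \<open>Stands in for uniqueness of limits in projective space: the quotient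
  \<open>L / l\<close> is homogeneous of degree 0, so it descends to points and turns projective
  convergence into convergence in a normed space. The set \<open>W\<close> is stable under nonzero
  scalars and hence has an open image.\<close>

lemma tendsto_homogeneous:
  fixes L :: "'v::euclidean_space \<Rightarrow> 'b::real_normed_vector" and l :: "'v \<Rightarrow> real"
  fixes g :: "'c \<Rightarrow> 'v"
  assumes L: "linear L" and l: "linear l" and g: "((\<lambda>t. pt (g t)) \<longlongrightarrow> pt v) F"
    and v: "l v \<noteq> 0" and nz: "\<And>t. g t \<noteq> 0"
  shows "((\<lambda>t. L (g t) /\<^sub>R l (g t)) \<longlongrightarrow> L v /\<^sub>R l v) F"
proof (rule topological_tendstoI)
  fix U assume U: "open (U :: 'b set)" "L v /\<^sub>R l v \<in> U"
  define W where "W = {w. l w \<noteq> 0 \<and> L w /\<^sub>R l w \<in> U}"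
  have cl: "continuous_on S l" and cL: "continuous_on S L" for S
    using l L linear_continuous_on linear_conv_bounded_linear by blast+
  have o: "open {w. l w \<noteq> 0}"
    using open_Collect_neq[OF cl continuous_on_const, of "0::real"] by simp
  have "continuous_on {w. l w \<noteq> 0} (\<lambda>w. L w /\<^sub>R l w)"
    by (intro continuous_intros cl cL) auto
  then have "open ((\<lambda>w. L w /\<^sub>R l w) -` U \<inter> {w. l w \<noteq> 0})"
    using U o by (metis continuous_on_open_vimage)
  moreover have "(\<lambda>w. L w /\<^sub>R l w) -` U \<inter> {w. l w \<noteq> 0} = W" by (auto simp: W_def)
  ultimately have "open W" by simp
  moreover have "0 \<notin> W" using l by (auto simp: W_def linear_0)
  moreover have W: "c *\<^sub>R w \<in> W" if "c \<noteq> 0" "w \<in> W" for c w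
    using that L l by (auto simp: W_def linear_cmul field_simps)
  ultimately have "open (pt ` W)" by (rule open_pt_image)
  moreover have "pt v \<in> pt ` W" using U v by (auto simp: W_def)
  ultimately have "\<forall>\<^sub>F t in F. pt (g t) \<in> pt ` W" using g by (metis topological_tendstoD)
  then show "\<forall>\<^sub>F t in F. L (g t) /\<^sub>R l (g t) \<in> U"
  proof (rule eventually_mono)
    fix t assume "pt (g t) \<in> pt ` W"
    then obtain w where "w \<in> W" "pt (g t) = pt w" by auto
    then have "g t \<in> W" using W \<open>0 \<notin> W\<close> nz pt_eq_iff[of "g t" w] by metis
    then show "L (g t) /\<^sub>R l (g t) \<in> U" by (simp add: W_def)
  qed
qed

section \<open>Convex cones\<close>

locale open_cone =
  fixes K :: "'v::euclidean_space set"
  assumes open_K: "open K"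
    and add_K: "\<And>x y. x \<in> K \<Longrightarrow> y \<in> K \<Longrightarrow> x + y \<in> K"
    and scale_K: "\<And>c x. 0 < c \<Longrightarrow> x \<in> K \<Longrightarrow> c *\<^sub>R x \<in> K"
begin

lemma scale_K_iff: "0 < c \<Longrightarrow> c *\<^sub>R x \<in> K \<longleftrightarrow> x \<in> K"
  using scale_K[of c x] scale_K[of "1 / c" "c *\<^sub>R x"] by auto

lemma add_closure_K:
  assumes "y \<in> K" "z \<in> closure K"
  shows "y + z \<in> K"
proof -
  obtain e where e: "0 < e" "ball y e \<subseteq> K" using open_K assms open_contains_ball by blast
  obtain z' where z': "z' \<in> K" "dist z' z < e" using assms e closure_approachable by blast
  have "y + (z - z') \<in> ball y e" using z' by (simp add: dist_norm norm_minus_commute)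
  then show ?thesis using e z' add_K[of "y + (z - z')" z'] by auto
qed

lemma closure_K_D: "z \<in> closure K \<Longrightarrow> \<exists>g. (\<forall>n. g n \<in> K) \<and> g \<longlonglongrightarrow> z"
  by (simp add: closure_sequential)

lemma closure_K_I: "(\<And>n. g n \<in> K) \<Longrightarrow> g \<longlonglongrightarrow> z \<Longrightarrow> z \<in> closure K"
  unfolding closure_sequential by blast

lemma closure_add:
  assumes "y \<in> closure K" "z \<in> closure K" shows "y + z \<in> closure K"
proof -
  obtain g where g: "\<forall>n. g n \<in> K" "g \<longlonglongrightarrow> y" using closure_K_D assms(1) by blast
  obtain h where h: "\<forall>n. h n \<in> K" "h \<longlonglongrightarrow> z" using closure_K_D assms(2) by blast
  show ?thesis
    by (rule closure_K_I[of "\<lambda>n. g n + h n"]) (use g h in \<open>auto intro: add_K tendsto_add\<close>)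
qed

lemma closure_scale:
  assumes "y \<in> closure K" "0 < c" shows "c *\<^sub>R y \<in> closure K"
proof -
  obtain g where g: "\<forall>n. g n \<in> K" "g \<longlonglongrightarrow> y" using closure_K_D assms(1) by blast
  show ?thesis
    by (rule closure_K_I[of "\<lambda>n. c *\<^sub>R g n"])
       (use g assms in \<open>auto intro: scale_K tendsto_scaleR tendsto_const\<close>)
qed

lemma add_small:
  assumes "y \<in> K"
  shows "\<exists>d>0. \<forall>r. \<bar>r\<bar> < d \<longrightarrow> y + r *\<^sub>R w \<in> K"
proof -
  obtain e where e: "0 < e" "ball y e \<subseteq> K" using open_K assms open_contains_ball by blast
  have "y + r *\<^sub>R w \<in> K" if "\<bar>r\<bar> < e / (norm w + 1)" for r
  proof -
    have "\<bar>r\<bar> * norm w \<le> \<bar>r\<bar> * (norm w + 1)" by (intro mult_left_mono) auto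
    also have "\<dots> < e" using that by (subst (asm) pos_less_divide_eq) (auto intro: add_nonneg_pos)
    finally have "y + r *\<^sub>R w \<in> ball y e" by (simp add: dist_norm)
    then show ?thesis using e by auto
  qed
  moreover have "0 < e / (norm w + 1)" using e by (intro divide_pos_pos add_nonneg_pos) auto
  ultimately show ?thesis by blast
qed

lemma add_large:
  assumes "y \<in> K"
  shows "\<exists>c>0. \<forall>r\<ge>c. r *\<^sub>R y + w \<in> K"
proof -
  obtain d where d: "0 < d" "\<And>r. \<bar>r\<bar> < d \<Longrightarrow> y + r *\<^sub>R w \<in> K" using add_small[OF assms] by blast
  have "r *\<^sub>R y + w \<in> K" if "r \<ge> 2 / d" for r
  proof -
    have r: "0 < r" using that d by (smt (verit) divide_pos_pos)
    have "2 \<le> r * d" using that d by (simp add: field_simps)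
    then have "\<bar>1 / r\<bar> < d" using r by (simp add: field_simps)
    then have "r *\<^sub>R (y + (1 / r) *\<^sub>R w) \<in> K" using d r scale_K by blast
    then show ?thesis using r by (simp add: scaleR_add_right)
  qed
  then show ?thesis using d by (intro exI[of _ "2 / d"]) auto
qed

lemma sub_small:
  assumes "y \<in> K" shows "\<exists>d>0. y - d *\<^sub>R w \<in> K"
proof -
  obtain d where "0 < d" "\<And>r. \<bar>r\<bar> < d \<Longrightarrow> y + r *\<^sub>R w \<in> K" using add_small[OF assms] by blast
  then have "y + (- (d / 2)) *\<^sub>R w \<in> K" by (metis abs_minus_cancel abs_of_pos field_sum_of_halves half_gt_zero less_add_same_cancel1)
  then show ?thesis using \<open>0 < d\<close> by (intro exI[of _ "d / 2"]) auto
qed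

section \<open>Thresholds along rays; \<open>thr y (- x)\<close> is the M(x/y) of Birkhoff's
  formula\<close>

definition thr :: "'v \<Rightarrow> 'v \<Rightarrow> real"
  where "thr y w = Inf {r. r *\<^sub>R y + w \<in> K}"

text \<open>The set of admissible r is open because \<open>K\<close> is, and closed upwards because
  \<open>y\<close> lies in \<open>K\<close>, so it is an open ray. One excluded value
  \<open>r0\<close> is assumed in place of properness, since the tangent cone is not proper.\<close>

lemma thr_iff:
  assumes y: "y \<in> K" and r0: "r0 *\<^sub>R y + w \<notin> K"
  shows "r *\<^sub>R y + w \<in> K \<longleftrightarrow> thr y w < r"
proof -
  define S where "S = {r. r *\<^sub>R y + w \<in> K}"
  have up: "r' \<in> S" if "r \<in> S" "r < r'" for r r'
  proof -
    have "(r' - r) *\<^sub>R y + (r *\<^sub>R y + w) \<in> K"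
      using that y add_K scale_K by (simp add: S_def)
    then show ?thesis by (simp add: S_def algebra_simps)
  qed
  have ne: "S \<noteq> {}" using add_large[OF y, of w] by (auto simp: S_def)
  have bdd: "bdd_below S"
    by (rule bdd_belowI[of _ r0]) (metis S_def linorder_le_less_linear mem_Collect_eq r0 up)
  have opn: "\<exists>r'<r. r' \<in> S" if "r \<in> S" for r
  proof -
    have "r *\<^sub>R y + w \<in> K" using that by (simp add: S_def)
    then obtain d where d: "0 < d" "r *\<^sub>R y + w - d *\<^sub>R y \<in> K" using sub_small by blast
    then have "r - d \<in> S" by (simp add: S_def algebra_simps)
    then show ?thesis using d by (intro exI[of _ "r - d"]) auto
  qed
  have "r \<in> S \<longleftrightarrow> Inf S < r"
  proof
    assume "r \<in> S"
    then obtain r' where "r' < r" "r' \<in> S" using opn by blast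
    then show "Inf S < r" using bdd by (meson cInf_lower le_less_trans)
  next
    assume "Inf S < r"
    then obtain s where "s \<in> S" "s < r" using ne bdd by (meson cInf_lessD)
    then show "r \<in> S" using up by blast
  qed
  then show ?thesis by (simp add: S_def thr_def)
qed

lemma thr_eqI:
  assumes "y \<in> K" "\<And>r. r *\<^sub>R y + w \<in> K \<longleftrightarrow> m < r"
  shows "thr y w = m"
proof -
  have "{r. r *\<^sub>R y + w \<in> K} = {m<..}" using assms by auto
  then show ?thesis by (simp add: thr_def)
qed

lemma thr_boundary:
  assumes y: "y \<in> K" and r0: "r0 *\<^sub>R y + w \<notin> K"
  shows "thr y w *\<^sub>R y + w \<in> closure K - K"
proof
  let ?m = "thr y w"
  have "(?m + inverse (Suc n)) *\<^sub>R y + w \<in> K" for n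
    using thr_iff[OF assms] by simp
  moreover have "(\<lambda>n. (?m + inverse (Suc n)) *\<^sub>R y + w) \<longlonglongrightarrow> (?m + 0) *\<^sub>R y + w"
    by (intro tendsto_intros LIMSEQ_inverse_real_of_nat)
  ultimately show "?m *\<^sub>R y + w \<in> closure K" 
    using closure_K_I[of "\<lambda>n. (?m + inverse (Suc n)) *\<^sub>R y + w"] by simp
  show "?m *\<^sub>R y + w \<notin> K" using thr_iff[OF assms] by simp
qed

end

text \<open>The functional \<open>l\<close> is positive on the nonzero vectors of the closed cone
  and the slice \<open>l = 1\<close> is bounded: this is relative compactness in an affine chart,
  read on the cone.\<close>

locale proper_cone = open_cone K for K :: "'v::euclidean_space set" +
  fixes l :: "'v \<Rightarrow> real" and B :: real
  assumes linear_l: "linear l" and B: "0 < B" and bound_K: "\<And>x. x \<in> K \<Longrightarrow> norm x \<le> B * l x"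
begin

lemma l_simps [simp]: "l (x + y) = l x + l y" "l (x - y) = l x - l y" "l (c *\<^sub>R x) = c * l x"
    "l 0 = 0" "l (- x) = - l x"
  using linear_l by (auto simp: linear_add linear_diff linear_cmul linear_0 linear_neg)

lemma cont_l: "continuous_on S l"
  using linear_l linear_continuous_on linear_conv_bounded_linear by blast

lemma bound_closure: "x \<in> closure K \<Longrightarrow> norm x \<le> B * l x"
  by (rule continuous_le_on_closure[of K "\<lambda>x. norm x - B * l x" x 0, simplified])
     (auto intro!: continuous_intros cont_l simp: bound_K)

lemma l_nonneg: "x \<in> closure K \<Longrightarrow> 0 \<le> l x"
  using bound_closure[of x] B by (smt (verit) mult_pos_neg norm_ge_zero)

lemma l_pos: "x \<in> closure K \<Longrightarrow> x \<noteq> 0 \<Longrightarrow> 0 < l x"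
  using bound_closure[of x] l_nonneg[of x] B by (cases "l x = 0") auto

lemma zero_not_K: "0 \<notin> K"
proof
  assume "0 \<in> K"
  obtain b :: 'v where b: "b \<noteq> 0" using nonzero_Basis SOME_Basis by blast
  obtain d where d: "0 < d" "\<And>r. \<bar>r\<bar> < d \<Longrightarrow> 0 + r *\<^sub>R b \<in> K" using add_small[OF \<open>0 \<in> K\<close>] by blast
  have "(d / 2) *\<^sub>R b \<in> K" "(- (d / 2)) *\<^sub>R b \<in> K" using d(2)[of "d/2"] d(2)[of "-(d/2)"] d(1) by auto
  then have "l ((d / 2) *\<^sub>R b) > 0" "l ((- (d / 2)) *\<^sub>R b) > 0"
    using b d(1) closure_subset l_pos by (metis divide_eq_0_iff less_irrefl neg_equal_0_iff_equal scaleR_eq_0_iff subsetD zero_neq_numeral)+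
  then show False by simp
qed

lemma l_pos_K: "x \<in> K \<Longrightarrow> 0 < l x"
  using l_pos zero_not_K closure_subset by blast

lemma closure_K_antisym: "x \<in> closure K \<Longrightarrow> - x \<in> closure K \<Longrightarrow> x = 0"
  using l_pos[of x] l_nonneg[of "-x"] by auto

lemma neg_not_closure: "x \<in> K \<Longrightarrow> - x \<notin> closure K"
  using l_pos_K[of x] l_nonneg[of "-x"] by auto

lemma neg_not_K: "x \<in> K \<Longrightarrow> - x \<notin> K"
  using neg_not_closure closure_subset by blast

lemma not_K_below:
  assumes "y \<in> closure K" "y \<noteq> 0" shows "\<exists>r0. \<forall>r\<le>r0. r *\<^sub>R y + w \<notin> K"
proof -
  have ly: "0 < l y" using l_pos assms by blast
  have "r *\<^sub>R y + w \<notin> K" if "r \<le> - l w / l y" for r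
  proof
    assume "r *\<^sub>R y + w \<in> K"
    then have "0 < r * l y + l w" using l_pos_K by fastforce
    moreover have "r * l y \<le> - l w" using that ly by (simp add: field_simps)
    ultimately show False by simp
  qed
  then show ?thesis by blast
qed

lemma thr_iff': "y \<in> K \<Longrightarrow> r *\<^sub>R y + w \<in> K \<longleftrightarrow> thr y w < r"
  using thr_iff not_K_below[of y w] zero_not_K closure_subset by (metis order_refl subsetD)

lemma thr_boundary': "y \<in> K \<Longrightarrow> thr y w *\<^sub>R y + w \<in> closure K - K"
  using thr_boundary not_K_below[of y w] zero_not_K closure_subset by (metis order_refl subsetD)

lemma thr_pos:
  assumes "y \<in> K" "x \<in> K" shows "0 < thr y (- x)"
proof -
  obtain d where d: "0 < d" "x - d *\<^sub>R y \<in> K" using sub_small assms by blast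
  then have "- (x - d *\<^sub>R y) \<notin> K" using neg_not_K by blast
  then have "\<not> d *\<^sub>R y + - x \<in> K" by simp
  then show ?thesis using d(1) thr_iff'[OF assms(1), of d "- x"] by simp
qed

text \<open>For the two thresholds m and n one has n(m y - x) + (n x - y) = (m n - 1) y, and both
  summands lie in the closed cone. So m n \<ge> 1, and for m n = 1 the summands are opposite, hence
  zero.\<close>

lemma thr_mult_ge:
  assumes "y \<in> K" "x \<in> K" shows "1 \<le> thr y (- x) * thr x (- y)"
    and "thr y (- x) * thr x (- y) = 1 \<Longrightarrow> x = thr y (- x) *\<^sub>R y"
proof -
  let ?m = "thr y (- x)" and ?n = "thr x (- y)"
  have a: "?m *\<^sub>R y + - x \<in> closure K" and b: "?n *\<^sub>R x + - y \<in> closure K"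
    using thr_boundary' assms by blast+
  have n: "0 < ?n" using thr_pos assms by blast
  have na: "?n *\<^sub>R (?m *\<^sub>R y + - x) \<in> closure K" using closure_scale a n by blast
  have e: "?n *\<^sub>R (?m *\<^sub>R y + - x) + (?n *\<^sub>R x + - y) = (?m * ?n - 1) *\<^sub>R y"
    by (simp add: algebra_simps)
  then have "(?m * ?n - 1) *\<^sub>R y \<in> closure K" using closure_add na b by metis
  then have "0 \<le> (?m * ?n - 1) * l y" using l_nonneg by fastforce
  then show "1 \<le> ?m * ?n" using l_pos_K assms(1) by (simp add: zero_le_mult_iff) (smt (verit))
  assume "?m * ?n = 1"
  then have "?n *\<^sub>R x + - y = - (?n *\<^sub>R (?m *\<^sub>R y + - x))" using e by (simp add: add_eq_0_iff)
  then have "?n *\<^sub>R (?m *\<^sub>R y + - x) = 0" using closure_K_antisym na b by metis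
  then show "x = ?m *\<^sub>R y" using n by simp
qed

lemma thr_closure_iff:
  assumes y: "y \<in> K" shows "r *\<^sub>R y + w \<in> closure K \<longleftrightarrow> thr y w \<le> r"
proof
  assume r: "r *\<^sub>R y + w \<in> closure K"
  have "thr y w < r'" if "r < r'" for r'
  proof -
    have "(r' - r) *\<^sub>R y + (r *\<^sub>R y + w) \<in> K" using that y r by (intro add_closure_K scale_K) auto
    then show ?thesis using thr_iff'[OF y] by (simp add: algebra_simps)
  qed
  then show "thr y w \<le> r" by (metis dense not_le order.asym)
next
  assume "thr y w \<le> r"
  then show "r *\<^sub>R y + w \<in> closure K"
    using thr_boundary'[OF y, of w] thr_iff'[OF y, of r w] closure_subset
    by (cases "thr y w = r") auto
qed

lemma thr_eqI':
  assumes "y \<in> K" "r *\<^sub>R y + w \<in> closure K - K" shows "thr y w = r"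
  using assms thr_closure_iff[OF assms(1), of r w] thr_iff'[OF assms(1), of r w] by auto

lemma closure_scale0: "y \<in> closure K \<Longrightarrow> K \<noteq> {} \<Longrightarrow> 0 \<le> c \<Longrightarrow> c *\<^sub>R y \<in> closure K"
proof (cases "c = 0")
  case True
  assume "K \<noteq> {}"
  then obtain k where k: "k \<in> K" by blast
  have "(\<lambda>n. inverse (Suc n) *\<^sub>R k) \<longlonglongrightarrow> 0 *\<^sub>R k"
    by (intro tendsto_intros LIMSEQ_inverse_real_of_nat)
  then have "0 \<in> closure K"
    using closure_K_I[of "\<lambda>n. inverse (Suc n) *\<^sub>R k"] scale_K[OF _ k] by simp
  then show ?thesis using True by simp
qed (use closure_scale in auto)

end

section \<open>The Hilbert distance in terms of the cone\<close>

text \<open>\<open>K\<close> is one of the two halves of the cone over \<Omega>, and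
  \<open>L / l\<close> is the very chart that \<open>hilbert_dist\<close> picks by choice, so that
  its cross ratio can be computed on lifts.\<close>

locale hilbert_cone = proper_cone K l B
  for K :: "('a::euclidean_space \<times> real) set" and l B +
  fixes \<Omega> :: "('a \<times> real) projective set" and L :: "'a \<times> real \<Rightarrow> 'a"
  assumes linear_L: "linear L" and inj_L: "\<And>x. L x = 0 \<Longrightarrow> l x = 0 \<Longrightarrow> x = 0"
    and Omega: "\<And>x. x \<noteq> 0 \<Longrightarrow> pt x \<in> \<Omega> \<longleftrightarrow> x \<in> K \<or> - x \<in> K"
    and chart: "\<And>x. l x \<noteq> 0 \<Longrightarrow> inv (SOME \<kappa>. proper_convex_chart \<Omega> \<kappa>) (pt x) = L x /\<^sub>R l x"
    and ne_K: "K \<noteq> {}"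
begin

lemma nonzero_K: "x \<in> K \<Longrightarrow> x \<noteq> 0"
  using zero_not_K by blast

lemma pt_in_Omega: "x \<in> K \<Longrightarrow> pt x \<in> \<Omega>"
  using Omega nonzero_K by blast

lemma ex_pt_K: "p \<in> \<Omega> \<Longrightarrow> \<exists>x\<in>K. p = pt x"
  using ex_pt[of p] Omega by (metis pt_uminus)

lemma closure_scale_nonneg: "y \<in> closure K \<Longrightarrow> 0 \<le> c \<Longrightarrow> c *\<^sub>R y \<in> closure K"
  using closure_scale0 ne_K by blast

section \<open>Frontier points of the domain and of its lines\<close>

lemma open_Omega: "open \<Omega>"
proof -
  have "{v. v \<noteq> 0 \<and> pt v \<in> \<Omega>} = K \<union> uminus -` K"
  proof (intro set_eqI)
    fix v :: "'a \<times> real"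
    have "v \<in> K \<or> - v \<in> K \<Longrightarrow> v \<noteq> 0" using zero_not_K by force
    then show "v \<in> {v. v \<noteq> 0 \<and> pt v \<in> \<Omega>} \<longleftrightarrow> v \<in> K \<union> uminus -` K" using Omega[of v] by blast
  qed
  moreover have "open (uminus -` K)"
    using open_K by (intro open_vimage continuous_intros)
  ultimately show ?thesis using open_K by (simp add: open_projective_iff open_Un)
qed

text \<open>For the harder direction: the complement of the closed double cone is open and stable
  under nonzero scalars, so its image is an open set disjoint from \<Omega>.\<close>

lemma pt_closure_Omega:
  assumes "x \<noteq> 0" shows "pt x \<in> closure \<Omega> \<longleftrightarrow> x \<in> closure K \<or> - x \<in> closure K"
proof
  have *: "pt x \<in> closure \<Omega>" if x: "x \<in> closure K" "x \<noteq> 0" for x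
  proof -
    obtain g where g: "\<forall>n. g n \<in> K" "g \<longlonglongrightarrow> x" using x closure_K_D by blast
    show ?thesis
    proof (rule Lim_in_closed_set)
      show "(\<lambda>n. pt (g n)) \<longlonglongrightarrow> pt x" using g x by (intro tendsto_pt)
      show "\<forall>\<^sub>F n in sequentially. pt (g n) \<in> closure \<Omega>"
        using g pt_in_Omega closure_subset by (intro always_eventually) blast
    qed auto
  qed
  assume "x \<in> closure K \<or> - x \<in> closure K"
  then show "pt x \<in> closure \<Omega>" using *[of x] *[of "-x"] assms by auto
next
  assume x: "pt x \<in> closure \<Omega>"
  define W where "W = - ({0} \<union> closure K \<union> uminus -` closure K)"
  have "closed (uminus -` closure K)" by (intro closed_vimage continuous_intros) auto
  then have "open W" unfolding W_def by (intro open_Compl closed_Un) auto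
  moreover have "0 \<notin> W" by (simp add: W_def)
  moreover have "c *\<^sub>R w \<in> W" if c: "c \<noteq> 0" and w: "w \<in> W" for c w
  proof (rule ccontr)
    assume "c *\<^sub>R w \<notin> W"
    then have "c *\<^sub>R w \<in> closure K \<or> - (c *\<^sub>R w) \<in> closure K" using c w by (auto simp: W_def)
    then have "(1 / \<bar>c\<bar>) *\<^sub>R (c *\<^sub>R w) \<in> closure K \<or> (1 / \<bar>c\<bar>) *\<^sub>R (- (c *\<^sub>R w)) \<in> closure K"
      using closure_scale c by (metis divide_pos_pos zero_less_abs_iff zero_less_one)
    then have "w \<in> closure K \<or> - w \<in> closure K" using c by (cases "0 < c") auto
    then show False using w by (auto simp: W_def)
  qed
  ultimately have "open (pt ` W)" by (rule open_pt_image)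
  moreover have "pt ` W \<inter> \<Omega> = {}"
  proof -
    have "pt w \<notin> \<Omega>" if "w \<in> W" for w
      using that Omega[of w] closure_subset by (auto simp: W_def)
    then show ?thesis by blast
  qed
  ultimately have "pt ` W \<inter> closure \<Omega> = {}" using open_Int_closure_eq_empty by blast
  then have "x \<notin> W" using x by blast
  then show "x \<in> closure K \<or> - x \<in> closure K" using assms by (auto simp: W_def)
qed

lemma pt_frontier_Omega:
  assumes "x \<noteq> 0" shows "pt x \<in> frontier \<Omega> \<longleftrightarrow> x \<in> closure K - K \<or> - x \<in> closure K - K"
  using pt_closure_Omega[OF assms] Omega[OF assms] neg_not_closure[of x] neg_not_closure[of "-x"]
    interior_open[OF open_Omega] by (auto simp: frontier_def)

definition k :: "'a \<times> real \<Rightarrow> 'a" where "k x = L x /\<^sub>R l x"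

text \<open>In the chart, a x + b y represents the barycentre of the two points with weights a l(x)
  and b l(y).\<close>

lemma k_dist:
  assumes "l x \<noteq> 0" "l y \<noteq> 0" "l (a *\<^sub>R x + b *\<^sub>R y) \<noteq> 0"
  shows "dist (k (a *\<^sub>R x + b *\<^sub>R y)) (k x) = \<bar>b * l y / l (a *\<^sub>R x + b *\<^sub>R y)\<bar> * dist (k x) (k y)"
proof -
  let ?z = "a *\<^sub>R x + b *\<^sub>R y"
  have lz: "l ?z = a * l x + b * l y" by simp
  have "l ?z *\<^sub>R k ?z = L ?z" using assms by (simp add: k_def)
  also have "\<dots> = a *\<^sub>R L x + b *\<^sub>R L y" using linear_L by (simp add: linear_add linear_cmul)
  also have "\<dots> = (a * l x) *\<^sub>R k x + (b * l y) *\<^sub>R k y"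
    using assms unfolding k_def scaleR_scaleR mult.assoc by simp
  finally have "l ?z *\<^sub>R (k ?z - k x) = (b * l y) *\<^sub>R (k y - k x)"
    unfolding scaleR_diff_right lz by (simp add: algebra_simps)
  then have "k ?z - k x = ((b * l y) / l ?z) *\<^sub>R (k y - k x)"
    using assms(3) by (metis (no_types, lifting) divideR_right divide_inverse_commute scaleR_scaleR)
  then show ?thesis by (simp add: dist_norm norm_minus_commute)
qed

lemma k_inj: "l x \<noteq> 0 \<Longrightarrow> l y \<noteq> 0 \<Longrightarrow> k x = k y \<Longrightarrow> x = (l x / l y) *\<^sub>R y"
proof -
  assume a: "l x \<noteq> 0" "l y \<noteq> 0" "k x = k y"
  have Lx: "L x = l x *\<^sub>R k x" and Ly: "L y = l y *\<^sub>R k y" using a(1,2) by (simp_all add: k_def)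
  have "L (x - (l x / l y) *\<^sub>R y) = L x - (l x / l y) *\<^sub>R L y"
    using linear_L by (simp add: linear_diff linear_cmul)
  also have "\<dots> = 0" unfolding Lx Ly a(3) using a(2) by simp
  finally have "L (x - (l x / l y) *\<^sub>R y) = 0" .
  moreover have "l (x - (l x / l y) *\<^sub>R y) = 0" using a by simp
  ultimately show ?thesis using inj_L by fastforce
qed

text \<open>The coefficients must have opposite signs, as \<open>K\<close> would otherwise contain
  z; dividing by the negative one puts z at a threshold.\<close>

lemma line_frontier_aux:
  assumes x: "x \<in> K" and y: "y \<in> K" and z: "z \<in> closure K - K" "z = a *\<^sub>R x + b *\<^sub>R y" "z \<noteq> 0"
    and a: "0 < a"
  shows "pt z = pt (thr x (- y) *\<^sub>R x - y)"
proof -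
  have b: "b < 0"
  proof (rule ccontr)
    assume "\<not> b < 0"
    then have "b *\<^sub>R y \<in> closure K" using y closure_subset by (intro closure_scale_nonneg) auto
    then show False using z add_closure_K[OF scale_K[OF a x]] by auto
  qed
  have e: "(1 / - b) *\<^sub>R z = (a / - b) *\<^sub>R x + - y"
    using b z(2) by (simp add: scaleR_add_right)
  have "(1 / - b) *\<^sub>R z \<in> closure K - K"
    using z b closure_scale[of z "1 / - b"] scale_K_iff[of "1 / - b" z] by auto
  then have "thr x (- y) = a / - b" using x by (intro thr_eqI') (simp_all only: e[symmetric])
  then have "(1 / - b) *\<^sub>R z = thr x (- y) *\<^sub>R x - y" using e by simp
  then show ?thesis using pt_scaleR[of "1 / - b" z] b by simp
qed

lemma line_frontier:
  assumes x: "x \<in> K" and y: "y \<in> K" and ne: "pt x \<noteq> pt y"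
  shows "proj_span {pt x, pt y} \<inter> frontier \<Omega> = {pt (thr y (- x) *\<^sub>R y - x), pt (thr x (- y) *\<^sub>R x - y)}"
proof (intro set_eqI iffI)
  fix p assume p: "p \<in> proj_span {pt x, pt y} \<inter> frontier \<Omega>"
  obtain z0 where z0: "z0 \<noteq> 0" "p = pt z0" using ex_pt by blast
  then have "z0 \<in> closure K - K \<or> - z0 \<in> closure K - K" using pt_frontier_Omega p by blast
  then obtain z where z: "z \<noteq> 0" "p = pt z" "z \<in> closure K - K" using z0 by (metis neg_equal_0_iff_equal pt_uminus)
  have "z \<in> span {x, y}" using p z pt_mem_proj_span_pair nonzero_K x y by blast
  then obtain a b where ab: "z = a *\<^sub>R x + b *\<^sub>R y" using mem_span_pair by blast
  consider "0 < a" | "0 < b" | "a \<le> 0" "b \<le> 0" by linarith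
  then show "p \<in> {pt (thr y (- x) *\<^sub>R y - x), pt (thr x (- y) *\<^sub>R x - y)}"
  proof cases
    case 1
    then show ?thesis using line_frontier_aux[OF x y z(3) ab z(1)] z(2) by simp
  next
    case 2
    then show ?thesis using line_frontier_aux[OF y x z(3) _ z(1), of b a] ab z(2) by (simp add: add.commute)
  next
    case 3
    then have "(- a) *\<^sub>R x + (- b) *\<^sub>R y \<in> closure K"
      using x y closure_subset by (intro closure_add closure_scale_nonneg) auto
    then have "- z \<in> closure K" using ab by simp
    then show ?thesis using closure_K_antisym z by blast
  qed
next
  have *: "pt (thr y (- x) *\<^sub>R y - x) \<in> proj_span {pt x, pt y} \<inter> frontier \<Omega>"
    if x: "x \<in> K" and y: "y \<in> K" and ne: "pt x \<noteq> pt y" for x y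
  proof -
    let ?z = "thr y (- x) *\<^sub>R y - x"
    have "?z \<noteq> 0"
    proof
      assume "?z = 0"
      then have "x = thr y (- x) *\<^sub>R y" by simp
      moreover have "thr y (- x) \<noteq> 0" using thr_pos x y by (metis less_irrefl)
      ultimately show False using ne pt_scaleR by metis
    qed
    moreover have "?z \<in> closure K - K" using thr_boundary'[OF y, of "-x"] by simp
    moreover have "?z \<in> span {x, y}" unfolding mem_span_pair
      by (intro exI[of _ "-1"] exI[of _ "thr y (- x)"]) simp
    ultimately show ?thesis using pt_frontier_Omega pt_mem_proj_span_pair nonzero_K x y by blast
  qed
  fix p assume "p \<in> {pt (thr y (- x) *\<^sub>R y - x), pt (thr x (- y) *\<^sub>R x - y)}"
  then show "p \<in> proj_span {pt x, pt y} \<inter> frontier \<Omega>"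
    using *[OF x y ne] *[OF y x] ne by (auto simp: insert_commute)
qed

text \<open>The factors coming from the chart cancel in the cross ratio, which becomes m n or, with
  the end points exchanged, 1 / (m n). As m n \<ge> 1, both have the same absolute logarithm ln (m
  n).\<close>

lemma hilbert_dist_pt:
  assumes x: "x \<in> K" and y: "y \<in> K"
  shows "hilbert_dist \<Omega> (pt x) (pt y) = ln (thr y (- x) * thr x (- y)) / 2"
proof (cases "pt x = pt y")
  case True
  then obtain c where c: "c \<noteq> 0" "x = c *\<^sub>R y" using pt_eq_iff nonzero_K x y by metis
  have "0 < c * l y" "0 < l y" using l_pos_K[OF x] l_pos_K[OF y] c by auto
  then have c0: "0 < c" by (simp add: zero_less_mult_iff)
  \<comment> \<open>Here x = c y, so r y - x vanishes at r = c, and 0 belongs to the closed cone but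
    not to \<open>K\<close>.\<close>
  have zz: "0 \<in> closure K - K" using closure_scale_nonneg[of y 0] closure_subset y zero_not_K by auto
  have "thr y (- x) = c" using y zz by (intro thr_eqI') (auto simp: c)
  moreover have "thr x (- y) = 1 / c" using x zz c0 by (intro thr_eqI') (auto simp: c)
  ultimately show ?thesis using True c0 by (simp add: hilbert_dist_def)
next
  case False
  define m n where "m = thr y (- x)" and "n = thr x (- y)"
  define a b where "a = m *\<^sub>R y - x" and "b = n *\<^sub>R x - y"
  define \<kappa> where "\<kappa> = (SOME \<kappa>. proper_convex_chart \<Omega> \<kappa>)"
  have mn: "0 < m" "0 < n" using thr_pos x y by (auto simp: m_def n_def)
  have ab: "a \<in> closure K - K" "b \<in> closure K - K"
    using thr_boundary'[OF y, of "-x"] thr_boundary'[OF x, of "-y"] by (auto simp: a_def b_def m_def n_def)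
  have "a \<noteq> 0" "b \<noteq> 0" using False mn pt_scaleR by (auto simp: a_def b_def)
  then have l: "0 < l a" "0 < l b" "0 < l x" "0 < l y" using l_pos ab l_pos_K x y by auto
  have inv: "inv \<kappa> (pt z) = k z" if "l z \<noteq> 0" for z
    using chart[OF that] by (simp add: \<kappa>_def k_def)
  have line: "proj_span {pt x, pt y} \<inter> frontier \<Omega> = {pt a, pt b}"
    using line_frontier[OF x y False] by (simp add: a_def b_def m_def n_def)
  let ?D = "dist (k x) (k y)"
  have "k x \<noteq> k y"
  proof
    assume "k x = k y"
    then have "x = (l x / l y) *\<^sub>R y" using k_inj l by simp
    moreover have "l x / l y \<noteq> 0" using l by simp
    ultimately show False using False pt_scaleR by metis
  qed
  then have D: "0 < ?D" by simp
  have e: "a = (-1) *\<^sub>R x + m *\<^sub>R y" "a = m *\<^sub>R y + (-1) *\<^sub>R x"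
    "b = n *\<^sub>R x + (-1) *\<^sub>R y" "b = (-1) *\<^sub>R y + n *\<^sub>R x"
    by (auto simp: a_def b_def)
  have d1: "dist (k a) (k x) = m * l y / l a * ?D"
    using k_dist[of x y "-1" m, folded e(1)] l mn by simp
  have d2: "dist (k a) (k y) = l x / l a * ?D"
    using k_dist[of y x m "-1", folded e(2)] l mn by (simp add: dist_commute)
  have d3: "dist (k b) (k x) = l y / l b * ?D"
    using k_dist[of x y n "-1", folded e(3)] l mn by simp
  have d4: "dist (k b) (k y) = n * l x / l b * ?D"
    using k_dist[of y x "-1" n, folded e(4)] l mn by (simp add: dist_commute)
  have cr: "cross_ratio (k a) (k b) (k x) (k y) = m * n"
    unfolding cross_ratio_def d1 d2 d3 d4 using l mn D by (simp add: field_simps)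
  have cr': "cross_ratio (k b) (k a) (k x) (k y) = 1 / (m * n)"
    unfolding cross_ratio_def d1 d2 d3 d4 using l mn D by (simp add: field_simps)
  have "1 \<le> m * n" using thr_mult_ge(1) x y by (simp add: m_def n_def)
  then have abs: "\<bar>ln (m * n)\<bar> = ln (m * n)" "\<bar>ln (1 / (m * n))\<bar> = ln (m * n)"
    using mn by (auto simp: ln_div)
  have "(THE r. \<exists>p q. proj_span {pt x, pt y} \<inter> frontier \<Omega> = {p, q} \<and>
         r = \<bar>ln (cross_ratio (inv \<kappa> p) (inv \<kappa> q) (inv \<kappa> (pt x)) (inv \<kappa> (pt y)))\<bar> / 2) = ln (m * n) / 2"
  proof (rule the_equality)
    show "\<exists>p q. proj_span {pt x, pt y} \<inter> frontier \<Omega> = {p, q} \<and>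
         ln (m * n) / 2 = \<bar>ln (cross_ratio (inv \<kappa> p) (inv \<kappa> q) (inv \<kappa> (pt x)) (inv \<kappa> (pt y)))\<bar> / 2"
      using l cr abs by (intro exI[of _ "pt a"] exI[of _ "pt b"]) (simp add: inv line)
  next
    fix r assume "\<exists>p q. proj_span {pt x, pt y} \<inter> frontier \<Omega> = {p, q} \<and>
         r = \<bar>ln (cross_ratio (inv \<kappa> p) (inv \<kappa> q) (inv \<kappa> (pt x)) (inv \<kappa> (pt y)))\<bar> / 2"
    then obtain p q where pq: "{pt a, pt b} = {p, q}"
      and r: "r = \<bar>ln (cross_ratio (inv \<kappa> p) (inv \<kappa> q) (inv \<kappa> (pt x)) (inv \<kappa> (pt y)))\<bar> / 2"
      using line by auto
    from pq have "p = pt a \<and> q = pt b \<or> p = pt b \<and> q = pt a" by (simp add: doubleton_eq_iff) blast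
    then show "r = ln (m * n) / 2"
      using r l cr cr' abs by (auto simp: inv)
  qed
  then show ?thesis using False by (simp add: hilbert_dist_def Let_def \<kappa>_def m_def n_def)
qed

end

section \<open>Radial lines and horospheres\<close>

text \<open>Leaves only the two orientations for an arc length parametrization of a line.\<close>

lemma isometry_real:
  fixes \<phi> :: "real \<Rightarrow> real"
  assumes "\<And>s t. \<bar>\<phi> s - \<phi> t\<bar> = \<bar>s - t\<bar>" "\<phi> 0 = 0"
  shows "(\<forall>t. \<phi> t = t) \<or> (\<forall>t. \<phi> t = - t)"
proof (rule ccontr)
  assume "\<not> ?thesis"
  then obtain s t where "\<phi> s \<noteq> s" "\<phi> t \<noteq> - t" by auto
  then show False using assms(1)[of s 0] assms(1)[of t 0] assms(1)[of s t] assms(2)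
    by (simp add: abs_if split: if_splits)
qed

lemma exp_at_right_0: "filterlim (\<lambda>t::real. exp (- 2 * t)) (at_right 0) at_top"
proof -
  have "((\<lambda>t::real. exp (- 2 * t)) \<longlongrightarrow> 0) at_top"
    by (intro filterlim_compose[OF exp_at_bot] filterlim_tendsto_neg_mult_at_bot[OF tendsto_const])
       (auto intro: filterlim_ident)
  then show ?thesis by (auto simp: filterlim_at)
qed

locale horo_cone = hilbert_cone K l B \<Omega> L
  for K :: "('a::euclidean_space \<times> real) set" and l B \<Omega> L +
  fixes X :: "'a \<times> real"
  assumes X_closure: "X \<in> closure K" and X_not_K: "X \<notin> K" and X_nonzero: "X \<noteq> 0"
begin

lemma scaleR_X_not_K: "c *\<^sub>R X \<notin> K"
proof
  assume c: "c *\<^sub>R X \<in> K"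
  show False
  proof (cases "0 < c")
    case True
    then show False using c X_not_K scale_K_iff by blast
  next
    case False
    then have "- (c *\<^sub>R X) \<in> closure K" using closure_scale_nonneg[OF X_closure, of "- c"] by simp
    then show False using c neg_not_closure by blast
  qed
qed

lemma lX: "0 < l X" using l_pos X_closure X_nonzero by blast

text \<open>The ray of such a vector is the second end point of a line through x+, and its scale
  singles out a point: X + r Q runs through the line as r > 0 varies.\<close>

definition ends :: "('a \<times> real) set"
  where "ends = {Q. Q \<in> closure K \<and> Q \<notin> K \<and> X + Q \<in> K}"

lemma ends_segment: "Q \<in> ends \<Longrightarrow> 0 < r \<Longrightarrow> X + r *\<^sub>R Q \<in> K"
proof -
  assume Q: "Q \<in> ends" and r: "0 < r"
  show ?thesis
  proof (cases "r \<le> 1")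
    case True
    have "r *\<^sub>R (X + Q) + (1 - r) *\<^sub>R X \<in> K"
      using Q r True X_closure
      by (intro add_closure_K[of "r *\<^sub>R (X + Q)"] scale_K closure_scale_nonneg) (auto simp: ends_def)
    then show ?thesis by (simp add: algebra_simps)
  next
    case False
    have "(X + Q) + (r - 1) *\<^sub>R Q \<in> K"
      using Q r False by (intro add_closure_K[of "X + Q"] closure_scale_nonneg) (auto simp: ends_def)
    then show ?thesis by (simp add: algebra_simps)
  qed
qed

lemma ends_scale: "Q \<in> ends \<Longrightarrow> 0 < r \<Longrightarrow> r *\<^sub>R Q \<in> ends"
  using ends_segment scale_K_iff closure_scale by (auto simp: ends_def)

lemma ends_nonzero: "Q \<in> ends \<Longrightarrow> Q \<noteq> 0"
  using X_not_K by (auto simp: ends_def)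

text \<open>The largest multiple of X that can be subtracted from a lift within the closed cone
  leaves the other end point. The supremum is finite because l X > 0; the final division normalises
  the coefficient of X to 1.\<close>

lemma ex_ends: "p \<in> \<Omega> \<Longrightarrow> \<exists>Q\<in>ends. p = pt (X + Q)"
proof -
  assume "p \<in> \<Omega>"
  then obtain x where x: "x \<in> K" "p = pt x" using ex_pt_K by blast
  define S where "S = {r. x - r *\<^sub>R X \<in> K}"
  have lS: "r * l X < l x" if "r \<in> S" for r
    using l_pos_K[of "x - r *\<^sub>R X"] that by (simp add: S_def)
  have bdd: "bdd_above S"
    by (rule bdd_aboveI[of _ "l x / l X"]) (use lS lX in \<open>simp add: less_imp_le pos_le_divide_eq\<close>)
  obtain d where d: "0 < d" "d \<in> S" using sub_small[OF x(1), of X] by (auto simp: S_def)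
  define m where "m = Sup S"
  have m: "0 < m" using d bdd cSup_upper m_def less_le_trans by metis
  have "x - m *\<^sub>R X \<notin> K"
  proof
    assume "x - m *\<^sub>R X \<in> K"
    then obtain e where "0 < e" "x - m *\<^sub>R X - e *\<^sub>R X \<in> K" using sub_small by blast
    then have "m + e \<in> S" by (simp add: S_def algebra_simps)
    then show False using bdd cSup_upper[of "m + e" S] \<open>0 < e\<close> by (simp add: m_def)
  qed
  moreover have "x - m *\<^sub>R X \<in> closure K"
  proof (rule closure_K_I)
    fix n :: nat
    obtain r where r: "r \<in> S" "m - inverse (Suc n) < r"
      using less_cSupD[of S "m - inverse (Suc n)"] d by (auto simp: m_def)
    have "(x - r *\<^sub>R X) + (r - (m - inverse (Suc n))) *\<^sub>R X \<in> K"
      using r X_closure by (intro add_closure_K closure_scale_nonneg) (auto simp: S_def)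
    then show "x - (m - inverse (Suc n)) *\<^sub>R X \<in> K" by (simp add: algebra_simps)
  next
    have "(\<lambda>n. x - (m - inverse (Suc n)) *\<^sub>R X) \<longlonglongrightarrow> x - (m - 0) *\<^sub>R X"
      by (intro tendsto_intros LIMSEQ_inverse_real_of_nat)
    then show "(\<lambda>n. x - (m - inverse (Suc n)) *\<^sub>R X) \<longlonglongrightarrow> x - m *\<^sub>R X" by simp
  qed
  moreover have e: "X + (1 / m) *\<^sub>R (x - m *\<^sub>R X) = (1 / m) *\<^sub>R x"
    using m by (simp add: scaleR_diff_right)
  ultimately have "(1 / m) *\<^sub>R (x - m *\<^sub>R X) \<in> ends"
    unfolding ends_def using m x scale_K_iff[of "1 / m"] closure_scale[of _ "1 / m"] by auto
  moreover have "p = pt (X + (1 / m) *\<^sub>R (x - m *\<^sub>R X))" using x m unfolding e by simp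
  ultimately show ?thesis by blast
qed

text \<open>With x = X + r Q and y = X + r' Q, the vector y - x is a multiple of Q and (r' / r) x -
  y is a multiple of X. Neither lies in the open cone, so the thresholds are 1 and r' / r.\<close>

lemma hilbert_dist_radial_less:
  assumes Q: "Q \<in> ends" and r: "0 < r" "r \<le> r'"
  shows "hilbert_dist \<Omega> (pt (X + r *\<^sub>R Q)) (pt (X + r' *\<^sub>R Q)) = (ln r' - ln r) / 2"
    and "hilbert_dist \<Omega> (pt (X + r' *\<^sub>R Q)) (pt (X + r *\<^sub>R Q)) = (ln r' - ln r) / 2"
proof -
  let ?x = "X + r *\<^sub>R Q" and ?y = "X + r' *\<^sub>R Q"
  have x: "?x \<in> K" and y: "?y \<in> K" using ends_segment[OF Q] r by auto
  have Qc: "Q \<in> closure K" "Q \<notin> K" using Q by (auto simp: ends_def)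
  have z: "c *\<^sub>R Q \<in> closure K - K" if "0 \<le> c" for c
    using closure_scale_nonneg[OF Qc(1) that] Qc(2) that scale_K_iff[of c Q] zero_not_K by (cases "c = 0") auto
  have zX: "c *\<^sub>R X \<in> closure K - K" if "0 \<le> c" for c
    using X_closure scaleR_X_not_K closure_scale_nonneg that by auto
  have "1 *\<^sub>R ?y + - ?x \<in> closure K - K" using z[of "r' - r"] r by (simp add: algebra_simps)
  then have 1: "thr ?y (- ?x) = 1" using y thr_eqI' by blast
  have "(r' / r) *\<^sub>R ?x + - ?y = (r' / r - 1) *\<^sub>R X" using r by (simp add: algebra_simps)
  then have "(r' / r) *\<^sub>R ?x + - ?y \<in> closure K - K" using zX[of "r' / r - 1"] r by simp
  then have 2: "thr ?x (- ?y) = r' / r" using x thr_eqI' by blast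
  show "hilbert_dist \<Omega> (pt ?x) (pt ?y) = (ln r' - ln r) / 2"
    unfolding hilbert_dist_pt[OF x y] 1 2 using r by (simp add: ln_div)
  show "hilbert_dist \<Omega> (pt ?y) (pt ?x) = (ln r' - ln r) / 2"
    unfolding hilbert_dist_pt[OF y x] 1 2 using r by (simp add: ln_div)
qed

lemma hilbert_dist_radial:
  assumes "Q \<in> ends" "0 < r" "0 < r'"
  shows "hilbert_dist \<Omega> (pt (X + r *\<^sub>R Q)) (pt (X + r' *\<^sub>R Q)) = \<bar>ln r' - ln r\<bar> / 2"
proof (cases "r \<le> r'")
  case True
  then show ?thesis using hilbert_dist_radial_less(1)[of Q r r'] assms by simp
next
  case False
  then show ?thesis using hilbert_dist_radial_less(2)[of Q r' r] assms by simp
qed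

text \<open>Write z = a X + b Q. If b \<le> 0, adding - b Q would put a multiple of X into
  \<open>K\<close>; if a \<le> 0, adding - a X would put a multiple of Q there.\<close>

lemma radial_segment:
  assumes Q: "Q \<in> ends" and p: "p \<in> \<Omega> \<inter> proj_span {pt (X + Q), pt X}"
  shows "\<exists>r>0. p = pt (X + r *\<^sub>R Q)"
proof -
  obtain z where z: "z \<in> K" "p = pt z" using p ex_pt_K by blast
  have Qc: "Q \<in> closure K" "Q \<notin> K" "X + Q \<noteq> 0" using Q nonzero_K by (auto simp: ends_def)
  have "z \<in> span {X + Q, X}"
    using p z pt_mem_proj_span_pair[of z "X + Q" X] nonzero_K Qc X_nonzero by blast
  then obtain b a' where ab': "z = b *\<^sub>R (X + Q) + a' *\<^sub>R X" using mem_span_pair by blast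
  define a where "a = b + a'"
  have ab: "z = a *\<^sub>R X + b *\<^sub>R Q" using ab' by (simp add: a_def algebra_simps)
  have b: "0 < b"
  proof (rule ccontr)
    assume "\<not> 0 < b"
    then have "z + (- b) *\<^sub>R Q \<in> K" using z Qc by (intro add_closure_K closure_scale_nonneg) auto
    then show False using scaleR_X_not_K ab by simp
  qed
  have a: "0 < a"
  proof (rule ccontr)
    assume "\<not> 0 < a"
    then have "z + (- a) *\<^sub>R X \<in> K" using z X_closure by (intro add_closure_K closure_scale_nonneg) auto
    then show False using ab b Qc scale_K_iff by simp
  qed
  have "z = a *\<^sub>R (X + (b / a) *\<^sub>R Q)" using ab a by (simp add: scaleR_add_right)
  then have "p = pt (X + (b / a) *\<^sub>R Q)" using z a by (metis less_irrefl pt_scaleR)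
  then show ?thesis using a b by (intro exI[of _ "b / a"]) simp
qed

text \<open>The 2 in the exponent undoes the 1 / 2 of the Hilbert distance. For uniqueness, - ln r /
  2 is an isometric coordinate on the line, so a second candidate could only be the reversed
  curve.\<close>

lemma radial_line_eq:
  assumes Q: "Q \<in> ends"
  shows "radial_line \<Omega> (pt X) (pt (X + Q)) = (\<lambda>t. pt (X + exp (- 2 * t) *\<^sub>R Q))"
proof -
  have seg: "X + r *\<^sub>R Q \<in> K" if "0 < r" for r using ends_segment Q that by blast
  have XQ: "X + Q \<noteq> 0" using seg[of 1] nonzero_K by auto
  have exp0: "((\<lambda>t::real. exp (- 2 * t)) \<longlongrightarrow> 0) at_top"
    using exp_at_right_0 by (simp add: filterlim_at)
  show ?thesis
    unfolding radial_line_def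
  proof (rule the_equality)
    let ?c = "\<lambda>t::real. pt (X + exp (- 2 * t) *\<^sub>R Q)"
    have "?c t \<in> \<Omega>" for t using pt_in_Omega seg by simp
    moreover have "?c t \<in> proj_span {pt (X + Q), pt X}" for t
    proof -
      have "X + exp (- 2 * t) *\<^sub>R Q = exp (- 2 * t) *\<^sub>R (X + Q) + (1 - exp (- 2 * t)) *\<^sub>R X"
        by (simp add: algebra_simps)
      then have "X + exp (- 2 * t) *\<^sub>R Q \<in> span {X + Q, X}" unfolding mem_span_pair by blast
      then show ?thesis
        using pt_mem_proj_span_pair[of "X + exp (- 2 * t) *\<^sub>R Q" "X + Q" X] seg nonzero_K XQ X_nonzero
        by (metis exp_gt_zero)
    qed
    moreover have "hilbert_dist \<Omega> (?c s) (?c t) = \<bar>s - t\<bar>" for s t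
      using hilbert_dist_radial[OF Q exp_gt_zero exp_gt_zero, of "- 2 * s" "- 2 * t"] by simp
    moreover have "(?c \<longlongrightarrow> pt X) at_top"
    proof (rule tendsto_pt)
      have "((\<lambda>t. X + exp (- 2 * t) *\<^sub>R Q) \<longlongrightarrow> X + 0 *\<^sub>R Q) at_top"
        by (intro tendsto_intros exp0)
      then show "((\<lambda>t. X + exp (- 2 * t) *\<^sub>R Q) \<longlongrightarrow> X) at_top" by simp
    qed (rule X_nonzero)
    ultimately show "(\<forall>t. ?c t \<in> \<Omega> \<inter> proj_span {pt (X + Q), pt X}) \<and>
       (\<forall>s t. hilbert_dist \<Omega> (?c s) (?c t) = \<bar>s - t\<bar>) \<and> ?c 0 = pt (X + Q) \<and> (?c \<longlongrightarrow> pt X) at_top"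
      by simp
  next
    fix c :: "real \<Rightarrow> ('a \<times> real) projective"
    assume c: "(\<forall>t. c t \<in> \<Omega> \<inter> proj_span {pt (X + Q), pt X}) \<and>
       (\<forall>s t. hilbert_dist \<Omega> (c s) (c t) = \<bar>s - t\<bar>) \<and> c 0 = pt (X + Q) \<and> (c \<longlongrightarrow> pt X) at_top"
    have "\<forall>t. \<exists>r>0. c t = pt (X + r *\<^sub>R Q)" using c radial_segment[OF Q] by blast
    then obtain \<rho> where \<rho>: "\<And>t. 0 < \<rho> t" "\<And>t. c t = pt (X + \<rho> t *\<^sub>R Q)" by metis
    define \<phi> where "\<phi> t = - ln (\<rho> t) / 2" for t
    have \<rho>e: "\<rho> t = exp (- 2 * \<phi> t)" for t using \<rho>(1)[of t] by (simp add: \<phi>_def)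
    have iso: "\<bar>\<phi> s - \<phi> t\<bar> = \<bar>s - t\<bar>" for s t
    proof -
      have "\<bar>s - t\<bar> = hilbert_dist \<Omega> (pt (X + \<rho> s *\<^sub>R Q)) (pt (X + \<rho> t *\<^sub>R Q))" using c \<rho>(2) by metis
      also have "\<dots> = \<bar>ln (\<rho> t) - ln (\<rho> s)\<bar> / 2" using hilbert_dist_radial[OF Q] \<rho>(1) by blast
      also have "\<dots> = \<bar>\<phi> s - \<phi> t\<bar>" by (simp add: \<phi>_def abs_if)
      finally show ?thesis by simp
    qed
    have "\<phi> 0 = 0"
    proof -
      have "0 = hilbert_dist \<Omega> (c 0) (pt (X + 1 *\<^sub>R Q))" using c by (simp add: hilbert_dist_def)
      also have "\<dots> = \<bar>ln 1 - ln (\<rho> 0)\<bar> / 2" unfolding \<rho>(2) using hilbert_dist_radial[OF Q \<rho>(1) zero_less_one, of 0] by simp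
      finally show ?thesis by (simp add: \<phi>_def)
    qed
    with iso have "(\<forall>t. \<phi> t = t) \<or> (\<forall>t. \<phi> t = - t)" by (rule isometry_real)
    then show "c = (\<lambda>t. pt (X + exp (- 2 * t) *\<^sub>R Q))"
    proof
      \<comment> \<open>The reversed curve converges to the other end point, as the rescaled lift
        \<open>?g\<close> shows. Two limits would make Q a multiple of X, and then X + Q could not
        lie in \<open>K\<close>.\<close>
      assume "\<forall>t. \<phi> t = - t"
      let ?g = "\<lambda>t. exp (- 2 * t) *\<^sub>R X + Q"
      have gc: "c t = pt (?g t)" for t
      proof -
        have "X + \<rho> t *\<^sub>R Q = exp (2 * t) *\<^sub>R ?g t"
          using \<open>\<forall>t. \<phi> t = - t\<close> by (simp add: \<rho>e scaleR_add_right exp_minus)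
        then show ?thesis using \<rho>(2) by (metis exp_not_eq_zero pt_scaleR)
      qed
      have g0: "?g t \<noteq> 0" for t
      proof -
        have "exp (2 * t) *\<^sub>R ?g t = X + exp (2 * t) *\<^sub>R Q" by (simp add: scaleR_add_right exp_minus)
        then show ?thesis using seg[of "exp (2 * t)"] nonzero_K by (metis exp_gt_zero scaleR_zero_right)
      qed
      have lQ: "0 < l Q" using l_pos[of Q] Q ends_nonzero by (auto simp: ends_def)
      have "(?g \<longlongrightarrow> 0 *\<^sub>R X + Q) at_top" by (intro tendsto_intros exp0)
      then have "((\<lambda>t. pt (?g t)) \<longlongrightarrow> pt Q) at_top" using ends_nonzero[OF Q] by (intro tendsto_pt) auto
      then have 1: "((\<lambda>t. k (?g t)) \<longlongrightarrow> k Q) at_top" unfolding k_def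
        using lQ g0 by (intro tendsto_homogeneous linear_L linear_l) auto
      have "c = (\<lambda>t. pt (?g t))" using gc by (rule ext)
      then have "((\<lambda>t. pt (?g t)) \<longlongrightarrow> pt X) at_top" using c by blast
      then have 2: "((\<lambda>t. k (?g t)) \<longlongrightarrow> k X) at_top" unfolding k_def
        using lX g0 by (intro tendsto_homogeneous linear_L linear_l) auto
      have "k Q = k X" using tendsto_unique[OF _ 1 2] by simp
      then have "Q = (l Q / l X) *\<^sub>R X" using k_inj lQ lX by simp
      then have "X + Q = (1 + l Q / l X) *\<^sub>R X" by (metis scaleR_add_left scaleR_one)
      then show ?thesis using seg[of 1] scaleR_X_not_K by (metis scaleR_one zero_less_one)
    qed (use \<rho> \<rho>e in auto)
  qed
qed

text \<open>The tangent cone of \<open>\<Omega>\<close> at \<open>x\<^sup>+\<close>, lifted and saturated along \<open>X\<close>.\<close>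

definition tcone :: "('a \<times> real) set"
  where "tcone = {z. \<exists>c. z + c *\<^sub>R X \<in> K}"

lemma K_inf_up:
  assumes "z + c *\<^sub>R X \<in> K" "c \<le> c'" shows "z + c' *\<^sub>R X \<in> K"
proof -
  have "(z + c *\<^sub>R X) + (c' - c) *\<^sub>R X \<in> K"
    using assms X_closure by (intro add_closure_K[of "z + c *\<^sub>R X"] closure_scale_nonneg) auto
  then show ?thesis by (simp add: algebra_simps)
qed

sublocale T: open_cone tcone
proof
  have "tcone = (\<Union>c. (\<lambda>z. z + c *\<^sub>R X) -` K)" unfolding tcone_def by blast
  moreover have "open ((\<lambda>z. z + c *\<^sub>R X) -` K)" for c
    using open_K by (intro open_vimage continuous_intros)
  ultimately show "open tcone" by auto
next
  fix x y assume "x \<in> tcone" "y \<in> tcone"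
  then obtain c d where "x + c *\<^sub>R X \<in> K" "y + d *\<^sub>R X \<in> K" by (auto simp: tcone_def)
  then have "(x + c *\<^sub>R X) + (y + d *\<^sub>R X) \<in> K" by (rule add_K)
  then have "(x + y) + (c + d) *\<^sub>R X \<in> K" by (simp add: algebra_simps)
  then show "x + y \<in> tcone" by (auto simp: tcone_def)
next
  fix c :: real and x assume "0 < c" "x \<in> tcone"
  then obtain d where "x + d *\<^sub>R X \<in> K" by (auto simp: tcone_def)
  then have "c *\<^sub>R (x + d *\<^sub>R X) \<in> K" using \<open>0 < c\<close> scale_K by blast
  then have "c *\<^sub>R x + (c * d) *\<^sub>R X \<in> K" by (simp add: scaleR_add_right)
  then show "c *\<^sub>R x \<in> tcone" by (auto simp: tcone_def)
qed

lemma K_subset_K_inf: "K \<subseteq> tcone"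
  by (auto simp: tcone_def intro!: exI[of _ 0])

lemma ends_K_inf: "Q \<in> ends \<Longrightarrow> Q \<in> tcone"
  by (auto simp: ends_def tcone_def add.commute intro!: exI[of _ 1])

lemma K_inf_add_X [simp]: "z + c *\<^sub>R X \<in> tcone \<longleftrightarrow> z \<in> tcone"
proof
  assume "z + c *\<^sub>R X \<in> tcone"
  then obtain d where "z + c *\<^sub>R X + d *\<^sub>R X \<in> K" by (auto simp: tcone_def)
  then show "z \<in> tcone" unfolding tcone_def add.assoc scaleR_add_left[symmetric] by blast
next
  assume "z \<in> tcone"
  then obtain d where "z + d *\<^sub>R X \<in> K" by (auto simp: tcone_def)
  then have "z + c *\<^sub>R X + (d - c) *\<^sub>R X \<in> K" by (simp add: algebra_simps)
  then show "z + c *\<^sub>R X \<in> tcone" unfolding tcone_def by blast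
qed

lemma zero_not_K_inf: "0 \<notin> tcone"
  using scaleR_X_not_K by (auto simp: tcone_def)

lemma neg_not_K_inf: "z \<in> tcone \<Longrightarrow> - z \<notin> tcone"
  using T.add_K[of z "-z"] zero_not_K_inf by auto

section \<open>Thresholds in the tangent cone and limits of distances\<close>

lemma T_thr_iff:
  assumes "P \<in> tcone" "Q \<in> tcone" shows "r *\<^sub>R P + - Q \<in> tcone \<longleftrightarrow> T.thr P (- Q) < r"
  using T.thr_iff[OF assms(1), of 0 "-Q"] neg_not_K_inf[OF assms(2)] by simp

lemma T_thr_pos:
  assumes "P \<in> tcone" "Q \<in> tcone" shows "0 < T.thr P (- Q)"
proof -
  obtain d where d: "0 < d" "Q - d *\<^sub>R P \<in> tcone" using T.sub_small assms by blast
  then have "- (Q - d *\<^sub>R P) \<notin> tcone" using neg_not_K_inf by blast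
  then have "\<not> d *\<^sub>R P + - Q \<in> tcone" by simp
  then show ?thesis using d(1) T_thr_iff[OF assms, of d] by simp
qed

lemma T_thr_scale:
  assumes "P \<in> tcone" "Q \<in> tcone" "0 < c"
  shows "T.thr P (- (c *\<^sub>R Q)) = c * T.thr P (- Q)" and "T.thr (c *\<^sub>R P) (- Q) = T.thr P (- Q) / c"
proof -
  show "T.thr P (- (c *\<^sub>R Q)) = c * T.thr P (- Q)"
  proof (rule T.thr_eqI)
    fix r
    have "r *\<^sub>R P + - (c *\<^sub>R Q) = c *\<^sub>R ((r / c) *\<^sub>R P + - Q)"
      using assms by (simp add: algebra_simps)
    then show "r *\<^sub>R P + - (c *\<^sub>R Q) \<in> tcone \<longleftrightarrow> c * T.thr P (- Q) < r"
      using T.scale_K_iff[OF assms(3)] T_thr_iff[OF assms(1,2), of "r / c"] assms(3)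
      by (simp add: pos_less_divide_eq mult.commute)
  qed (rule assms)
  show "T.thr (c *\<^sub>R P) (- Q) = T.thr P (- Q) / c"
  proof (rule T.thr_eqI)
    fix r
    show "r *\<^sub>R c *\<^sub>R P + - Q \<in> tcone \<longleftrightarrow> T.thr P (- Q) / c < r"
      using T_thr_iff[OF assms(1,2), of "r * c"] assms(3) by (simp add: field_simps)
  qed (use assms T.scale_K in auto)
qed

text \<open>The antisymmetry behind \<open>thr_mult_ge\<close> fails for a cone that is not proper.
  Instead, a product below 1 would give an r with both (1 / r) P - Q and r Q - P in the open cone,
  and then 0 would be there as well.\<close>

lemma T_thr_mult_ge:
  assumes "P \<in> tcone" "Q \<in> tcone"
  shows "1 \<le> T.thr P (- Q) * T.thr Q (- P)"
proof (rule ccontr)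
  assume a: "\<not> ?thesis"
  have "0 < T.thr P (- Q)" using T_thr_pos assms by blast
  then have "T.thr Q (- P) < 1 / T.thr P (- Q)" using a by (simp add: field_simps)
  then obtain r where r: "T.thr Q (- P) < r" "r < 1 / T.thr P (- Q)" using dense by blast
  have r0: "0 < r" using r(1) T_thr_pos[OF assms(2,1)] by linarith
  then have "T.thr P (- Q) < 1 / r" using r(2) \<open>0 < T.thr P (- Q)\<close> by (simp add: field_simps)
  then have "(1 / r) *\<^sub>R P + - Q \<in> tcone" using T_thr_iff assms by blast
  then have 1: "r *\<^sub>R ((1 / r) *\<^sub>R P + - Q) \<in> tcone" using T.scale_K r0 by blast
  have "r *\<^sub>R Q + - P \<in> tcone" using T_thr_iff assms r(1) by blast
  with 1 have "r *\<^sub>R ((1 / r) *\<^sub>R P + - Q) + (r *\<^sub>R Q + - P) \<in> tcone" by (rule T.add_K)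
  then show False using r0 zero_not_K_inf by (simp add: algebra_simps)
qed

lemma thr_less_iff:
  assumes P: "P \<in> ends" and e: "0 < \<epsilon>"
  shows "thr (X + \<epsilon> *\<^sub>R P) (- (X + \<epsilon> *\<^sub>R Q)) < r \<longleftrightarrow> (r *\<^sub>R P - Q) + ((r - 1) / \<epsilon>) *\<^sub>R X \<in> K"
proof -
  have "\<epsilon> *\<^sub>R ((r *\<^sub>R P - Q) + ((r - 1) / \<epsilon>) *\<^sub>R X) = (\<epsilon> * r) *\<^sub>R P - \<epsilon> *\<^sub>R Q + (r - 1) *\<^sub>R X"
    using e by (simp add: scaleR_add_right scaleR_diff_right)
  also have "\<dots> = r *\<^sub>R (X + \<epsilon> *\<^sub>R P) + - (X + \<epsilon> *\<^sub>R Q)"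
    by (simp add: algebra_simps)
  finally show ?thesis
    using thr_iff'[OF ends_segment[OF P e], of r "- (X + \<epsilon> *\<^sub>R Q)"] scale_K_iff[OF e] by metis
qed

text \<open>In \<open>thr_less_iff\<close> the value r comes with the multiple (r - 1) / \<epsilon>
  of X. For r > 1 this grows without bound, so that only membership in the tangent cone matters; for
  r < 1 it tends to minus infinity and makes \<open>l\<close> negative. Hence the maximum with
  1.\<close>

lemma thr_limit:
  assumes P: "P \<in> ends" and Q: "Q \<in> ends"
  shows "((\<lambda>\<epsilon>. thr (X + \<epsilon> *\<^sub>R P) (- (X + \<epsilon> *\<^sub>R Q))) \<longlongrightarrow> max 1 (T.thr P (- Q))) (at_right 0)"
proof (rule order_tendstoI)
  have Ki: "P \<in> tcone" "Q \<in> tcone" using ends_K_inf P Q by auto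
  have eps: "\<forall>\<^sub>F \<epsilon> in at_right 0. 0 < (\<epsilon>::real)" by (simp add: eventually_at_right_less)
  have inv: "filterlim (\<lambda>\<epsilon>. inverse \<epsilon> :: real) at_top (at_right 0)" by (rule filterlim_inverse_at_top_right)
  fix a assume a: "max 1 (T.thr P (- Q)) < a"
  then have "a *\<^sub>R P + - Q \<in> tcone" using T_thr_iff[OF Ki] by simp
  then obtain c where c: "a *\<^sub>R P - Q + c *\<^sub>R X \<in> K" by (auto simp: tcone_def)
  have "\<forall>\<^sub>F \<epsilon> in at_right 0. c / (a - 1) \<le> inverse \<epsilon>"
    using inv by (simp add: filterlim_at_top)
  then show "\<forall>\<^sub>F \<epsilon> in at_right 0. thr (X + \<epsilon> *\<^sub>R P) (- (X + \<epsilon> *\<^sub>R Q)) < a"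
    using eps
  proof eventually_elim
    case (elim \<epsilon>)
    then have "c \<le> (a - 1) / \<epsilon>" using a by (simp add: field_simps)
    then show ?case using K_inf_up[OF c] thr_less_iff[OF P] elim by blast
  qed
next
  have Ki: "P \<in> tcone" "Q \<in> tcone" using ends_K_inf P Q by auto
  have eps: "\<forall>\<^sub>F \<epsilon> in at_right 0. 0 < (\<epsilon>::real)" by (simp add: eventually_at_right_less)
  have inv: "filterlim (\<lambda>\<epsilon>. inverse \<epsilon> :: real) at_top (at_right 0)" by (rule filterlim_inverse_at_top_right)
  fix a assume a: "a < max 1 (T.thr P (- Q))"
  then obtain b where b: "a < b" "b < max 1 (T.thr P (- Q))" using dense by blast
  show "\<forall>\<^sub>F \<epsilon> in at_right 0. a < thr (X + \<epsilon> *\<^sub>R P) (- (X + \<epsilon> *\<^sub>R Q))"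
  proof (cases "b < 1")
    case True
    have "\<forall>\<^sub>F \<epsilon> in at_right 0. l (b *\<^sub>R P - Q) / ((1 - b) * l X) \<le> inverse \<epsilon>"
      using inv by (simp add: filterlim_at_top)
    then show ?thesis
      using eps
    proof eventually_elim
      case (elim \<epsilon>)
      have "l (b *\<^sub>R P - Q) \<le> ((1 - b) * l X) * inverse \<epsilon>"
        using elim lX True by (simp add: field_simps)
      then have "l ((b *\<^sub>R P - Q) + ((b - 1) / \<epsilon>) *\<^sub>R X) \<le> 0"
        by (simp add: divide_inverse algebra_simps)
      then have "(b *\<^sub>R P - Q) + ((b - 1) / \<epsilon>) *\<^sub>R X \<notin> K" using l_pos_K not_le by blast
      then show ?case using thr_less_iff[OF P, of \<epsilon> Q b] elim b by simp
    qed
  next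
    case False
    then have "\<not> T.thr P (- Q) < b" using b by simp
    then have nb: "b *\<^sub>R P - Q \<notin> tcone" using T_thr_iff[OF Ki, of b] by simp
    show ?thesis using eps
    proof eventually_elim
      case (elim \<epsilon>)
      have "(b *\<^sub>R P - Q) + ((b - 1) / \<epsilon>) *\<^sub>R X \<notin> K" using nb by (auto simp: tcone_def)
      then show ?case using thr_less_iff[OF P, of \<epsilon> Q b] elim b by simp
    qed
  qed
qed

text \<open>The limit of the distance between two radial lines. Because of the maxima it can exceed
  the Hilbert distance of the tangent cone, and it equals that distance exactly at the minimal
  points.\<close>

definition D :: "'a \<times> real \<Rightarrow> 'a \<times> real \<Rightarrow> real"
  where "D P Q = ln (max 1 (T.thr P (- Q)) * max 1 (T.thr Q (- P))) / 2"

lemma hilbert_dist_limit: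
  assumes P: "P \<in> ends" and Q: "Q \<in> ends"
  shows "((\<lambda>t. hilbert_dist \<Omega> (pt (X + exp (- 2 * t) *\<^sub>R P)) (pt (X + exp (- 2 * t) *\<^sub>R Q))) \<longlongrightarrow> D P Q) at_top"
proof -
  have "((\<lambda>\<epsilon>. ln (thr (X + \<epsilon> *\<^sub>R Q) (- (X + \<epsilon> *\<^sub>R P)) * thr (X + \<epsilon> *\<^sub>R P) (- (X + \<epsilon> *\<^sub>R Q))) / 2)
      \<longlongrightarrow> ln (max 1 (T.thr Q (- P)) * max 1 (T.thr P (- Q))) / 2) (at_right 0)"
    by (intro tendsto_divide tendsto_ln tendsto_mult thr_limit P Q tendsto_const) auto
  then have "((\<lambda>t. ln (thr (X + exp (- 2 * t) *\<^sub>R Q) (- (X + exp (- 2 * t) *\<^sub>R P)) *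
      thr (X + exp (- 2 * t) *\<^sub>R P) (- (X + exp (- 2 * t) *\<^sub>R Q))) / 2) \<longlongrightarrow> D P Q) at_top"
    using filterlim_compose[OF _ exp_at_right_0] by (simp add: D_def mult.commute)
  then show ?thesis
    by (subst hilbert_dist_pt) (auto intro: ends_segment P Q)
qed

lemma Lim_radial:
  assumes P: "P \<in> ends" and Q: "Q \<in> ends" and "0 < r"
  shows "Lim at_top (\<lambda>t. hilbert_dist \<Omega> (radial_line \<Omega> (pt X) (pt (X + P)) t) (radial_line \<Omega> (pt X) (pt (X + r *\<^sub>R Q)) t))
    = D P (r *\<^sub>R Q)"
  using hilbert_dist_limit[OF P ends_scale[OF Q \<open>0 < r\<close>]] radial_line_eq[OF P]
    radial_line_eq[OF ends_scale[OF Q \<open>0 < r\<close>]] by (intro tendsto_Lim) simp_all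

text \<open>A time shift by s multiplies the end vector by exp (- 2 s), so time shifts and scales of
  Q are interchangeable.\<close>

lemma Lim_radial_shift:
  assumes P: "P \<in> ends" and Q: "Q \<in> ends"
  shows "Lim at_top (\<lambda>t. hilbert_dist \<Omega> (radial_line \<Omega> (pt X) (pt (X + P)) t) (radial_line \<Omega> (pt X) (pt (X + Q)) (t + s)))
    = D P (exp (- 2 * s) *\<^sub>R Q)"
proof -
  have e: "exp (- 2 * (t + s)) *\<^sub>R Q = exp (- 2 * t) *\<^sub>R (exp (- 2 * s) *\<^sub>R Q)" for t
    by (simp add: exp_add[symmetric] algebra_simps)
  show ?thesis
    unfolding radial_line_eq[OF P] radial_line_eq[OF Q] e
    by (intro tendsto_Lim trivial_limit_at_top_linorder hilbert_dist_limit P ends_scale Q exp_gt_zero)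
qed

lemma D_scale:
  assumes "P \<in> ends" "Q \<in> ends" "0 < r"
  shows "D P (r *\<^sub>R Q) = ln (max 1 (r * T.thr P (- Q)) * max 1 (T.thr Q (- P) / r)) / 2"
  using assms T_thr_scale[OF ends_K_inf ends_K_inf] by (simp add: D_def)

text \<open>Scaling Q by r multiplies one threshold by r and divides the other by r, so their
  product a b is constant. Replacing a and b by their maxima with 1 enlarges it unless both are at
  least 1.\<close>

lemma D_ge:
  assumes P: "P \<in> ends" and Q: "Q \<in> ends" and r: "0 < r"
  shows "ln (T.thr P (- Q) * T.thr Q (- P)) / 2 \<le> D P (r *\<^sub>R Q)"
    and "D P (r *\<^sub>R Q) = ln (T.thr P (- Q) * T.thr Q (- P)) / 2 \<longleftrightarrow>
      1 \<le> r * T.thr P (- Q) \<and> 1 \<le> T.thr Q (- P) / r"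
proof -
  define a b where "a = r * T.thr P (- Q)" and "b = T.thr Q (- P) / r"
  have Ki: "P \<in> tcone" "Q \<in> tcone" using ends_K_inf P Q by auto
  have pos: "0 < a" "0 < b" using T_thr_pos Ki r by (auto simp: a_def b_def)
  have ab: "T.thr P (- Q) * T.thr Q (- P) = a * b" using r by (simp add: a_def b_def)
  have ge: "1 \<le> a * b" using T_thr_mult_ge[OF Ki] ab by simp
  have D: "D P (r *\<^sub>R Q) = ln (max 1 a * max 1 b) / 2" using D_scale[OF P Q r] by (simp add: a_def b_def)
  have le: "a * b \<le> max 1 a * max 1 b" using pos by (intro mult_mono) auto
  show "ln (T.thr P (- Q) * T.thr Q (- P)) / 2 \<le> D P (r *\<^sub>R Q)"
    unfolding D ab using le ge by (intro divide_right_mono ln_mono) auto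
  have "ln (max 1 a * max 1 b) = ln (a * b) \<longleftrightarrow> max 1 a * max 1 b = a * b"
    using pos by (intro ln_inj_iff) (auto intro!: mult_pos_pos)
  also have "\<dots> \<longleftrightarrow> 1 \<le> a \<and> 1 \<le> b"
  proof
    assume e: "max 1 a * max 1 b = a * b"
    show "1 \<le> a \<and> 1 \<le> b"
    proof (rule ccontr)
      assume "\<not> ?thesis"
      then consider "a < 1" | "b < 1" by linarith
      then show False
      proof cases
        case 1
        have "a * b < 1 * b" using 1 pos by simp
        also have "\<dots> \<le> max 1 a * max 1 b" by (intro mult_mono) (use pos in auto)
        finally show False using e by simp
      next
        case 2
        have "a * b < a * 1" using 2 pos by simp
        also have "\<dots> \<le> max 1 a * max 1 b" by (intro mult_mono) (use pos in auto)
        finally show False using e by simp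
      qed
    qed
  qed (use pos in \<open>simp add: max_def\<close>)
  finally show "D P (r *\<^sub>R Q) = ln (T.thr P (- Q) * T.thr Q (- P)) / 2 \<longleftrightarrow>
      1 \<le> r * T.thr P (- Q) \<and> 1 \<le> T.thr Q (- P) / r"
    unfolding D ab a_def[symmetric] b_def[symmetric] by simp
qed

lemma INF_radial:
  assumes P: "P \<in> ends" and Q: "Q \<in> ends"
  shows "(INF z\<in>range (radial_line \<Omega> (pt X) (pt (X + Q))).
      Lim at_top (\<lambda>t. hilbert_dist \<Omega> (radial_line \<Omega> (pt X) (pt (X + P)) t) (radial_line \<Omega> (pt X) z t)))
    = ln (T.thr P (- Q) * T.thr Q (- P)) / 2" (is "?I = ?m")
proof -
  have "?I = (INF s. D P (exp (- 2 * s) *\<^sub>R Q))"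
    using Lim_radial[OF P Q exp_gt_zero] by (simp add: radial_line_eq[OF Q] image_image)
  also have "\<dots> = ?m"
  proof (rule cInf_eq_minimum)
    have Ki: "P \<in> tcone" "Q \<in> tcone" using ends_K_inf P Q by auto
    have pos: "0 < T.thr P (- Q)" using T_thr_pos Ki by blast
    \<comment> \<open>At this scale the first threshold is 1, and the second is then at least 1 by
      \<open>T_thr_mult_ge\<close>.\<close>
    let ?r = "1 / T.thr P (- Q)"
    have "D P (?r *\<^sub>R Q) = ?m"
      using D_ge(2)[OF P Q, of ?r] pos T_thr_mult_ge[OF Ki] by (simp add: mult.commute)
    moreover have "D P (exp (- 2 * (- ln ?r / 2)) *\<^sub>R Q) = D P (?r *\<^sub>R Q)" using pos by simp
    ultimately have "?m = D P (exp (- 2 * (- ln ?r / 2)) *\<^sub>R Q)" by (simp only:)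
    then show "?m \<in> range (\<lambda>s. D P (exp (- 2 * s) *\<^sub>R Q))" by (rule range_eqI)
  qed (use D_ge(1)[OF P Q exp_gt_zero] in blast)
  finally show ?thesis .
qed

text \<open>A threshold is at least 1 exactly if the corresponding difference of end vectors is
  outside the tangent cone; this turns the equality case of \<open>D_ge\<close> into the two
  conditions.\<close>

lemma horosphere_iff:
  assumes P: "P \<in> ends"
  shows "horosphere \<Omega> (pt X) (pt (X + P)) =
    {pt (X + Q) | Q. Q \<in> ends \<and> P - Q \<notin> tcone \<and> Q - P \<notin> tcone}"
proof -
  have minimal: "D P (r *\<^sub>R Q) = ln (T.thr P (- Q) * T.thr Q (- P)) / 2 \<longleftrightarrow>
      P - r *\<^sub>R Q \<notin> tcone \<and> r *\<^sub>R Q - P \<notin> tcone" if Q: "Q \<in> ends" and r: "0 < r" for Q r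
  proof -
    have Ki: "P \<in> tcone" "Q \<in> tcone" "r *\<^sub>R Q \<in> tcone" using ends_K_inf P Q T.scale_K r by auto
    have "P - r *\<^sub>R Q \<notin> tcone \<longleftrightarrow> 1 \<le> r * T.thr P (- Q)"
      using T_thr_iff[OF Ki(1,3), of 1] T_thr_scale(1)[OF Ki(1,2) r] by auto
    moreover have "r *\<^sub>R Q - P \<notin> tcone \<longleftrightarrow> 1 \<le> T.thr Q (- P) / r"
      using T_thr_iff[OF Ki(3,1), of 1] T_thr_scale(2)[OF Ki(2,1) r] by auto
    ultimately show ?thesis using D_ge(2)[OF P Q r] by blast
  qed
  show ?thesis
  proof (intro set_eqI iffI)
    fix x assume "x \<in> horosphere \<Omega> (pt X) (pt (X + P))"
    then obtain y s where ys: "x = radial_line \<Omega> (pt X) y s" "y \<in> \<Omega>"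
      and m: "Lim at_top (\<lambda>t. hilbert_dist \<Omega> (radial_line \<Omega> (pt X) (pt (X + P)) t) (radial_line \<Omega> (pt X) y (t + s))) =
       (INF z\<in>range (radial_line \<Omega> (pt X) y).
          Lim at_top (\<lambda>t. hilbert_dist \<Omega> (radial_line \<Omega> (pt X) (pt (X + P)) t) (radial_line \<Omega> (pt X) z t)))"
      unfolding horosphere_def by blast
    obtain Q where Q: "Q \<in> ends" "y = pt (X + Q)" using ex_ends ys by blast
    let ?Q = "exp (- 2 * s) *\<^sub>R Q"
    have "x = pt (X + ?Q)" using ys Q radial_line_eq by simp
    moreover have "?Q \<in> ends" using ends_scale Q by simp
    moreover have "P - ?Q \<notin> tcone \<and> ?Q - P \<notin> tcone"
      using m minimal[OF Q(1), of "exp (- 2 * s)"]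
      unfolding Q(2) Lim_radial_shift[OF P Q(1)] INF_radial[OF P Q(1)] by simp
    ultimately show "x \<in> {pt (X + Q) | Q. Q \<in> ends \<and> P - Q \<notin> tcone \<and> Q - P \<notin> tcone}" by blast
  next
    fix x assume "x \<in> {pt (X + Q) | Q. Q \<in> ends \<and> P - Q \<notin> tcone \<and> Q - P \<notin> tcone}"
    then obtain Q where Q: "Q \<in> ends" "x = pt (X + Q)" "P - Q \<notin> tcone" "Q - P \<notin> tcone" by blast
    \<comment> \<open>The scale of Q already carries the time shift, so s = 0 is the right
      witness.\<close>
    have "x = radial_line \<Omega> (pt X) (pt (X + Q)) 0" using Q radial_line_eq by simp
    moreover have "pt (X + Q) \<in> \<Omega>" using Q(1) pt_in_Omega by (simp add: ends_def)
    moreover have "Lim at_top (\<lambda>t. hilbert_dist \<Omega> (radial_line \<Omega> (pt X) (pt (X + P)) t) (radial_line \<Omega> (pt X) (pt (X + Q)) (t + 0))) =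
       (INF z\<in>range (radial_line \<Omega> (pt X) (pt (X + Q))).
          Lim at_top (\<lambda>t. hilbert_dist \<Omega> (radial_line \<Omega> (pt X) (pt (X + P)) t) (radial_line \<Omega> (pt X) z t)))"
      unfolding Lim_radial_shift[OF P Q(1)] INF_radial[OF P Q(1)]
      using minimal[OF Q(1), of 1] Q by simp
    ultimately show "x \<in> horosphere \<Omega> (pt X) (pt (X + P))"
      unfolding horosphere_def mem_Collect_eq
      by (intro exI[of _ "pt (X + Q)"] exI[of _ "0::real"] conjI)
  qed
qed

text \<open>Used to move a given point along its radial line onto the horosphere; the scale that
  makes one threshold equal to 1 does this.\<close>

lemma ex_minimal:
  assumes P: "P \<in> ends" and Q: "Q \<in> ends"
  shows "\<exists>r>0. P - r *\<^sub>R Q \<notin> tcone \<and> r *\<^sub>R Q - P \<notin> tcone"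
proof -
  have Ki: "P \<in> tcone" "Q \<in> tcone" using ends_K_inf P Q by auto
  define r where "r = 1 / T.thr P (- Q)"
  have r: "0 < r" using T_thr_pos Ki by (simp add: r_def)
  have Kr: "r *\<^sub>R Q \<in> tcone" using T.scale_K r Ki by blast
  have "P - r *\<^sub>R Q \<notin> tcone"
    using T_thr_iff[OF Ki(1) Kr, of 1] T_thr_scale(1)[OF Ki r] r by (simp add: r_def)
  moreover have "1 \<le> T.thr Q (- P) / r" using T_thr_mult_ge[OF Ki] by (simp add: r_def mult.commute)
  then have "r *\<^sub>R Q - P \<notin> tcone"
    using T_thr_iff[OF Kr Ki(1), of 1] T_thr_scale(2)[OF Ki(2,1) r] by simp
  ultimately show ?thesis using r by blast
qed

end

section \<open>Exponents of a convex function\<close>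

text \<open>With e = exp (- 2 t), the logarithm of C e^(1-y) divided by t is ln C / t + (- 2 + 2 y).
  Constants disappear in the limit, and bounds for y arbitrarily close to g suffice.\<close>

lemma rate_tendsto:
  fixes d :: "real \<Rightarrow> real"
  assumes upper: "\<And>y. g < y \<Longrightarrow> \<exists>C>0. \<forall>\<^sub>F e in at_right 0. d e \<le> C * e powr (1 - y)"
    and lower: "\<And>y. y < g \<Longrightarrow> \<exists>c>0. \<forall>\<^sub>F e in at_right 0. c * e powr (1 - y) \<le> d e"
  shows "((\<lambda>t. 1 / t * ln (d (exp (- 2 * t)))) \<longlongrightarrow> - 2 + 2 * g) at_top"
proof (rule order_tendstoI)
  have lim: "((\<lambda>t::real. C / t) \<longlongrightarrow> 0) at_top" for C
    by (intro tendsto_divide_0[OF tendsto_const] filterlim_at_top_imp_at_infinity filterlim_ident)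
  note e0 = exp_at_right_0
  have pw: "1 / t * ln (C * exp (- 2 * t) powr (1 - y)) = ln C / t + (- 2 + 2 * y)" if "0 < C" "0 < t" for C t y :: real
  proof -
    have "ln (C * exp (- 2 * t) powr (1 - y)) = ln C + (1 - y) * (- 2 * t)"
      using that by (simp add: ln_mult ln_powr)
    then show ?thesis using that by (simp add: field_simps)
  qed
  have t0: "\<forall>\<^sub>F t in at_top. 0 < (t::real)" by (rule eventually_gt_at_top)
  {
    fix a assume a: "a < - 2 + 2 * g"
    \<comment> \<open>The midpoint of g and (a + 2) / 2, so that - 2 + 2 y lies strictly between a
      and - 2 + 2 g.\<close>
    define y where "y = (g + (a + 2) / 2) / 2"
    have y: "y < g" "a < - 2 + 2 * y" using a by (auto simp: y_def field_simps)
    obtain c where c: "0 < c" "\<forall>\<^sub>F e in at_right 0. c * e powr (1 - y) \<le> d e" using lower[OF y(1)] by blast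
    have "((\<lambda>t. ln c / t + (- 2 + 2 * y)) \<longlongrightarrow> 0 + (- 2 + 2 * y)) at_top"
      by (intro tendsto_add lim tendsto_const)
    then have "\<forall>\<^sub>F t in at_top. a < ln c / t + (- 2 + 2 * y)" using y by (intro order_tendstoD) auto
    moreover have "\<forall>\<^sub>F t in at_top. c * exp (- 2 * t) powr (1 - y) \<le> d (exp (- 2 * t))"
      using filterlim_iff[THEN iffD1, OF e0] c(2) by blast
    ultimately show "\<forall>\<^sub>F t in at_top. a < 1 / t * ln (d (exp (- 2 * t)))"
      using t0
    proof eventually_elim
      case (elim t)
      have "ln (c * exp (- 2 * t) powr (1 - y)) \<le> ln (d (exp (- 2 * t)))"
        using elim c(1) by (intro ln_mono) (auto intro: less_le_trans[OF _ elim(2)])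
      then have "1 / t * ln (c * exp (- 2 * t) powr (1 - y)) \<le> 1 / t * ln (d (exp (- 2 * t)))"
        using elim by (intro mult_left_mono) auto
      then show ?case using elim pw[OF c(1) elim(3), of y] by linarith
    qed
  }
  fix a assume a: "- 2 + 2 * g < a"
  define y where "y = (g + (a + 2) / 2) / 2"
  have y: "g < y" "- 2 + 2 * y < a" using a by (auto simp: y_def field_simps)
  obtain C where C: "0 < C" "\<forall>\<^sub>F e in at_right 0. d e \<le> C * e powr (1 - y)" using upper[OF y(1)] by blast
  \<comment> \<open>Any lower bound would do: it only ensures that d is positive, so that ln is
    monotone there.\<close>
  obtain c where c: "0 < c" "\<forall>\<^sub>F e in at_right 0. c * e powr (1 - (g - 1)) \<le> d e" using lower[of "g - 1"] by auto
  have "((\<lambda>t. ln C / t + (- 2 + 2 * y)) \<longlongrightarrow> 0 + (- 2 + 2 * y)) at_top"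
    by (intro tendsto_add lim tendsto_const)
  then have "\<forall>\<^sub>F t in at_top. ln C / t + (- 2 + 2 * y) < a" using y by (intro order_tendstoD) auto
  moreover have "\<forall>\<^sub>F t in at_top. d (exp (- 2 * t)) \<le> C * exp (- 2 * t) powr (1 - y)"
    using filterlim_iff[THEN iffD1, OF e0] C(2) by blast
  moreover have "\<forall>\<^sub>F t in at_top. c * exp (- 2 * t) powr (1 - (g - 1)) \<le> d (exp (- 2 * t))"
    using filterlim_iff[THEN iffD1, OF e0] c(2) by blast
  ultimately show "\<forall>\<^sub>F t in at_top. 1 / t * ln (d (exp (- 2 * t))) < a"
    using t0
  proof eventually_elim
    case (elim t)
    have "0 < c * exp (- 2 * t) powr (1 - (g - 1))" using c by simp
    then have "0 < d (exp (- 2 * t))" using elim by linarith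
    then have "ln (d (exp (- 2 * t))) \<le> ln (C * exp (- 2 * t) powr (1 - y))"
      using elim C(1) by (intro ln_mono) auto
    then have "1 / t * ln (d (exp (- 2 * t))) \<le> 1 / t * ln (C * exp (- 2 * t) powr (1 - y))"
      using elim by (intro mult_left_mono) auto
    then show ?case using elim pw[OF C(1) elim(4), of y] by linarith
  qed
qed

lemma eventually_powr_small:
  assumes "0 < (y::real)" "0 < c" shows "\<forall>\<^sub>F e in at_right 0. e powr y < c"
proof -
  have "((\<lambda>e::real. e powr y) \<longlongrightarrow> 0 powr y) (at_right 0)"
    using assms eventually_at_right_less[of "0::real"]
    by (intro tendsto_powr' tendsto_const tendsto_ident_at) (auto elim: eventually_mono)
  then show ?thesis using assms by (intro order_tendstoD) auto
qed

lemma eventually_powr_large: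
  assumes "0 < (y::real)" shows "\<forall>\<^sub>F e in at_right 0. C < e powr (- y)"
proof -
  have "\<forall>\<^sub>F e in at_right (0::real). 0 < e" by (simp add: eventually_at_right_less)
  moreover have "\<forall>\<^sub>F e in at_right 0. e powr y < 1 / (\<bar>C\<bar> + 1)"
    using assms by (intro eventually_powr_small) auto
  ultimately show ?thesis
  proof eventually_elim
    case (elim e)
    have "\<bar>C\<bar> + 1 < 1 / e powr y"
      using elim by (simp add: field_simps)
    then show ?case by (simp add: powr_minus_divide)
  qed
qed

context
  fixes f :: "'a::euclidean_space \<Rightarrow> real" and \<nu> :: 'a
  assumes regular: "approx_regular \<nu> f"
begin

lemma log_ratio_tendsto_alpha:
  assumes "v \<in> tangent \<nu> - {0}"
  shows "(log_ratio f v \<longlongrightarrow> alpha f v) (at 0)" and "1 \<le> alpha f v"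
proof -
  obtain a where a: "a \<in> {1..\<infinity>}" "(log_ratio f v \<longlongrightarrow> a) (at 0)"
    using regular assms unfolding approx_regular_def by blast
  then have "alpha f v = a" unfolding alpha_def by (intro tendsto_Lim) auto
  then show "(log_ratio f v \<longlongrightarrow> alpha f v) (at 0)" "1 \<le> alpha f v" using a by auto
qed

end

text \<open>Twice the averaged height in the definition of \<alpha>, which accounts for the factors
  2 in front of the powers below.\<close>

definition twosided :: "('a::euclidean_space \<Rightarrow> real) \<Rightarrow> 'a \<Rightarrow> real \<Rightarrow> real"
  where "twosided f v t = f (t *\<^sub>R v) + f (- (t *\<^sub>R v))"

locale convex_graph =
  fixes f :: "'a::euclidean_space \<Rightarrow> real" and \<nu> :: 'a and \<rho> :: real
  assumes \<rho>: "0 < \<rho>" and f_nonneg: "\<And>h. h \<in> tangent \<nu> \<Longrightarrow> norm h < \<rho> \<Longrightarrow> 0 \<le> f h"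
    and f_convex: "convex_on (tangent \<nu> \<inter> ball 0 \<rho>) f" and f_0: "f 0 = 0"
    and regular: "approx_regular \<nu> f"
begin

lemma eventually_small: "\<forall>\<^sub>F t in at_right 0. 0 < t \<and> t < 1 \<and> norm (t *\<^sub>R v :: 'a) < \<rho>"
proof -
  have "((\<lambda>t. norm (t *\<^sub>R v)) \<longlongrightarrow> norm (0 *\<^sub>R v)) (at_right 0)" by (intro tendsto_intros)
  then have "\<forall>\<^sub>F t in at_right 0. norm (t *\<^sub>R v) < \<rho>" using \<rho> by (intro order_tendstoD) auto
  moreover have "\<forall>\<^sub>F t in at_right (0::real). t < 1" by (rule eventually_at_right_real[THEN eventually_mono, of 0 1]) auto
  moreover have "\<forall>\<^sub>F t in at_right (0::real). 0 < t" by (simp add: eventually_at_right_less)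
  ultimately show ?thesis by eventually_elim auto
qed

lemma tangent_scale: "v \<in> tangent \<nu> \<Longrightarrow> c *\<^sub>R v \<in> tangent \<nu>"
  and tangent_add: "v \<in> tangent \<nu> \<Longrightarrow> w \<in> tangent \<nu> \<Longrightarrow> v + w \<in> tangent \<nu>"
  and tangent_uminus: "v \<in> tangent \<nu> \<Longrightarrow> - v \<in> tangent \<nu>"
  by (auto simp: tangent_def inner_add_left)

lemma twosided_nonneg:
  "v \<in> tangent \<nu> \<Longrightarrow> norm (t *\<^sub>R v) < \<rho> \<Longrightarrow> 0 \<le> f (t *\<^sub>R v) \<and> 0 \<le> f (- (t *\<^sub>R v)) \<and> 0 \<le> twosided f v t"
  using f_nonneg[of "t *\<^sub>R v"] f_nonneg[of "- (t *\<^sub>R v)"] tangent_scale tangent_uminus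
  by (auto simp: twosided_def)

lemma log_ratio_twosided:
  "log_ratio f v t = (if twosided f v t = 0 then \<infinity> else ereal (ln (twosided f v t / 2) / ln \<bar>t\<bar>))"
  by (simp add: log_ratio_def twosided_def)

text \<open>Division by ln t < 0 reverses the inequalities. The value \<infinity> of the ratio when
  \<open>twosided\<close> vanishes agrees with both equivalences because 2 t^b is positive.\<close>

lemma less_log_ratio_iff:
  assumes "v \<in> tangent \<nu>" "0 < t" "t < 1" "norm (t *\<^sub>R v) < \<rho>"
  shows "ereal b < log_ratio f v t \<longleftrightarrow> twosided f v t < 2 * t powr b"
    and "log_ratio f v t < ereal b \<longleftrightarrow> 2 * t powr b < twosided f v t"
proof -
  let ?g = "twosided f v t"
  have l: "ln t < 0" using assms by simp
  have g: "0 \<le> ?g" using twosided_nonneg assms by blast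
  have "(ereal b < log_ratio f v t \<longleftrightarrow> ?g < 2 * t powr b) \<and> (log_ratio f v t < ereal b \<longleftrightarrow> 2 * t powr b < ?g)"
  proof (cases "?g = 0")
    case True
    then show ?thesis using assms by (simp add: log_ratio_twosided)
  next
    case False
    then have g0: "0 < ?g / 2" using g by simp
    have p: "0 < t powr b" using assms by simp
    have e: "ln (t powr b) = b * ln t" using assms by (simp add: ln_powr)
    have "b < ln (?g / 2) / ln t \<longleftrightarrow> ln (?g / 2) < ln (t powr b)"
      unfolding e using l by (simp add: neg_less_divide_eq)
    also have "\<dots> \<longleftrightarrow> ?g / 2 < t powr b" by (rule ln_less_cancel_iff[OF g0 p])
    finally have 1: "b < ln (?g / 2) / ln t \<longleftrightarrow> ?g / 2 < t powr b" .
    have "ln (?g / 2) / ln t < b \<longleftrightarrow> ln (t powr b) < ln (?g / 2)"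
      unfolding e using l by (simp add: neg_divide_less_eq)
    also have "\<dots> \<longleftrightarrow> t powr b < ?g / 2" by (rule ln_less_cancel_iff[OF p g0])
    finally have 2: "ln (?g / 2) / ln t < b \<longleftrightarrow> t powr b < ?g / 2" .
    have "log_ratio f v t = ereal (ln (?g / 2) / ln t)"
      using False assms by (simp add: log_ratio_twosided)
    then show ?thesis using 1 2 by auto
  qed
  then show "ereal b < log_ratio f v t \<longleftrightarrow> twosided f v t < 2 * t powr b"
    and "log_ratio f v t < ereal b \<longleftrightarrow> 2 * t powr b < twosided f v t" by auto
qed

lemma less_alpha:
  assumes v: "v \<in> tangent \<nu> - {0}" and b: "ereal b < alpha f v"
  shows "\<forall>\<^sub>F t in at_right 0. twosided f v t < 2 * t powr b"
proof -
  have "\<forall>\<^sub>F t in at 0. ereal b < log_ratio f v t"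
    using log_ratio_tendsto_alpha[OF regular v] b by (intro order_tendstoD(1))
  then have "\<forall>\<^sub>F t in at_right 0. ereal b < log_ratio f v t" by (simp add: eventually_at_split)
  then show ?thesis using eventually_small[of v] by eventually_elim (use less_log_ratio_iff v in blast)
qed

lemma alpha_less:
  assumes v: "v \<in> tangent \<nu> - {0}" and b: "alpha f v < ereal b"
  shows "\<forall>\<^sub>F t in at_right 0. 2 * t powr b < twosided f v t"
proof -
  have "\<forall>\<^sub>F t in at 0. log_ratio f v t < ereal b"
    using log_ratio_tendsto_alpha[OF regular v] b by (intro order_tendstoD(2))
  then have "\<forall>\<^sub>F t in at_right 0. log_ratio f v t < ereal b" by (simp add: eventually_at_split)
  then show ?thesis using eventually_small[of v] by eventually_elim (use less_log_ratio_iff v in blast)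
qed

text \<open>A constant factor costs only an arbitrarily small amount of the exponent, so it suffices
  to bound \<open>twosided\<close> up to constants.\<close>

lemma alpha_geI:
  assumes v: "v \<in> tangent \<nu> - {0}"
    and b: "\<And>b. 0 < b \<Longrightarrow> ereal b < a \<Longrightarrow> \<exists>C. \<forall>\<^sub>F t in at_right 0. twosided f v t \<le> C * t powr b"
  shows "a \<le> alpha f v"
proof (rule ccontr)
  assume "\<not> a \<le> alpha f v"
  then obtain b where b1: "alpha f v < ereal b" "ereal b < a" using ereal_dense2[of "alpha f v" a] not_le by blast
  \<comment> \<open>Two exponents b < c are needed: the upper bound at c contradicts the lower one
    at b, because t^(c-b) tends to 0.\<close>
  then obtain c where c: "ereal b < ereal c" "ereal c < a" using ereal_dense2[of "ereal b" a] by blast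
  have "ereal 1 < ereal b" using log_ratio_tendsto_alpha(2)[OF regular v] b1(1)
    by (metis le_less_trans one_ereal_def)
  then have bpos: "0 < c" using c(1) by simp
  obtain C where "\<forall>\<^sub>F t in at_right 0. twosided f v t \<le> C * t powr c" using b[OF bpos c(2)] by blast
  moreover have "\<forall>\<^sub>F t in at_right 0. 2 * t powr b < twosided f v t" using alpha_less v b1 by blast
  moreover have "\<forall>\<^sub>F t in at_right 0. t powr (c - b) < 2 / (\<bar>C\<bar> + 1)"
    using c by (intro eventually_powr_small) auto
  ultimately have "\<forall>\<^sub>F t in at_right (0::real). t < 0" using eventually_small[of 0]
  proof eventually_elim
    case (elim t)
    have "2 * t powr b < C * t powr c" using elim by linarith
    also have "\<dots> \<le> (\<bar>C\<bar> + 1) * t powr c" by (intro mult_right_mono) auto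
    also have "\<dots> = ((\<bar>C\<bar> + 1) * t powr (c - b)) * t powr b" using elim by (simp add: powr_add[symmetric])
    also have "\<dots> < 2 * t powr b" using elim by (intro mult_strict_right_mono) (auto simp: field_simps)
    finally show ?case .
  qed
  then have "\<forall>\<^sub>F t in at_right (0::real). t < 0 \<and> 0 < t" using eventually_small[of 0] by eventually_elim simp
  then obtain t :: real where "t < 0 \<and> 0 < t"
    using eventually_happens'[of "at_right (0::real)"] trivial_limit_at_right_real by blast
  then show False by linarith
qed

lemma alpha_scale_ge:
  assumes v: "v \<in> tangent \<nu> - {0}" and c: "c \<noteq> 0"
  shows "alpha f v \<le> alpha f (c *\<^sub>R v)"
proof (rule alpha_geI)
  show "c *\<^sub>R v \<in> tangent \<nu> - {0}" using v c tangent_scale by auto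
  fix b :: real assume b: "0 < b" "ereal b < alpha f v"
  have "filterlim (\<lambda>t. \<bar>c\<bar> * t) (at_right 0) (at_right 0)"
  proof -
    have "((\<lambda>t. \<bar>c\<bar> * t) \<longlongrightarrow> \<bar>c\<bar> * 0) (at_right 0)" by (intro tendsto_intros)
    moreover have "\<forall>\<^sub>F t in at_right 0. \<bar>c\<bar> * t \<in> {0<..} \<and> \<bar>c\<bar> * t \<noteq> 0"
      using eventually_small[of 0] by eventually_elim (use c in auto)
    ultimately show ?thesis by (simp add: filterlim_at)
  qed
  then have "\<forall>\<^sub>F t in at_right 0. twosided f v (\<bar>c\<bar> * t) < 2 * (\<bar>c\<bar> * t) powr b"
    using less_alpha[OF v b(2)] filterlim_iff by blast
  then have "\<forall>\<^sub>F t in at_right 0. twosided f (c *\<^sub>R v) t \<le> 2 * \<bar>c\<bar> powr b * t powr b"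
    using eventually_small[of 0]
  proof eventually_elim
    case (elim t)
    have "twosided f (c *\<^sub>R v) t = twosided f v (\<bar>c\<bar> * t)"
      by (cases "0 < c") (auto simp: twosided_def abs_if mult.commute)
    then show ?case using elim by (simp add: powr_mult)
  qed
  then show "\<exists>C. \<forall>\<^sub>F t in at_right 0. twosided f (c *\<^sub>R v) t \<le> C * t powr b" by blast
qed

lemma alpha_scale:
  assumes v: "v \<in> tangent \<nu> - {0}" and c: "c \<noteq> 0"
  shows "alpha f (c *\<^sub>R v) = alpha f v"
proof -
  have "c *\<^sub>R v \<in> tangent \<nu> - {0}" using v c tangent_scale by auto
  then have "alpha f (c *\<^sub>R v) \<le> alpha f ((1 / c) *\<^sub>R (c *\<^sub>R v))" using c by (intro alpha_scale_ge) auto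
  then show ?thesis using alpha_scale_ge[OF v c] c by simp
qed

text \<open>The point t(v + w) is the midpoint of 2 t v and 2 t w, so convexity bounds f there by
  the mean of the two values, and likewise at the opposite point.\<close>

lemma alpha_add:
  assumes v: "v \<in> tangent \<nu> - {0}" and w: "w \<in> tangent \<nu> - {0}" and vw: "v + w \<noteq> 0"
    and a: "a \<le> alpha f v" "a \<le> alpha f w"
  shows "a \<le> alpha f (v + w)"
proof (rule alpha_geI)
  show "v + w \<in> tangent \<nu> - {0}" using v w vw tangent_add by auto
  fix b :: real assume b: "0 < b" "ereal b < a"
  have v2: "2 *\<^sub>R v \<in> tangent \<nu> - {0}" "2 *\<^sub>R w \<in> tangent \<nu> - {0}" using v w tangent_scale by auto
  have a2: "ereal b < alpha f (2 *\<^sub>R v)" "ereal b < alpha f (2 *\<^sub>R w)"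
    using a b alpha_scale[OF v] alpha_scale[OF w] by (auto intro: less_le_trans)
  have "\<forall>\<^sub>F t in at_right 0. twosided f (v + w) t \<le> 2 * t powr b"
    using less_alpha[OF v2(1) a2(1)] less_alpha[OF v2(2) a2(2)] eventually_small[of "2 *\<^sub>R v"] eventually_small[of "2 *\<^sub>R w"]
  proof eventually_elim
    case (elim t)
    have mem: "t *\<^sub>R 2 *\<^sub>R v \<in> tangent \<nu> \<inter> ball 0 \<rho>" "t *\<^sub>R 2 *\<^sub>R w \<in> tangent \<nu> \<inter> ball 0 \<rho>"
      "- (t *\<^sub>R 2 *\<^sub>R v) \<in> tangent \<nu> \<inter> ball 0 \<rho>" "- (t *\<^sub>R 2 *\<^sub>R w) \<in> tangent \<nu> \<inter> ball 0 \<rho>"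
      using elim v w by (auto simp: tangent_def)
    have half: "t *\<^sub>R (v + w) = (1 - 1/2) *\<^sub>R (t *\<^sub>R 2 *\<^sub>R v) + (1/2) *\<^sub>R (t *\<^sub>R 2 *\<^sub>R w)"
      "- (t *\<^sub>R (v + w)) = (1 - 1/2) *\<^sub>R (- (t *\<^sub>R 2 *\<^sub>R v)) + (1/2) *\<^sub>R (- (t *\<^sub>R 2 *\<^sub>R w))"
      by (auto simp: algebra_simps)
    have "f (t *\<^sub>R (v + w)) \<le> (1 - 1/2) * f (t *\<^sub>R 2 *\<^sub>R v) + (1/2) * f (t *\<^sub>R 2 *\<^sub>R w)"
      unfolding half(1) by (rule convex_onD[OF f_convex]) (use mem in auto)
    moreover have "f (- (t *\<^sub>R (v + w))) \<le> (1 - 1/2) * f (- (t *\<^sub>R 2 *\<^sub>R v)) + (1/2) * f (- (t *\<^sub>R 2 *\<^sub>R w))"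
      unfolding half(2) by (rule convex_onD[OF f_convex]) (use mem in auto)
    ultimately show ?case using elim by (simp add: twosided_def)
  qed
  then show "\<exists>C. \<forall>\<^sub>F t in at_right 0. twosided f (v + w) t \<le> C * t powr b" by blast
qed

lemma subspace_filtration: "subspace (filtration \<nu> f e i)"
proof (cases "i = 0")
  case True
  then show ?thesis by (simp add: filtration_def)
next
  case False
  then have H: "filtration \<nu> f e i = {0} \<union> {v \<in> tangent \<nu> - {0}. e i \<le> alpha f v}" by (simp add: filtration_def)
  show ?thesis
    unfolding subspace_def H
  proof (intro conjI ballI allI)
    fix v w assume "v \<in> {0} \<union> {v \<in> tangent \<nu> - {0}. e i \<le> alpha f v}" "w \<in> {0} \<union> {v \<in> tangent \<nu> - {0}. e i \<le> alpha f v}"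
    then show "v + w \<in> {0} \<union> {v \<in> tangent \<nu> - {0}. e i \<le> alpha f v}"
      using alpha_add[of v w "e i"] tangent_add by (cases "v + w = 0") auto
  next
    fix c v assume "v \<in> {0} \<union> {v \<in> tangent \<nu> - {0}. e i \<le> alpha f v}"
    then show "c *\<^sub>R v \<in> {0} \<union> {v \<in> tangent \<nu> - {0}. e i \<le> alpha f v}"
      using alpha_scale[of v c] tangent_scale by (cases "c = 0") auto
  qed simp
qed

end

section \<open>Growth of the distance along radial lines\<close>

text \<open>X + J z lifts the point at offset z from x+ in the chart where the boundary is a graph.
  This chart may differ from the bounded one behind \<open>l\<close> and \<open>L\<close>; X and
  \<open>J\<close> are the link between them.\<close>

locale graph_cone = horo_cone K l B \<Omega> L X + convex_graph f \<nu> \<rho>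
  for K :: "('a::euclidean_space \<times> real) set" and l B \<Omega> L X and f :: "'a \<Rightarrow> real" and \<nu> \<rho> +
  fixes J :: "'a \<Rightarrow> 'a \<times> real"
  assumes linear_J: "linear J"
    and decomp: "\<And>w. \<exists>c z. w = c *\<^sub>R X + J z"
    and indep: "\<And>c z. c *\<^sub>R X + J z = 0 \<Longrightarrow> c = 0 \<and> z = 0"
    and norm_nu: "norm \<nu> = 1"
    and graph: "\<And>z. norm z < \<rho> \<Longrightarrow> X + J z \<in> K \<longleftrightarrow> f (z - (z \<bullet> \<nu>) *\<^sub>R \<nu>) < z \<bullet> \<nu>"
begin

lemma J_simps [simp]: "J (x + y) = J x + J y" "J (x - y) = J x - J y" "J (c *\<^sub>R x) = c *\<^sub>R J x"
    "J 0 = 0" "J (- x) = - J x"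
  using linear_J by (auto simp: linear_add linear_diff linear_cmul linear_0 linear_neg)

lemma nu_nu: "\<nu> \<bullet> \<nu> = 1"
  using norm_nu by (simp add: norm_eq_1)

text \<open>By homogeneity one may divide by m, which brings the offset within the radius \<rho>
  where the graph describes \<open>K\<close>.\<close>

lemma graph_scaled:
  assumes h: "h \<in> tangent \<nu>" and m: "0 < m" and small: "norm (h + s *\<^sub>R \<nu>) < \<rho> * m"
  shows "m *\<^sub>R X + J (h + s *\<^sub>R \<nu>) \<in> K \<longleftrightarrow> f ((1 / m) *\<^sub>R h) < s / m"
proof -
  let ?z = "(1 / m) *\<^sub>R (h + s *\<^sub>R \<nu>)"
  have "h \<bullet> \<nu> = 0" using h by (simp add: tangent_def)
  then have z: "?z \<bullet> \<nu> = s / m" "?z - (?z \<bullet> \<nu>) *\<^sub>R \<nu> = (1 / m) *\<^sub>R h"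
    by (simp_all add: inner_add_left nu_nu scaleR_add_right)
  have "norm ?z = norm (h + s *\<^sub>R \<nu>) / m" using m by (subst norm_scaleR) (simp add: divide_inverse mult.commute)
  then have "norm ?z < \<rho>" using small m by (simp add: pos_divide_less_eq)
  then have "X + J ?z \<in> K \<longleftrightarrow> f ((1 / m) *\<^sub>R h) < s / m" using graph[of ?z] z by metis
  moreover have "m *\<^sub>R (X + J ?z) = m *\<^sub>R X + J (h + s *\<^sub>R \<nu>)"
    using m by (simp add: scaleR_add_right del: J_simps(1)) (simp add: scaleR_add_right)
  ultimately show ?thesis using scale_K_iff[OF m, of "X + J ?z"] by metis
qed

lemma eventually_graph:
  assumes h: "h \<in> tangent \<nu>"
  shows "\<forall>\<^sub>F t in at_right 0. (1 / t) *\<^sub>R X + J (h + s *\<^sub>R \<nu>) \<in> K \<longleftrightarrow> f (t *\<^sub>R h) < t * s"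
  using eventually_small[of "h + s *\<^sub>R \<nu>"]
proof eventually_elim
  case (elim t)
  have "t * norm (h + s *\<^sub>R \<nu>) < \<rho>" using elim by (metis norm_scaleR abs_of_pos)
  then have "norm (h + s *\<^sub>R \<nu>) < \<rho> * (1 / t)" using elim by (simp add: pos_less_divide_eq mult.commute)
  moreover have "0 < 1 / t" using elim by simp
  ultimately have "(1 / t) *\<^sub>R X + J (h + s *\<^sub>R \<nu>) \<in> K \<longleftrightarrow> f ((1 / (1 / t)) *\<^sub>R h) < s / (1 / t)"
    using graph_scaled[OF h] by blast
  then show ?case by (simp add: mult.commute)
qed

lemma tcone_memI:
  assumes h: "h \<in> tangent \<nu>" and "\<forall>\<^sub>F t in at_right 0. f (t *\<^sub>R h) < t * s"
  shows "J (h + s *\<^sub>R \<nu>) \<in> tcone"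
proof -
  have "\<forall>\<^sub>F t in at_right 0. (1 / t) *\<^sub>R X + J (h + s *\<^sub>R \<nu>) \<in> K"
    using assms(2) eventually_graph[OF h, of s] by eventually_elim simp
  from eventually_happens'[OF trivial_limit_at_right_real this]
  obtain t :: real where "(1 / t) *\<^sub>R X + J (h + s *\<^sub>R \<nu>) \<in> K" by blast
  then show ?thesis by (auto simp: tcone_def add.commute intro!: exI[of _ "1 / t"])
qed

lemma J_nu_tcone: "J \<nu> \<in> tcone"
proof -
  have "\<forall>\<^sub>F t in at_right 0. f (t *\<^sub>R (0::'a)) < t * 1"
    using eventually_small[of 0] by eventually_elim (simp add: f_0)
  then have "J (0 + 1 *\<^sub>R \<nu>) \<in> tcone" by (intro tcone_memI) (simp_all add: tangent_def)
  then show ?thesis by simp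
qed

text \<open>As f \<ge> 0, the tangent cone lies strictly on the inner side of the supporting
  hyperplane.\<close>

lemma tcone_coord_pos:
  assumes h: "h \<in> tangent \<nu>" and P: "c *\<^sub>R X + J (h + s *\<^sub>R \<nu>) \<in> tcone"
  shows "0 < s"
proof -
  have "J (h + s *\<^sub>R \<nu>) \<in> tcone" using P K_inf_add_X by (metis add.commute)
  then obtain d where d: "J (h + s *\<^sub>R \<nu>) + d *\<^sub>R X \<in> K" by (auto simp: tcone_def)
  have "\<forall>\<^sub>F t in at_right 0. d < inverse t"
    using filterlim_inverse_at_top_right by (simp add: filterlim_at_top_dense)
  then have "\<forall>\<^sub>F t in at_right 0. 0 < t * s"
    using eventually_graph[OF h, of s] eventually_small[of h]
  proof eventually_elim
    case (elim t)
    have "d \<le> 1 / t" using elim by (simp add: inverse_eq_divide)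
    then have "J (h + s *\<^sub>R \<nu>) + (1 / t) *\<^sub>R X \<in> K" by (rule K_inf_up[OF d])
    then have "f (t *\<^sub>R h) < t * s" using elim by (simp add: add.commute)
    moreover have "0 \<le> f (t *\<^sub>R h)" using f_nonneg[OF tangent_scale[OF h], of t] elim by blast
    ultimately show ?case by linarith
  qed
  then have "\<forall>\<^sub>F t in at_right 0. 0 < t \<and> 0 < t * s"
    using eventually_small[of 0] by eventually_elim simp
  from eventually_happens'[OF trivial_limit_at_right_real this] obtain t where "0 < t" "0 < t * s" by blast
  then show ?thesis by (simp add: zero_less_mult_iff)
qed

text \<open>An exponent above 1 gives f(tv) + f(-tv) = o(t), and each term is nonnegative, so both
  fall below t s. Thus v and - v both lie in the closure of the tangent cone.\<close>

lemma flat_tcone: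
  assumes v: "v \<in> tangent \<nu>" and flat: "v = 0 \<or> 1 < alpha f v" and s: "0 < s"
  shows "J v + s *\<^sub>R J \<nu> \<in> tcone" and "- J v + s *\<^sub>R J \<nu> \<in> tcone"
proof -
  have both: "\<forall>\<^sub>F t in at_right 0. f (t *\<^sub>R v) < t * s \<and> f (t *\<^sub>R (- v)) < t * s"
  proof (cases "v = 0")
    case True
    show ?thesis using eventually_small[of 0] by eventually_elim (use s True in \<open>simp add: f_0\<close>)
  next
    case False
    then obtain b where b: "ereal 1 < ereal b" "ereal b < alpha f v"
      using flat ereal_dense2[of 1 "alpha f v"] unfolding one_ereal_def by blast
    have "1 < b" using b(1) by simp
    then have "\<forall>\<^sub>F t in at_right 0. t powr (b - 1) < s / 2" using s by (intro eventually_powr_small) auto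
    moreover have "\<forall>\<^sub>F t in at_right 0. twosided f v t < 2 * t powr b"
      using v False by (intro less_alpha b(2)) auto
    ultimately show ?thesis using eventually_small[of v]
    proof eventually_elim
      case (elim t)
      have "t powr (b - 1 + 1) = t powr (b - 1) * t" using elim powr_add[of t "b - 1" 1] by simp
      then have "2 * t powr b = 2 * t powr (b - 1) * t" by simp
      also have "\<dots> < s * t" using elim by (intro mult_strict_right_mono) auto
      finally have "twosided f v t < t * s" using elim by (simp add: mult.commute)
      moreover have "0 \<le> f (t *\<^sub>R v)" "0 \<le> f (- (t *\<^sub>R v))" using twosided_nonneg[OF v, of t] elim by blast+
      ultimately show ?case by (simp add: twosided_def)
    qed
  qed
  have "J (v + s *\<^sub>R \<nu>) \<in> tcone" using both by (intro tcone_memI v) (auto elim: eventually_mono)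
  then show "J v + s *\<^sub>R J \<nu> \<in> tcone" by simp
  have "J (- v + s *\<^sub>R \<nu>) \<in> tcone" using both v
    by (intro tcone_memI tangent_uminus) (auto elim: eventually_mono)
  then show "- J v + s *\<^sub>R J \<nu> \<in> tcone" by simp
qed

text \<open>Up to constants, \<open>P\<close> may be replaced by \<open>J \<nu>\<close> in conditions of the form \<open>w + m (X + e P) \<in> K\<close>.\<close>

lemma compare:
  assumes "C1 \<in> tcone" "C2 \<in> tcone"
  shows "\<exists>c>0. \<exists>e0>0. \<forall>e m w. 0 < e \<and> e < e0 \<and> 0 \<le> m \<and> w + m *\<^sub>R X + (m * e) *\<^sub>R C1 \<in> K
    \<longrightarrow> w + (2 * m) *\<^sub>R X + (c * m * e) *\<^sub>R C2 \<in> K"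
proof -
  obtain d where d: "0 < d" "C2 - d *\<^sub>R C1 \<in> tcone" using T.sub_small assms by blast
  then obtain a0 where a0: "C2 - d *\<^sub>R C1 + a0 *\<^sub>R X \<in> K" by (auto simp: tcone_def)
  define a where "a = max a0 1"
  have a: "C2 - d *\<^sub>R C1 + a *\<^sub>R X \<in> K" "0 < a" using K_inf_up[OF a0] by (auto simp: a_def)
  have "w + (2 * m) *\<^sub>R X + (1 / d * m * e) *\<^sub>R C2 \<in> K"
    if e: "0 < e" "e < d / a" and m: "0 \<le> m" and w: "w + m *\<^sub>R X + (m * e) *\<^sub>R C1 \<in> K" for e m w
  proof -
    \<comment> \<open>The added vector trades C1 for C2. Its cost is m e a / d times X, at most m X
      because e < d / a; hence the coefficient 2 m.\<close>
    have "(w + m *\<^sub>R X + (m * e) *\<^sub>R C1) + (m * e / d) *\<^sub>R (C2 - d *\<^sub>R C1 + a *\<^sub>R X) \<in> K"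
      using w a closure_subset d e m
      by (intro add_closure_K[of "w + m *\<^sub>R X + (m * e) *\<^sub>R C1"] closure_scale_nonneg) auto
    also have "(w + m *\<^sub>R X + (m * e) *\<^sub>R C1) + (m * e / d) *\<^sub>R (C2 - d *\<^sub>R C1 + a *\<^sub>R X)
      = (w + (1 / d * m * e) *\<^sub>R C2) + (m + m * (e * a / d)) *\<^sub>R X"
      using d by (simp add: algebra_simps)
    finally have "(w + (1 / d * m * e) *\<^sub>R C2) + (2 * m) *\<^sub>R X \<in> K"
    proof (rule K_inf_up)
      have "e * a / d \<le> 1" using e a d by (simp add: field_simps)
      then have "m * (e * a / d) \<le> m * 1" using m by (intro mult_left_mono) auto
      then show "m + m * (e * a / d) \<le> 2 * m" by simp
    qed
    then show ?thesis by (simp add: ac_simps)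
  qed
  then show ?thesis using d a by (intro exI[of _ "1 / d"] exI[of _ "d / a"] conjI) auto
qed

end

text \<open>\<open>u_not\<close> is the condition of \<open>horosphere_iff\<close> that X + Q lies
  on the horosphere of X + P, and \<open>u_not_X\<close> excludes Q = P.\<close>

locale horo_pair = graph_cone K l B \<Omega> L X f \<nu> \<rho> J
  for K :: "('a::euclidean_space \<times> real) set" and l B \<Omega> L X f \<nu> \<rho> J +
  fixes P Q u :: "'a \<times> real"
  assumes P: "P \<in> ends" and Q: "Q \<in> ends" and u: "u = P - Q"
    and u_not: "u \<notin> tcone" "- u \<notin> tcone" and u_not_X: "\<And>c. u \<noteq> c *\<^sub>R X"
begin

lemma u_nonzero: "u \<noteq> 0"
  using u_not_X[of 0] by simp

text \<open>By \<open>thr_less\<close> this says that both thresholds are below 1 + e m, so the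
  smallest such m controls the distance up to constants.\<close>

definition both :: "real \<Rightarrow> real \<Rightarrow> bool"
  where "both e m \<longleftrightarrow> u + m *\<^sub>R (X + e *\<^sub>R P) \<in> K \<and> - u + m *\<^sub>R (X + e *\<^sub>R Q) \<in> K"

definition hdist :: "real \<Rightarrow> real"
  where "hdist e = hilbert_dist \<Omega> (pt (X + e *\<^sub>R P)) (pt (X + e *\<^sub>R Q))"

lemma thr_less:
  assumes "0 < e"
  shows "thr (X + e *\<^sub>R P) (- (X + e *\<^sub>R Q)) < 1 + e * m \<longleftrightarrow> u + m *\<^sub>R (X + e *\<^sub>R P) \<in> K"
    and "thr (X + e *\<^sub>R Q) (- (X + e *\<^sub>R P)) < 1 + e * m \<longleftrightarrow> - u + m *\<^sub>R (X + e *\<^sub>R Q) \<in> K"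
proof -
  have "(1 + e * m) *\<^sub>R P - Q + ((1 + e * m - 1) / e) *\<^sub>R X = u + m *\<^sub>R (X + e *\<^sub>R P)"
    using assms by (simp add: u algebra_simps)
  then show "thr (X + e *\<^sub>R P) (- (X + e *\<^sub>R Q)) < 1 + e * m \<longleftrightarrow> u + m *\<^sub>R (X + e *\<^sub>R P) \<in> K"
    using thr_less_iff[OF P assms] by metis
  have "(1 + e * m) *\<^sub>R Q - P + ((1 + e * m - 1) / e) *\<^sub>R X = - u + m *\<^sub>R (X + e *\<^sub>R Q)"
    using assms by (simp add: u algebra_simps)
  then show "thr (X + e *\<^sub>R Q) (- (X + e *\<^sub>R P)) < 1 + e * m \<longleftrightarrow> - u + m *\<^sub>R (X + e *\<^sub>R Q) \<in> K"
    using thr_less_iff[OF Q assms] by metis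
qed

lemma hdist_eq:
  assumes "0 < e"
  shows "hdist e = (ln (thr (X + e *\<^sub>R Q) (- (X + e *\<^sub>R P))) + ln (thr (X + e *\<^sub>R P) (- (X + e *\<^sub>R Q)))) / 2"
    and "1 \<le> thr (X + e *\<^sub>R P) (- (X + e *\<^sub>R Q))" and "1 \<le> thr (X + e *\<^sub>R Q) (- (X + e *\<^sub>R P))"
proof -
  have K: "X + e *\<^sub>R P \<in> K" "X + e *\<^sub>R Q \<in> K" using ends_segment P Q assms by auto
  then show "hdist e = (ln (thr (X + e *\<^sub>R Q) (- (X + e *\<^sub>R P))) + ln (thr (X + e *\<^sub>R P) (- (X + e *\<^sub>R Q)))) / 2"
    unfolding hdist_def hilbert_dist_pt[OF K] using thr_pos[OF K] thr_pos[OF K(2,1)] by (simp add: ln_mult)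
  have "u \<notin> K" "- u \<notin> K" using u_not K_subset_K_inf by auto
  then show "1 \<le> thr (X + e *\<^sub>R P) (- (X + e *\<^sub>R Q))" "1 \<le> thr (X + e *\<^sub>R Q) (- (X + e *\<^sub>R P))"
    using thr_less[OF assms, of 0] by auto
qed

lemma hdist_upper:
  assumes "0 < e" "0 \<le> m" "both e m" shows "hdist e \<le> e * m"
proof -
  let ?a = "thr (X + e *\<^sub>R P) (- (X + e *\<^sub>R Q))" and ?b = "thr (X + e *\<^sub>R Q) (- (X + e *\<^sub>R P))"
  have "?a < 1 + e * m" "?b < 1 + e * m" using assms thr_less by (auto simp: both_def)
  then have "ln ?a \<le> e * m" "ln ?b \<le> e * m"
    using hdist_eq(2,3)[OF assms(1)] ln_le_minus_one[of ?a] ln_le_minus_one[of ?b] by linarith+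
  then show ?thesis using hdist_eq(1)[OF assms(1)] by simp
qed

text \<open>One threshold is at least 1 + e m, and ln (1 + x) \<ge> x - x^2 \<ge> x / 2 for 0 \<le>
  x \<le> 1 / 2. The other logarithm is nonnegative, so half the sum is at least e m / 4.\<close>

lemma hdist_lower:
  assumes "0 < e" "0 \<le> m" "e * m \<le> 1 / 2" "\<not> both e m" shows "e * m / 4 \<le> hdist e"
proof -
  let ?a = "thr (X + e *\<^sub>R P) (- (X + e *\<^sub>R Q))" and ?b = "thr (X + e *\<^sub>R Q) (- (X + e *\<^sub>R P))"
  have em: "0 \<le> e * m" using assms by simp
  have "1 + e * m \<le> ?a \<or> 1 + e * m \<le> ?b" using assms thr_less[OF assms(1), of m] by (auto simp: both_def not_less)
  moreover have "e * m / 2 \<le> ln r" if "1 + e * m \<le> r" for r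
  proof -
    have "e * m * (e * m) \<le> e * m * (1 / 2)" using assms em by (intro mult_left_mono) auto
    then have "e * m / 2 \<le> e * m - (e * m)\<^sup>2" by (simp add: power2_eq_square)
    also have "\<dots> \<le> ln (1 + e * m)" using assms em by (intro ln_one_plus_pos_lower_bound) auto
    also have "\<dots> \<le> ln r" using that em by (intro ln_mono) auto
    finally show ?thesis .
  qed
  moreover have "0 \<le> ln ?a" "0 \<le> ln ?b" using hdist_eq(2,3)[OF assms(1)] by auto
  ultimately show ?thesis using hdist_eq(1)[OF assms(1)] by fastforce
qed

text \<open>When the cone bounds of the two members are added, l u cancels and norm u \<le> m A'
  remains. Consequently the distance is at least of order e, whatever the shape of f.\<close>

lemma both_bounded_below: "\<exists>c>0. \<forall>e m. 0 < e \<and> e < 1 \<and> 0 \<le> m \<and> both e m \<longrightarrow> c < m"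
proof -
  define A where "A = norm X + norm P + norm Q"
  define A' where "A' = B * (l X + l P + l X + l Q) + A"
  have Pc: "P \<in> closure K" "Q \<in> closure K" using P Q by (auto simp: ends_def)
  have l: "0 < l X" "0 \<le> l P" "0 \<le> l Q" using lX l_nonneg Pc by auto
  have A': "0 < A'" unfolding A'_def A_def using B l by (intro add_pos_nonneg mult_pos_pos) auto
  have "norm u / (2 * A') < m" if h: "0 < e" "e < 1" "0 \<le> m" "both e m" for e m
  proof -
    let ?a = "X + e *\<^sub>R P" and ?b = "X + e *\<^sub>R Q"
    have n1: "norm (u + m *\<^sub>R ?a) \<le> B * (l u + m * l ?a)" and n2: "norm (- u + m *\<^sub>R ?b) \<le> B * (- l u + m * l ?b)"
      using h bound_K[of "u + m *\<^sub>R ?a"] bound_K[of "- u + m *\<^sub>R ?b"] by (auto simp: both_def)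
    have eP: "e * l P \<le> l P" "e * l Q \<le> l Q" "e * norm P \<le> norm P"
      using h l by (auto intro: mult_left_le_one_le)
    have la: "l ?a + l ?b \<le> l X + l P + l X + l Q" using eP by simp
    have na: "norm ?a \<le> A"
      using norm_triangle_ineq[of X "e *\<^sub>R P"] eP h by (simp add: A_def add_increasing2)
    have "norm u = norm ((u + m *\<^sub>R ?a) - m *\<^sub>R ?a)" by simp
    also have "\<dots> \<le> norm (u + m *\<^sub>R ?a) + norm (m *\<^sub>R ?a)" by (rule norm_triangle_ineq4)
    also have "\<dots> \<le> norm (u + m *\<^sub>R ?a) + norm (- u + m *\<^sub>R ?b) + m * norm ?a" using h by simp
    also have "\<dots> \<le> B * (m * (l ?a + l ?b)) + m * A"
      using n1 n2 na h mult_left_mono[OF na h(3)] by (simp add: algebra_simps)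
    also have "\<dots> \<le> B * (m * (l X + l P + l X + l Q)) + m * A"
      using la h B by (intro add_right_mono mult_left_mono) auto
    also have "\<dots> = m * A'" by (simp add: A'_def algebra_simps)
    finally have "norm u \<le> m * A'" .
    moreover have "0 < norm u" using u_nonzero by simp
    ultimately have "norm u < m * (2 * A')" using A' by linarith
    then show ?thesis using A' by (simp add: pos_divide_less_eq)
  qed
  then show ?thesis using u_nonzero A' by (intro exI[of _ "norm u / (2 * A')"]) auto
qed

text \<open>With P and Q exchanged for \<open>J \<nu>\<close>, the two memberships bound f(v / n)
  and f(- v / n) for n = 2 m + C, where \<open>compare\<close> causes the doubling. Their normal
  components s and - s cancel in the sum, which leaves a multiple of e m / n.\<close>

lemma both_twosided:
  assumes coords: "u = a *\<^sub>R X + J (v + s *\<^sub>R \<nu>)" and v: "v \<in> tangent \<nu>" and t0: "0 < t0"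
  shows "\<exists>c>0. \<exists>C. 0 < C \<and> 1 / C < t0 \<and> (\<forall>\<^sub>F e in at_right 0. \<forall>m. 0 \<le> m \<and> e * m \<le> 1 \<and> both e m
    \<longrightarrow> twosided f v (1 / (2 * m + C)) < c * e)"
proof -
  have Ki: "P \<in> tcone" "Q \<in> tcone" using P Q ends_K_inf by auto
  obtain c1 e1 where c1: "0 < c1" "0 < e1" and 1: "\<And>e m w. 0 < e \<and> e < e1 \<and> 0 \<le> m \<and>
      w + m *\<^sub>R X + (m * e) *\<^sub>R P \<in> K \<Longrightarrow> w + (2 * m) *\<^sub>R X + (c1 * m * e) *\<^sub>R J \<nu> \<in> K"
    using compare[OF Ki(1) J_nu_tcone] by blast
  obtain c2 e2 where c2: "0 < c2" "0 < e2" and 2: "\<And>e m w. 0 < e \<and> e < e2 \<and> 0 \<le> m \<and>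
      w + m *\<^sub>R X + (m * e) *\<^sub>R Q \<in> K \<Longrightarrow> w + (2 * m) *\<^sub>R X + (c2 * m * e) *\<^sub>R J \<nu> \<in> K"
    using compare[OF Ki(2) J_nu_tcone] by blast
  \<comment> \<open>The summands dominate the X coordinates of u and - u, bring 1 / (2 m + C) below
    t0, and keep the offsets within \<rho>; the rest is slack for strict inequalities.\<close>
  define C where "C = \<bar>a\<bar> + 2 / t0 + 2 * (norm v + \<bar>s\<bar> + c1 + c2) / \<rho> + 1"
  have C_parts: "0 \<le> \<bar>a\<bar>" "0 < 1 / t0" "2 / t0 = 1 / t0 + 1 / t0" "0 \<le> 2 * (norm v + \<bar>s\<bar> + c1 + c2) / \<rho>"
    using \<rho> c1 c2 t0 by (simp_all add: add_nonneg_nonneg)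
  have Ca: "\<bar>a\<bar> \<le> C" and C0: "0 < C" and Ct: "1 / t0 < C" using C_parts by (auto simp only: C_def)
  have C\<rho>: "norm v + \<bar>s\<bar> + c1 + c2 < \<rho> * C"
  proof -
    have "norm v + \<bar>s\<bar> + c1 + c2 < \<rho> * (2 * (norm v + \<bar>s\<bar> + c1 + c2) / \<rho>)"
    proof -
      have "0 < norm v + \<bar>s\<bar> + c1 + c2" using c1 c2 by (smt (verit) norm_ge_zero)
      then show ?thesis using \<rho> by simp
    qed
    also have "\<dots> \<le> \<rho> * C" unfolding C_def using \<rho> t0 by (intro mult_left_mono) auto
    finally show ?thesis .
  qed
  have main: "twosided f v (1 / (2 * m + C)) < (c1 + c2) * e"
    if e: "0 < e" "e < e1" "e < e2" and m: "0 \<le> m" "e * m \<le> 1" "both e m" for e m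
  proof -
    let ?n = "2 * m + C"
    have n: "0 < ?n" using C0 m by simp
    have em: "0 \<le> m * e" "m * e \<le> 1" using e m by (auto simp: mult.commute)
    have "u + m *\<^sub>R X + (m * e) *\<^sub>R P \<in> K" "- u + m *\<^sub>R X + (m * e) *\<^sub>R Q \<in> K"
      using m(3) by (simp_all add: both_def algebra_simps)
    then have "u + (2 * m) *\<^sub>R X + (c1 * m * e) *\<^sub>R J \<nu> \<in> K" "- u + (2 * m) *\<^sub>R X + (c2 * m * e) *\<^sub>R J \<nu> \<in> K"
      using 1 2 e m by blast+
    then have "J (v + (s + c1 * m * e) *\<^sub>R \<nu>) + (2 * m + a) *\<^sub>R X \<in> K"
      "J (- v + (- s + c2 * m * e) *\<^sub>R \<nu>) + (2 * m - a) *\<^sub>R X \<in> K"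
      by (simp_all add: coords algebra_simps)
    then have "J (v + (s + c1 * m * e) *\<^sub>R \<nu>) + ?n *\<^sub>R X \<in> K" "J (- v + (- s + c2 * m * e) *\<^sub>R \<nu>) + ?n *\<^sub>R X \<in> K"
      using Ca by (auto elim!: K_inf_up simp del: J_simps)
    then have mem: "?n *\<^sub>R X + J (v + (s + c1 * m * e) *\<^sub>R \<nu>) \<in> K" "?n *\<^sub>R X + J (- v + (- s + c2 * m * e) *\<^sub>R \<nu>) \<in> K"
      by (simp_all only: add.commute)
    have ce: "0 \<le> c1 * m * e" "c1 * m * e \<le> c1" "0 \<le> c2 * m * e" "c2 * m * e \<le> c2"
      using mult_left_mono[OF em(2), of c1] mult_left_mono[OF em(2), of c2] c1 c2 em by (auto simp: mult.assoc)
    have small: "norm (v' + r *\<^sub>R \<nu>) < \<rho> * ?n" if "norm v' = norm v" "\<bar>r\<bar> \<le> \<bar>s\<bar> + c1 + c2" for v' r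
    proof -
      have "norm (v' + r *\<^sub>R \<nu>) \<le> norm v + \<bar>r\<bar>" using norm_triangle_ineq[of v' "r *\<^sub>R \<nu>"] norm_nu that by simp
      also have "\<dots> < \<rho> * C" using C\<rho> that by linarith
      also have "\<dots> \<le> \<rho> * ?n" using m \<rho> by (intro mult_left_mono) auto
      finally show ?thesis .
    qed
    have abs1: "\<bar>s + c1 * m * e\<bar> \<le> \<bar>s\<bar> + c1 + c2" and abs2: "\<bar>- s + c2 * m * e\<bar> \<le> \<bar>s\<bar> + c1 + c2"
      using ce c1 c2 by linarith+
    have "f ((1 / ?n) *\<^sub>R v) < (s + c1 * m * e) / ?n"
      using mem(1) graph_scaled[OF v n small[OF refl abs1]] by blast
    moreover have "f ((1 / ?n) *\<^sub>R (- v)) < (- s + c2 * m * e) / ?n"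
      using mem(2) graph_scaled[OF tangent_uminus[OF v] n small[OF norm_minus_cancel abs2]] by blast
    ultimately have "twosided f v (1 / ?n) < (s + c1 * m * e) / ?n + (- s + c2 * m * e) / ?n"
      unfolding twosided_def by simp
    also have "\<dots> = (c1 + c2) * e * (m / ?n)" by (simp add: add_divide_distrib[symmetric] algebra_simps)
    also have "\<dots> \<le> (c1 + c2) * e * 1"
    proof (intro mult_left_mono)
      show "m / ?n \<le> 1" using m C0 n by (simp add: pos_divide_le_eq)
    qed (use e c1 c2 in auto)
    finally show ?thesis by simp
  qed
  have "\<forall>\<^sub>F e in at_right (0::real). e < min e1 e2 \<and> 0 < e"
    using c1 c2 eventually_at_right_real[of 0 "min e1 e2"] by (auto elim: eventually_mono)
  then have "\<forall>\<^sub>F e in at_right 0. \<forall>m. 0 \<le> m \<and> e * m \<le> 1 \<and> both e m \<longrightarrow> twosided f v (1 / (2 * m + C)) < (c1 + c2) * e"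
    by eventually_elim (use main in auto)
  moreover have "1 / C < t0" using Ct C0 t0 by (simp add: field_simps)
  ultimately show ?thesis using c1 c2 C0 by (intro exI[of _ "c1 + c2"] exI[of _ C] conjI) auto
qed

text \<open>For y \<le> 0 the order e of \<open>both_bounded_below\<close> is enough. For y > 0,
  \<open>both\<close> bounds \<open>twosided\<close> at 1 / (2 m + C) by c e while the exponent
  bounds it from below; together they force 2 m + C > A e^(-y), so \<open>both\<close> fails at a
  smaller multiple of e^(-y).\<close>

lemma hdist_growth_lower:
  assumes coords: "u = a *\<^sub>R X + J (v + s *\<^sub>R \<nu>)" and v: "v \<in> tangent \<nu> - {0}"
    and y: "y < 1" "y \<le> 0 \<or> alpha f v < ereal (1 / y)"
  shows "\<exists>c>0. \<forall>\<^sub>F e in at_right 0. c * e powr (1 - y) \<le> hdist e"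
proof (cases "y \<le> 0")
  case True
  obtain c where c: "0 < c" "\<And>e m. 0 < e \<Longrightarrow> e < 1 \<Longrightarrow> 0 \<le> m \<Longrightarrow> both e m \<Longrightarrow> c < m"
    using both_bounded_below by blast
  have "\<forall>\<^sub>F e in at_right 0. e powr 1 < 1 / (2 * c)" using c by (intro eventually_powr_small) auto
  then have "\<forall>\<^sub>F e in at_right 0. (c / 4) * e powr (1 - y) \<le> hdist e"
    using eventually_small[of 0]
  proof eventually_elim
    case (elim e)
    have "e * c \<le> 1 / 2" using elim c by (simp add: field_simps)
    moreover have "\<not> both e c" using c(2)[of e c] elim c(1) by auto
    ultimately have "e * c / 4 \<le> hdist e" using elim c by (intro hdist_lower) auto
    moreover have "e powr (1 - y) \<le> e powr 1" using elim True by (intro powr_mono') auto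
    then have "(c / 4) * e powr (1 - y) \<le> (c / 4) * e" using elim c by (intro mult_left_mono) auto
    ultimately show ?case by (simp add: mult.commute)
  qed
  then show ?thesis using c(1) by (intro exI[of _ "c / 4"]) auto
next
  case False
  then have y0: "0 < y" and b: "alpha f v < ereal (1 / y)" using y by auto
  obtain t0 where t0: "0 < t0" "\<And>t. 0 < t \<Longrightarrow> t < t0 \<Longrightarrow> 2 * t powr (1 / y) < twosided f v t"
    using alpha_less[OF v b] unfolding eventually_at_right_field by auto
  have "v \<in> tangent \<nu>" using v by simp
  then obtain c C where c: "0 < c" "0 < C" "1 / C < t0" and ev: "\<forall>\<^sub>F e in at_right 0. \<forall>m. 0 \<le> m \<and> e * m \<le> 1 \<and> both e m
    \<longrightarrow> twosided f v (1 / (2 * m + C)) < c * e"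
    using both_twosided[OF coords _ t0(1)] by blast
  \<comment> \<open>The equation 2 n^(-1/y) = c e has the solution n = A e^(-y).\<close>
  define A where "A = (c / 2) powr (- y)"
  have A: "0 < A" using c by (simp add: A_def)
  have "\<forall>\<^sub>F e in at_right 0. e powr (1 - y) < 2 / A" using y A by (intro eventually_powr_small) auto
  then have "\<forall>\<^sub>F e in at_right 0. (A / 16) * e powr (1 - y) \<le> hdist e"
    using ev eventually_powr_large[OF y0, of "2 * C / A"] eventually_small[of 0]
  proof eventually_elim
    case (elim e)
    \<comment> \<open>With a quarter, 2 m is only half of A e^(-y), and the other half eventually
      exceeds C.\<close>
    define m where "m = A / 4 * e powr (- y)"
    have m: "0 \<le> m" using A by (simp add: m_def)
    have em: "e * m = A / 4 * e powr (1 - y)" using elim by (simp add: m_def powr_diff powr_minus_divide)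
    have em2: "e * m \<le> 1 / 2" unfolding em using elim A by (simp add: field_simps)
    have "\<not> both e m"
    proof
      assume "both e m"
      then have g: "twosided f v (1 / (2 * m + C)) < c * e" using elim m em2 by auto
      have n: "0 < 2 * m + C" using m c by simp
      have "1 / (2 * m + C) \<le> 1 / C" using m c by (intro divide_left_mono) auto
      then have "2 * (1 / (2 * m + C)) powr (1 / y) < twosided f v (1 / (2 * m + C))"
        using n c(3) by (intro t0(2)) auto
      then have "(1 / (2 * m + C)) powr (1 / y) < c / 2 * e" using g by simp
      then have "((1 / (2 * m + C)) powr (1 / y)) powr y < (c / 2 * e) powr y"
        using y0 by (intro powr_less_mono2) auto
      then have "1 / (2 * m + C) < (c / 2) powr y * e powr y"
        using n y0 c elim powr_mult[of "c / 2" e y] by (simp add: powr_powr)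
      also have "\<dots> = 1 / (A * e powr (- y))" by (simp add: A_def powr_minus_divide)
      finally have "A * e powr (- y) < 2 * m + C"
        using n A elim by (simp add: field_simps)
      then have "A / 2 * e powr (- y) < C" by (simp add: m_def field_simps)
      then show False using elim A by (simp add: field_simps)
    qed
    then have "e * m / 4 \<le> hdist e" using elim m em2 by (intro hdist_lower) auto
    then show ?case by (simp add: em)
  qed
  then show ?thesis using A by (intro exI[of _ "A / 16"]) auto
qed

text \<open>For m = C / e the term m e R is the constant C R, which brings w into the tangent cone,
  while the multiple of X grows. This gives a bounded distance.\<close>

lemma tcone_eventually:
  assumes R: "R \<in> tcone" shows "\<exists>C0. \<forall>C\<ge>C0. \<forall>\<^sub>F e in at_right 0. w + (C / e) *\<^sub>R (X + e *\<^sub>R R) \<in> K"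
proof -
  obtain C0 where C0: "0 < C0" "\<And>r. r \<ge> C0 \<Longrightarrow> r *\<^sub>R R + w \<in> tcone" using T.add_large[OF R] by blast
  have "\<forall>\<^sub>F e in at_right 0. w + (C / e) *\<^sub>R (X + e *\<^sub>R R) \<in> K" if C: "C \<ge> C0" for C
  proof -
    obtain d where d: "C *\<^sub>R R + w + d *\<^sub>R X \<in> K" using C0(2)[OF C] by (auto simp: tcone_def)
    have "\<forall>\<^sub>F e in at_right 0. d / C < inverse e"
      using filterlim_inverse_at_top_right by (simp add: filterlim_at_top_dense)
    then show ?thesis using eventually_small[of 0]
    proof eventually_elim
      case (elim e)
      have "d \<le> C / e" using elim C0 C by (simp add: field_simps)
      then have "C *\<^sub>R R + w + (C / e) *\<^sub>R X \<in> K" by (rule K_inf_up[OF d])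
      also have "C *\<^sub>R R + w + (C / e) *\<^sub>R X = w + (C / e) *\<^sub>R (X + e *\<^sub>R R)"
        using elim by (simp add: algebra_simps)
      finally show ?case .
    qed
  qed
  then show ?thesis by blast
qed

text \<open>In the absence of a normal component, the graph condition amounts to f(t v) below a
  multiple of e, with t about 1 / m. As f(t v) is at most of order t^(1/y), a t of order e^y
  works.\<close>

lemma flat_eventually:
  assumes R: "R \<in> tcone" and w: "w = a *\<^sub>R X + J v" and v: "v \<in> tangent \<nu> - {0}"
    and y: "0 < y" "ereal (1 / y) < alpha f v"
  shows "\<exists>C>0. \<forall>\<^sub>F e in at_right 0. \<exists>m\<ge>0. m \<le> C * e powr (- y) \<and> w + m *\<^sub>R (X + e *\<^sub>R R) \<in> K"
proof -
  obtain c e0 where c: "0 < c" "0 < e0" and cmp: "\<And>e m w. 0 < e \<and> e < e0 \<and> 0 \<le> m \<and>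
      w + m *\<^sub>R X + (m * e) *\<^sub>R J \<nu> \<in> K \<Longrightarrow> w + (2 * m) *\<^sub>R X + (c * m * e) *\<^sub>R R \<in> K"
    using compare[OF J_nu_tcone R] by blast
  \<comment> \<open>Chosen so that 2 \<tau>^(1/y) = e / c, half of the e1 = 2 e / c used
    below.\<close>
  define \<tau> where "\<tau> e = (e / (2 * c)) powr y" for e
  have \<tau>_pos: "0 < \<tau> e" if "0 < e" for e using that c by (simp add: \<tau>_def)
  have \<tau>_eq: "\<tau> e = (2 * c) powr (- y) * e powr y" if "0 < e" for e
    using that c by (simp add: \<tau>_def powr_divide powr_minus_divide)
  have "((\<lambda>e. (2 * c) powr (- y) * e powr y) \<longlongrightarrow> (2 * c) powr (- y) * 0 powr y) (at_right 0)"
    using y eventually_at_right_less[of "0::real"]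
    by (intro tendsto_intros tendsto_powr' tendsto_ident_at) (auto elim: eventually_mono)
  then have "((\<lambda>e. (2 * c) powr (- y) * e powr y) \<longlongrightarrow> 0) (at_right 0)" by simp
  moreover have "\<forall>\<^sub>F e in at_right 0. (2 * c) powr (- y) * e powr y = \<tau> e"
    using eventually_small[of 0] by eventually_elim (simp add: \<tau>_eq)
  ultimately have lim: "(\<tau> \<longlongrightarrow> 0) (at_right 0)" by (rule Lim_transform_eventually)
  have "\<forall>\<^sub>F e in at_right 0. \<tau> e \<in> {0<..} \<and> \<tau> e \<noteq> 0"
    using eventually_small[of 0]
  proof eventually_elim
    case (elim e)
    then show ?case using \<tau>_pos[of e] by simp
  qed
  then have flim: "filterlim \<tau> (at_right 0) (at_right 0)" using lim by (simp add: filterlim_at)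
  have 1: "\<forall>\<^sub>F e in at_right 0. twosided f v (\<tau> e) < 2 * \<tau> e powr (1 / y)"
    using less_alpha[OF v y(2)] filterlim_iff[THEN iffD1, OF flim] by blast
  have 2: "\<forall>\<^sub>F e in at_right 0. norm (\<tau> e *\<^sub>R v) < \<rho>"
  proof -
    have "\<forall>\<^sub>F t in at_right 0. norm (t *\<^sub>R v) < \<rho>" using eventually_small[of v] by eventually_elim blast
    then show ?thesis using filterlim_iff[THEN iffD1, OF flim] by blast
  qed
  have "((\<lambda>e. \<tau> e * \<bar>a\<bar>) \<longlongrightarrow> 0 * \<bar>a\<bar>) (at_right 0)" by (intro tendsto_intros lim)
  then have 3: "\<forall>\<^sub>F e in at_right 0. \<tau> e * \<bar>a\<bar> < 1 / 2" by (intro order_tendstoD) auto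
  have "((\<lambda>e. \<tau> e * norm v + 3 / 2 * (2 * e / c)) \<longlongrightarrow> 0 * norm v + 3 / 2 * (2 * 0 / c)) (at_right 0)"
    using c by (intro tendsto_intros lim tendsto_ident_at) auto
  then have 4: "\<forall>\<^sub>F e in at_right 0. \<tau> e * norm v + 3 / 2 * (2 * e / c) < \<rho>"
    using \<rho> by (intro order_tendstoD) auto
  have 5: "\<forall>\<^sub>F e in at_right (0::real). e < c * e0 / 2"
    using c eventually_at_right_real[of 0 "c * e0 / 2"] by (auto elim: eventually_mono)
  have "\<forall>\<^sub>F e in at_right 0. \<exists>m\<ge>0. m \<le> (3 * (2 * c) powr y) * e powr (- y) \<and> w + m *\<^sub>R (X + e *\<^sub>R R) \<in> K"
    using 1 2 3 4 5 eventually_small[of 0]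
  proof eventually_elim
    case (elim e)
    \<comment> \<open>For this e1 the term c m e1 R returned by \<open>compare\<close> is 2 m e R,
      which matches the doubled multiple of X.\<close>
    define e1 where "e1 = 2 * e / c"
    define t where "t = \<tau> e"
    \<comment> \<open>Compensates the X coordinate of w: the total coefficient of X becomes 1 /
      t.\<close>
    define m where "m = 1 / t - a"
    have e: "0 < e" using elim by simp
    have t: "0 < t" using \<tau>_pos e by (simp add: t_def)
    have ta: "t * \<bar>a\<bar> < 1 / 2" using elim(3) by (simp add: t_def)
    have "\<bar>t * a\<bar> < 1 / 2" using ta t by (simp add: abs_mult)
    moreover have tm: "t * m = 1 - t * a" using t by (simp add: m_def algebra_simps)
    ultimately have tm1: "1 / 2 \<le> t * m" "t * m \<le> 3 / 2" by (auto simp: abs_less_iff)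
    then have "0 < t * m" by linarith
    then have m: "0 \<le> m" using t by (simp add: zero_less_mult_iff)
    have e1: "0 < e1" "e1 < e0" using elim(5) e c by (auto simp: e1_def field_simps)
    have "t powr (1 / y) = e / (2 * c)" using y e c by (simp add: t_def \<tau>_def powr_powr)
    then have "2 * t powr (1 / y) = e1 / 2" by (simp add: e1_def)
    then have "twosided f v t < e1 / 2" using elim(1) by (simp add: t_def)
    then have "f (t *\<^sub>R v) < e1 / 2" using twosided_nonneg[of v t] v elim(2) by (simp add: twosided_def t_def)
    also have "\<dots> \<le> e1 * (t * m)" using mult_left_mono[OF tm1(1), of e1] e1 by simp
    finally have ft: "f (t *\<^sub>R v) < (m * e1) / (1 / t)" by (simp add: ac_simps)
    have "norm (v + (m * e1) *\<^sub>R \<nu>) \<le> norm v + m * e1"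
      using norm_triangle_ineq[of v "(m * e1) *\<^sub>R \<nu>"] norm_nu m e1 by simp
    then have "t * norm (v + (m * e1) *\<^sub>R \<nu>) \<le> t * (norm v + m * e1)" using t by (intro mult_left_mono) auto
    also have "\<dots> = t * norm v + (t * m) * e1" by (simp add: algebra_simps)
    also have "\<dots> \<le> t * norm v + 3 / 2 * e1" using tm1 e1 by (intro add_left_mono mult_right_mono) auto
    also have "\<dots> < \<rho>" using elim(4) by (simp add: t_def e1_def)
    finally have "norm (v + (m * e1) *\<^sub>R \<nu>) < \<rho> * (1 / t)" using t by (simp add: pos_less_divide_eq mult.commute)
    then have "(1 / t) *\<^sub>R X + J (v + (m * e1) *\<^sub>R \<nu>) \<in> K"
      using graph_scaled[of v "1 / t" "m * e1"] v t ft by simp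
    also have "(1 / t) *\<^sub>R X + J (v + (m * e1) *\<^sub>R \<nu>) = w + m *\<^sub>R X + (m * e1) *\<^sub>R J \<nu>"
      by (simp add: w m_def algebra_simps)
    finally have "w + (2 * m) *\<^sub>R X + (c * m * e1) *\<^sub>R R \<in> K" using cmp e1 m by blast
    also have "w + (2 * m) *\<^sub>R X + (c * m * e1) *\<^sub>R R = w + (2 * m) *\<^sub>R (X + e *\<^sub>R R)"
      using c by (simp add: e1_def scaleR_add_right)
    finally have mem: "w + (2 * m) *\<^sub>R (X + e *\<^sub>R R) \<in> K" .
    have "1 / t = (2 * c) powr y * e powr (- y)"
      using \<tau>_eq[OF e] by (simp add: t_def powr_minus_divide)
    moreover have "m \<le> 3 / 2 * (1 / t)" using tm1(2) t by (simp add: field_simps)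
    ultimately have "2 * m \<le> (3 * (2 * c) powr y) * e powr (- y)" by simp
    then show ?case using mem m by (intro exI[of _ "2 * m"]) auto
  qed
  then show ?thesis using c by (intro exI[of _ "3 * (2 * c) powr y"]) auto
qed

lemma member_mono:
  assumes "w + m *\<^sub>R (X + e *\<^sub>R R) \<in> K" "R \<in> ends" "0 < e" "m \<le> m'"
  shows "w + m' *\<^sub>R (X + e *\<^sub>R R) \<in> K"
proof -
  have "(w + m *\<^sub>R (X + e *\<^sub>R R)) + (m' - m) *\<^sub>R (X + e *\<^sub>R R) \<in> K"
    using assms ends_segment[of R e] closure_subset
    by (intro add_closure_K[of "w + m *\<^sub>R (X + e *\<^sub>R R)"] closure_scale_nonneg) auto
  then show ?thesis by (simp add: algebra_simps)
qed

text \<open>For y \<ge> 1 a bounded distance suffices, since e^(1-y) \<ge> 1 for e < 1. For y < 1,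
  \<open>flat_eventually\<close> is applied to u with P and to - u with Q.\<close>

lemma hdist_growth_upper:
  assumes coords: "u = a *\<^sub>R X + J (v + s *\<^sub>R \<nu>)" and v: "v \<in> tangent \<nu> - {0}"
    and y: "1 \<le> y \<or> 0 < y \<and> ereal (1 / y) < alpha f v \<and> s = 0"
  shows "\<exists>C>0. \<forall>\<^sub>F e in at_right 0. hdist e \<le> C * e powr (1 - y)"
proof (cases "1 \<le> y")
  case True
  have Ki: "P \<in> tcone" "Q \<in> tcone" using P Q ends_K_inf by auto
  obtain C1 where C1: "\<And>C. C \<ge> C1 \<Longrightarrow> \<forall>\<^sub>F e in at_right 0. u + (C / e) *\<^sub>R (X + e *\<^sub>R P) \<in> K"
    using tcone_eventually[OF Ki(1)] by blast
  obtain C2 where C2: "\<And>C. C \<ge> C2 \<Longrightarrow> \<forall>\<^sub>F e in at_right 0. - u + (C / e) *\<^sub>R (X + e *\<^sub>R Q) \<in> K"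
    using tcone_eventually[OF Ki(2)] by blast
  define C where "C = max 1 (max C1 C2)"
  have C: "0 < C" "C1 \<le> C" "C2 \<le> C" by (auto simp: C_def)
  have "\<forall>\<^sub>F e in at_right 0. hdist e \<le> C * e powr (1 - y)"
    using C1[OF C(2)] C2[OF C(3)] eventually_small[of 0]
  proof eventually_elim
    case (elim e)
    have "hdist e \<le> e * (C / e)" using elim C by (intro hdist_upper) (auto simp: both_def)
    also have "\<dots> = C * 1" using elim by simp
    also have "\<dots> \<le> C * e powr (1 - y)"
    proof (intro mult_left_mono)
      have "e powr 0 \<le> e powr (1 - y)" using elim True by (intro powr_mono') auto
      then show "1 \<le> e powr (1 - y)" using elim by simp
    qed (use C in auto)
    finally show ?case .
  qed
  then show ?thesis using C(1) by blast
next
  case False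
  then have y: "0 < y" "ereal (1 / y) < alpha f v" and u: "u = a *\<^sub>R X + J v" using assms by auto
  have Ki: "P \<in> tcone" "Q \<in> tcone" using P Q ends_K_inf by auto
  have mu: "- u = (- a) *\<^sub>R X + J (- v)" by (simp add: u)
  have mv: "- v \<in> tangent \<nu> - {0}" "ereal (1 / y) < alpha f (- v)"
    using v y tangent_uminus alpha_scale[OF v, of "-1"] by auto
  obtain C1 where C1: "0 < C1" "\<forall>\<^sub>F e in at_right 0. \<exists>m\<ge>0. m \<le> C1 * e powr (- y) \<and> u + m *\<^sub>R (X + e *\<^sub>R P) \<in> K"
    using flat_eventually[OF Ki(1) u v y] by blast
  obtain C2 where C2: "0 < C2" "\<forall>\<^sub>F e in at_right 0. \<exists>m\<ge>0. m \<le> C2 * e powr (- y) \<and> - u + m *\<^sub>R (X + e *\<^sub>R Q) \<in> K"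
    using flat_eventually[OF Ki(2) mu mv(1) y(1) mv(2)] by blast
  define C where "C = C1 + C2"
  have "\<forall>\<^sub>F e in at_right 0. hdist e \<le> C * e powr (1 - y)"
    using C1(2) C2(2) eventually_small[of 0]
  proof eventually_elim
    case (elim e)
    have le: "C1 * e powr (- y) \<le> C * e powr (- y)" "C2 * e powr (- y) \<le> C * e powr (- y)"
      using C1 C2 by (auto simp: C_def intro: mult_right_mono)
    \<comment> \<open>The two memberships come with different values of m;
      \<open>member_mono\<close> raises both to a common one.\<close>
    have "both e (C * e powr (- y))"
      unfolding both_def using elim le member_mono[OF _ P] member_mono[OF _ Q] by (meson order_trans)
    then have "hdist e \<le> e * (C * e powr (- y))" using elim C1 C2 by (intro hdist_upper) (auto simp: C_def)
    also have "\<dots> = C * e powr (1 - y)" using elim by (simp add: powr_diff powr_minus_divide)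
    finally show ?case .
  qed
  then show ?thesis using C1 C2 by (intro exI[of _ C]) (auto simp: C_def)
qed

text \<open>Here g is 1 / \<alpha>, or 0 for \<alpha> = \<infinity>. An upper bound with y < 1 is
  demanded only for y > g, which forces \<alpha> > 1 and hence s = 0.\<close>

lemma hdist_rate:
  assumes coords: "u = a *\<^sub>R X + J (v + s *\<^sub>R \<nu>)" and v: "v \<in> tangent \<nu> - {0}"
    and s: "1 < alpha f v \<Longrightarrow> s = 0"
  shows "((\<lambda>t. ereal (1 / t * ln (hdist (exp (- 2 * t))))) \<longlongrightarrow> lyapunov_exponent (alpha f v)) at_top"
proof -
  have a1: "1 \<le> alpha f v" using log_ratio_tendsto_alpha(2)[OF regular v] .
  obtain g where g: "0 \<le> g" "g \<le> 1" and lyap: "lyapunov_exponent (alpha f v) = ereal (- 2 + 2 * g)"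
    and g1: "\<And>y. y < g \<Longrightarrow> y \<le> 0 \<or> alpha f v < ereal (1 / y)"
    and g2: "\<And>y. g < y \<Longrightarrow> ereal (1 / y) < alpha f v"
  proof (cases "alpha f v")
    case PInf
    then show ?thesis by (intro that[of 0]) (auto simp: lyapunov_exponent_def)
  next
    case (real r)
    then have r: "1 \<le> r" using a1 by simp
    show ?thesis
    proof (rule that[of "1 / r"])
      show "lyapunov_exponent (alpha f v) = ereal (- 2 + 2 * (1 / r))"
        using r by (simp add: real lyapunov_exponent_def)
      show "y \<le> 0 \<or> alpha f v < ereal (1 / y)" if "y < 1 / r" for y
        using that r by (cases "y \<le> 0") (simp_all add: real field_simps)
      show "ereal (1 / y) < alpha f v" if "1 / r < y" for y
      proof -
        have "0 < 1 / r" using r by simp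
        then have "0 < y" using that by linarith
        then show ?thesis using that r by (simp add: real field_simps)
      qed
    qed (use r in auto)
  qed (use a1 in auto)
  have "((\<lambda>t. 1 / t * ln (hdist (exp (- 2 * t)))) \<longlongrightarrow> - 2 + 2 * g) at_top"
  proof (rule rate_tendsto)
    fix y assume y: "g < y"
    have "1 \<le> y \<or> 0 < y \<and> ereal (1 / y) < alpha f v \<and> s = 0"
    proof (cases "1 \<le> y")
      case False
      have y0: "0 < y" using y g by simp
      then have "ereal 1 < ereal (1 / y)" using False by simp
      then have "1 < alpha f v" using less_trans[OF _ g2[OF y]] unfolding one_ereal_def by blast
      then show ?thesis using s g2[OF y] y0 by blast
    qed simp
    then show "\<exists>C>0. \<forall>\<^sub>F e in at_right 0. hdist e \<le> C * e powr (1 - y)" by (rule hdist_growth_upper[OF coords v])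
  next
    fix y assume "y < g"
    then show "\<exists>c>0. \<forall>\<^sub>F e in at_right 0. c * e powr (1 - y) \<le> hdist e"
      using g by (intro hdist_growth_lower[OF coords v] g1) auto
  qed
  then show ?thesis unfolding lyap by simp
qed

text \<open>\<open>v0\<close> is the tangential part along \<nu>, to which \<open>hdist_rate\<close>
  applies, and \<open>v\<close> is the one along P, which the filtration sees. Either b = 0 and they
  coincide, or both have exponent 1.\<close>

lemma growth:
  "\<exists>a v b. v \<in> tangent \<nu> - {0} \<and> u = a *\<^sub>R X + J v + b *\<^sub>R P \<and>
    ((\<lambda>t. ereal (1 / t * ln (hdist (exp (- 2 * t))))) \<longlongrightarrow> lyapunov_exponent (alpha f v)) at_top"
proof -
  have Ki: "P \<in> tcone" using P ends_K_inf by auto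
  obtain pc z where z: "P = pc *\<^sub>R X + J z" using decomp by blast
  define ps ph where "ps = z \<bullet> \<nu>" and "ph = z - ps *\<^sub>R \<nu>"
  have ph: "ph \<in> tangent \<nu>" by (simp add: ph_def ps_def tangent_def inner_diff_left nu_nu)
  have Pz: "P = pc *\<^sub>R X + J (ph + ps *\<^sub>R \<nu>)" unfolding z ph_def by simp
  have ps: "0 < ps" using tcone_coord_pos[OF ph] Ki Pz by metis
  obtain a z' where z': "u = a *\<^sub>R X + J z'" using decomp by blast
  define s v0 where "s = z' \<bullet> \<nu>" and "v0 = z' - s *\<^sub>R \<nu>"
  have v0: "v0 \<in> tangent \<nu>" by (simp add: v0_def s_def tangent_def inner_diff_left nu_nu)
  have coords: "u = a *\<^sub>R X + J (v0 + s *\<^sub>R \<nu>)" unfolding z' v0_def by simp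
  have flat0: "s = 0" if "v0 = 0 \<or> 1 < alpha f v0"
  proof (rule ccontr)
    assume "s \<noteq> 0"
    then consider "0 < s" | "0 < - s" by linarith
    then show False
    proof cases
      case 1
      have "(J v0 + s *\<^sub>R J \<nu>) + a *\<^sub>R X \<in> tcone" using flat_tcone(1)[OF v0 that 1] by simp
      also have "(J v0 + s *\<^sub>R J \<nu>) + a *\<^sub>R X = u" by (simp add: coords)
      finally show False using u_not by blast
    next
      case 2
      have "(- J v0 + (- s) *\<^sub>R J \<nu>) + (- a) *\<^sub>R X \<in> tcone" using flat_tcone(2)[OF v0 that 2] K_inf_add_X by blast
      also have "(- J v0 + (- s) *\<^sub>R J \<nu>) + (- a) *\<^sub>R X = - u" by (simp add: coords)
      finally show False using u_not by blast
    qed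
  qed
  have v0_nz: "v0 \<noteq> 0" using flat0 coords u_not_X[of a] by auto
  \<comment> \<open>The multiple b P has the same normal component as
    \<open>s J \<nu>\<close>.\<close>
  define b v where "b = s / ps" and "v = v0 - b *\<^sub>R ph"
  have v: "v \<in> tangent \<nu>" using v0 ph by (simp add: v_def tangent_def inner_diff_left)
  have bps: "b * ps = s" using ps by (simp add: b_def)
  have uP: "u = (a - b * pc) *\<^sub>R X + J v + b *\<^sub>R P"
    unfolding coords Pz v_def by (simp add: bps algebra_simps)
  \<comment> \<open>A part of P can be replaced by \<open>J \<nu>\<close>, so
    \<open>flat_tcone\<close> also rules out a component along P.\<close>
  obtain d where d: "0 < d" "P - d *\<^sub>R J \<nu> \<in> tcone" using T.sub_small[OF Ki] by blast
  have flat: "b = 0" if "v = 0 \<or> 1 < alpha f v"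
  proof (rule ccontr)
    assume "b \<noteq> 0"
    then consider "0 < b" | "0 < - b" by linarith
    then show False
    proof cases
      case 1
      have "(J v + (b * d) *\<^sub>R J \<nu>) + b *\<^sub>R (P - d *\<^sub>R J \<nu>) \<in> tcone"
        using 1 d by (intro T.add_K T.scale_K flat_tcone(1)[OF v that]) auto
      then have "(J v + (b * d) *\<^sub>R J \<nu>) + b *\<^sub>R (P - d *\<^sub>R J \<nu>) + (a - b * pc) *\<^sub>R X \<in> tcone" by simp
      also have "(J v + (b * d) *\<^sub>R J \<nu>) + b *\<^sub>R (P - d *\<^sub>R J \<nu>) + (a - b * pc) *\<^sub>R X = u"
        unfolding uP by (simp add: algebra_simps)
      finally show False using u_not by blast
    next
      case 2
      have "(- J v + (- b * d) *\<^sub>R J \<nu>) + (- b) *\<^sub>R (P - d *\<^sub>R J \<nu>) \<in> tcone"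
        by (intro T.add_K T.scale_K flat_tcone(2)[OF v that] mult_pos_pos 2 d)
      then have "(- J v + (- b * d) *\<^sub>R J \<nu>) + (- b) *\<^sub>R (P - d *\<^sub>R J \<nu>) + (- (a - b * pc)) *\<^sub>R X \<in> tcone"
        using K_inf_add_X by blast
      also have "(- J v + (- b * d) *\<^sub>R J \<nu>) + (- b) *\<^sub>R (P - d *\<^sub>R J \<nu>) + (- (a - b * pc)) *\<^sub>R X = - u"
        unfolding uP by (simp add: algebra_simps)
      finally show False using u_not by blast
    qed
  qed
  have v_nz: "v \<noteq> 0"
  proof
    assume "v = 0"
    then have "b = 0" using flat by blast
    then show False using \<open>v = 0\<close> v0_nz by (simp add: v_def)
  qed
  have "alpha f v = alpha f v0"
  proof (cases "b = 0")
    case False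
    then have "s \<noteq> 0" using bps ps by auto
    then have "\<not> 1 < alpha f v" "\<not> 1 < alpha f v0" using flat flat0 False by auto
    then show ?thesis
      using log_ratio_tendsto_alpha(2)[OF regular, of v] log_ratio_tendsto_alpha(2)[OF regular, of v0] v v0 v_nz v0_nz
      by (auto simp: not_less)
  qed (simp add: v_def)
  moreover have "((\<lambda>t. ereal (1 / t * ln (hdist (exp (- 2 * t))))) \<longlongrightarrow> lyapunov_exponent (alpha f v0)) at_top"
    using v0 v0_nz flat0 by (intro hdist_rate[OF coords]) auto
  ultimately have "((\<lambda>t. ereal (1 / t * ln (hdist (exp (- 2 * t))))) \<longlongrightarrow> lyapunov_exponent (alpha f v)) at_top"
    by simp
  moreover have "v \<in> tangent \<nu> - {0}" using v v_nz by simp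
  ultimately show ?thesis using uP by blast
qed

end

section \<open>The filtration of the horosphere\<close>

lemma lyapunov_exponent_inject:
  assumes "1 \<le> a" "1 \<le> b" shows "lyapunov_exponent a = lyapunov_exponent b \<longleftrightarrow> a = b"
proof -
  have fin: "lyapunov_exponent (ereal r) = ereal (- 2 + 2 / r)" if "1 \<le> r" for r
    using that by (simp add: lyapunov_exponent_def)
  show ?thesis
  proof (cases a; cases b)
    fix r s assume "a = ereal r" "b = ereal s"
    then show ?thesis using assms by (auto simp: fin field_simps)
  next
    fix r assume "a = ereal r" "b = \<infinity>"
    then show ?thesis using assms by (simp add: fin lyapunov_exponent_infinity)
  next
    fix s assume "a = \<infinity>" "b = ereal s"
    then show ?thesis using assms by (simp add: fin lyapunov_exponent_infinity)
  qed (use assms in auto)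
qed

locale chart_cone = graph_cone K l B \<Omega> L X f \<nu> \<rho> J
  for K :: "('a::euclidean_space \<times> real) set" and l B \<Omega> L X f \<nu> \<rho> J +
  fixes P :: "'a \<times> real" and z\<^sub>0 :: 'a
  assumes P: "P \<in> ends"
begin

definition \<kappa> :: "'a \<Rightarrow> ('a \<times> real) projective"
  where "\<kappa> z = pt (X + J (z - z\<^sub>0))"

text \<open>The linear subspace over the projective completion of the affine subspace directed by H
  and (ox+), because X and P span the plane of that line.\<close>

definition flag :: "'a set \<Rightarrow> ('a \<times> real) set"
  where "flag H = span (insert X (insert P (J ` H)))"

lemma chart_nonzero: "X + J z \<noteq> 0"
  using indep[of 1 z] by auto

lemma pt_mem_directed_subspace:
  assumes H: "subspace H" and w: "w \<noteq> 0"
  shows "pt w \<in> directed_subspace \<kappa> H (pt (X + P)) (pt X) \<longleftrightarrow> w \<in> flag H"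
proof -
  have XP: "X + P \<noteq> 0" using P nonzero_K by (auto simp: ends_def)
  define W where "W = {X + J (z + h - z\<^sub>0) | z h. X + J (z - z\<^sub>0) \<in> span {X + P, X} \<and> h \<in> H}"
  have span: "\<kappa> z \<in> proj_span {pt (X + P), pt X} \<longleftrightarrow> X + J (z - z\<^sub>0) \<in> span {X + P, X}" for z
    unfolding \<kappa>_def by (rule pt_mem_proj_span_pair[OF chart_nonzero XP X_nonzero])
  have "\<kappa> ` {z + h | z h. \<kappa> z \<in> proj_span {pt (X + P), pt X} \<and> h \<in> H} = pt ` W"
  proof (intro set_eqI iffI, goal_cases)
    case (1 y)
    then obtain z h where zh: "\<kappa> z \<in> proj_span {pt (X + P), pt X}" "h \<in> H" "y = \<kappa> (z + h)" by blast
    then have "X + J (z + h - z\<^sub>0) \<in> W" using span unfolding W_def by blast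
    then show ?case using zh(3) unfolding \<kappa>_def by (rule rev_image_eqI)
  next
    case (2 y)
    then obtain z h where zh: "X + J (z - z\<^sub>0) \<in> span {X + P, X}" "h \<in> H" "y = pt (X + J (z + h - z\<^sub>0))"
      unfolding W_def by blast
    then have "y = \<kappa> (z + h)" by (simp add: \<kappa>_def)
    then show ?case using zh span by blast
  qed
  moreover have "0 \<notin> W"
  proof
    assume "0 \<in> W"
    then obtain z h where "0 = X + J (z + h - z\<^sub>0)" unfolding W_def by blast
    then show False using chart_nonzero by metis
  qed
  ultimately have 1: "pt w \<in> directed_subspace \<kappa> H (pt (X + P)) (pt X) \<longleftrightarrow> w \<in> span W"
    unfolding directed_subspace_def using pt_mem_proj_span[OF w] by simp
  have H0: "0 \<in> H" using H by (rule subspace_0)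
  have XW: "X + J h \<in> W" if "h \<in> H" for h
  proof -
    have "X + J (z\<^sub>0 - z\<^sub>0) \<in> span {X + P, X}" by (simp add: span_base)
    then show ?thesis unfolding W_def using that by (intro CollectI exI[of _ z\<^sub>0] exI[of _ h]) simp
  qed
  have "span W = flag H" unfolding flag_def
  proof (intro span_eq[THEN iffD2] conjI subsetI)
    fix y assume "y \<in> W"
    then obtain z h where y: "y = X + J (z + h - z\<^sub>0)" "X + J (z - z\<^sub>0) \<in> span {X + P, X}" "h \<in> H"
      by (auto simp: W_def)
    then obtain a b where ab: "X + J (z - z\<^sub>0) = a *\<^sub>R (X + P) + b *\<^sub>R X" using mem_span_pair by blast
    have "y = (X + J (z - z\<^sub>0)) + J h" using y(1) by (simp add: algebra_simps)
    then have "y = (a + b) *\<^sub>R X + a *\<^sub>R P + J h" unfolding ab by (simp add: algebra_simps)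
    then show "y \<in> span (insert X (insert P (J ` H)))"
      using y(3) by (auto intro!: span_add intro: span_scale span_base)
  next
    fix y assume "y \<in> insert X (insert P (J ` H))"
    then consider "y = X" | "y = P" | h where "h \<in> H" "y = J h" by blast
    then show "y \<in> span W"
    proof cases
      case 1
      then show ?thesis using XW[OF H0] by (simp add: span_base)
    next
      case 3
      then have "y = (X + J h) - (X + J 0)" by simp
      then show ?thesis using XW H0 3 by (metis span_base span_diff)
    next
      case 2
      obtain c z where P': "P = c *\<^sub>R X + J z" using decomp by blast
      \<comment> \<open>As P = c X + J z, the vector X + J z = P + (1 - c) X is the chart lift of a
        point of the line (ox+); this brings P into the span.\<close>
      have "X + J (z + z\<^sub>0 - z\<^sub>0) = 1 *\<^sub>R (X + P) + (- c) *\<^sub>R X" by (simp add: P')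
      then have "X + J (z + z\<^sub>0 - z\<^sub>0) \<in> span {X + P, X}" unfolding mem_span_pair by blast
      then have "X + J (z + z\<^sub>0 + 0 - z\<^sub>0) \<in> W" unfolding W_def using H0 by blast
      then have "X + J z \<in> W" by simp
      moreover have "P = (X + J z) + (c - 1) *\<^sub>R (X + J 0)" by (simp add: P' algebra_simps)
      ultimately show ?thesis using XW[OF H0] 2 by (metis span_add span_base span_scale)
    qed
  qed
  then show ?thesis using 1 by simp
qed

text \<open>P is transversal to the tangent hyperplane by \<open>tcone_coord_pos\<close>, so pairing
  with \<nu> removes its contribution; independence of X and \<open>J\<close> settles the
  rest.\<close>

lemma flag_coords:
  assumes H: "subspace H" "H \<subseteq> tangent \<nu>" and v: "v \<in> tangent \<nu>"
  shows "a *\<^sub>R X + J v + b *\<^sub>R P \<in> flag H \<longleftrightarrow> v \<in> H"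
proof
  assume "v \<in> H"
  then show "a *\<^sub>R X + J v + b *\<^sub>R P \<in> flag H"
    unfolding flag_def by (auto intro!: span_add intro: span_scale span_base)
next
  assume "a *\<^sub>R X + J v + b *\<^sub>R P \<in> flag H"
  then obtain a' b' where ab: "a *\<^sub>R X + J v + b *\<^sub>R P - a' *\<^sub>R X - b' *\<^sub>R P \<in> span (J ` H)"
    unfolding flag_def span_breakdown_eq[of _ X] span_breakdown_eq[of _ P] by blast
  have "subspace (J ` H)" using linear_J H(1) by (rule linear_subspace_image)
  then have "span (J ` H) = J ` H" by (simp add: span_eq_iff)
  then obtain h where h: "h \<in> H" "a *\<^sub>R X + J v + b *\<^sub>R P - a' *\<^sub>R X - b' *\<^sub>R P = J h" using ab by blast
  obtain c z where P': "P = c *\<^sub>R X + J z" using decomp by blast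
  define s where "s = z \<bullet> \<nu>"
  have "P = c *\<^sub>R X + J ((z - s *\<^sub>R \<nu>) + s *\<^sub>R \<nu>)" using P' by simp
  moreover have "P \<in> tcone" using ends_K_inf P by blast
  moreover have "z - s *\<^sub>R \<nu> \<in> tangent \<nu>" by (simp add: s_def tangent_def inner_diff_left nu_nu)
  ultimately have s: "0 < s" using tcone_coord_pos by metis
  have "(a - a' + (b - b') * c) *\<^sub>R X + J (v - h + (b - b') *\<^sub>R z) = 0"
    using h(2) unfolding P' by (simp add: algebra_simps)
  then have e: "v - h + (b - b') *\<^sub>R z = 0" using indep by blast
  then have "(v - h + (b - b') *\<^sub>R z) \<bullet> \<nu> = 0" by simp
  then have "(b - b') * s = 0"
    using v h(1) H(2) by (auto simp: tangent_def inner_add_left inner_diff_left s_def)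
  then have "b = b'" using s by simp
  then show "v \<in> H" using e h(1) by simp
qed

lemma filtration_tangent: "filtration \<nu> f e i \<subseteq> tangent \<nu>"
  by (auto simp: filtration_def tangent_def)

lemma mem_directed_iff:
  assumes Q: "Q \<in> ends" and u: "P - Q = a *\<^sub>R X + J v + b *\<^sub>R P" and v: "v \<in> tangent \<nu>"
  shows "pt (X + Q) \<in> directed_subspace \<kappa> (filtration \<nu> f e i) (pt (X + P)) (pt X) \<longleftrightarrow> v \<in> filtration \<nu> f e i"
proof -
  let ?H = "filtration \<nu> f e i"
  have nz: "X + Q \<noteq> 0" using Q nonzero_K by (auto simp: ends_def)
  have "Q = P - (P - Q)" by simp
  then have "X + Q = (1 - a) *\<^sub>R X + J (- v) + (1 - b) *\<^sub>R P" unfolding u by (simp add: algebra_simps)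
  then have "X + Q \<in> flag ?H \<longleftrightarrow> - v \<in> ?H"
    using flag_coords[OF subspace_filtration filtration_tangent tangent_uminus[OF v]] by metis
  also have "\<dots> \<longleftrightarrow> v \<in> ?H" using subspace_neg[OF subspace_filtration] by (metis minus_minus)
  finally show ?thesis using pt_mem_directed_subspace[OF subspace_filtration nz] by simp
qed

text \<open>Adding a positive multiple of X to an end vector moves it into the open cone, where no
  end vector lies.\<close>

lemma ends_not_parallel:
  assumes Q: "Q \<in> ends" and c: "P - Q = c *\<^sub>R X" shows "P = Q"
proof (rule ccontr)
  have *: False if R: "R \<in> ends" and S: "S \<in> ends" and d: "0 < d" "R - S = d *\<^sub>R X" for R S d
  proof -
    have "X + (1 / d) *\<^sub>R S \<in> K" using ends_segment S d by simp
    then have "d *\<^sub>R (X + (1 / d) *\<^sub>R S) \<in> K" using scale_K d by blast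
    also have "d *\<^sub>R (X + (1 / d) *\<^sub>R S) = d *\<^sub>R X + S" using d by (simp add: scaleR_add_right)
    also have "\<dots> = R" unfolding d(2)[symmetric] by simp
    finally show False using R by (simp add: ends_def)
  qed
  assume "P \<noteq> Q"
  then have "c \<noteq> 0" using c by auto
  moreover have "Q - P = (- c) *\<^sub>R X" using c by (metis minus_diff_eq scaleR_minus_left)
  ultimately show False using *[OF P Q _ c] *[OF Q P, of "- c"] by (cases "0 < c") auto
qed

lemma horosphere_direction:
  assumes x: "x \<in> horosphere \<Omega> (pt X) (pt (X + P))" "x \<noteq> pt (X + P)"
  shows "\<exists>v\<in>tangent \<nu> - {0}.
    (\<forall>e i. x \<in> directed_subspace \<kappa> (filtration \<nu> f e i) (pt (X + P)) (pt X) \<longleftrightarrow> v \<in> filtration \<nu> f e i) \<and>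
    ((\<lambda>t. ereal (1 / t * ln (hilbert_dist \<Omega> (radial_flow \<Omega> (pt X) t (pt (X + P))) (radial_flow \<Omega> (pt X) t x))))
      \<longlongrightarrow> lyapunov_exponent (alpha f v)) at_top"
proof -
  obtain Q where Q: "Q \<in> ends" "x = pt (X + Q)" "P - Q \<notin> tcone" "Q - P \<notin> tcone"
    using x(1) horosphere_iff[OF P] by blast
  have nX: "P - Q \<noteq> c *\<^sub>R X" for c using ends_not_parallel[OF Q(1)] x(2) Q(2) by auto
  interpret pair: horo_pair K l B \<Omega> L X f \<nu> \<rho> J P Q "P - Q"
    by unfold_locales (use P Q nX in auto)
  obtain a v b where v: "v \<in> tangent \<nu> - {0}" and u: "P - Q = a *\<^sub>R X + J v + b *\<^sub>R P"
    and lim: "((\<lambda>t. ereal (1 / t * ln (pair.hdist (exp (- 2 * t))))) \<longlongrightarrow> lyapunov_exponent (alpha f v)) at_top"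
    using pair.growth by blast
  have "hilbert_dist \<Omega> (radial_flow \<Omega> (pt X) t (pt (X + P))) (radial_flow \<Omega> (pt X) t x) = pair.hdist (exp (- 2 * t))" for t
    using radial_line_eq[OF P] radial_line_eq[OF Q(1)] by (simp add: radial_flow_def pair.hdist_def Q(2))
  moreover have "v \<in> tangent \<nu>" using v by simp
  ultimately show ?thesis
    using v lim mem_directed_iff[OF Q(1) u] Q(2) by (intro bexI[of _ v]) simp_all
qed

lemma base_in_horosphere: "pt (X + P) \<in> horosphere \<Omega> (pt X) (pt (X + P))"
  using P zero_not_K_inf unfolding horosphere_iff[OF P] by fastforce

lemma base_in_directed: "pt (X + P) \<in> directed_subspace \<kappa> (filtration \<nu> f e i) (pt (X + P)) (pt X)"
  using mem_directed_iff[OF P, of 0 0 0 e i] by (simp add: filtration_def tangent_def)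

text \<open>Supplies the strictness of the inclusions. From X + P one moves slightly along
  \<open>J v\<close> inside the cone and then radially onto the horosphere; the radial motion adds
  multiples of X and rescales, so v changes only by a nonzero factor.\<close>

lemma ex_horosphere_direction:
  assumes v: "v \<in> tangent \<nu> - {0}"
  shows "\<exists>x\<in>horosphere \<Omega> (pt X) (pt (X + P)).
    \<forall>e i. x \<in> directed_subspace \<kappa> (filtration \<nu> f e i) (pt (X + P)) (pt X) \<longleftrightarrow> v \<in> filtration \<nu> f e i"
proof -
  have XP: "X + P \<in> K" using P by (simp add: ends_def)
  obtain d where d: "0 < d" "X + P - d *\<^sub>R J v \<in> K" using sub_small[OF XP] by blast
  obtain Q0 where Q0: "Q0 \<in> ends" "pt (X + P - d *\<^sub>R J v) = pt (X + Q0)"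
    using ex_ends[OF pt_in_Omega[OF d(2)]] by blast
  have "X + Q0 \<in> K" using Q0(1) by (simp add: ends_def)
  then obtain c where c: "c \<noteq> 0" "X + Q0 = c *\<^sub>R (X + P - d *\<^sub>R J v)"
    using Q0(2) pt_eq_iff[of "X + Q0" "X + P - d *\<^sub>R J v"] nonzero_K d(2) by metis
  obtain r where r: "0 < r" "P - r *\<^sub>R Q0 \<notin> tcone" "r *\<^sub>R Q0 - P \<notin> tcone"
    using ex_minimal[OF P Q0(1)] by blast
  have Q: "r *\<^sub>R Q0 \<in> ends" using ends_scale Q0 r by blast
  have Q0_eq: "Q0 = c *\<^sub>R (X + P - d *\<^sub>R J v) - X" using c(2) by (metis add_diff_cancel_left')
  have u: "P - r *\<^sub>R Q0 = (r - r * c) *\<^sub>R X + J ((r * c * d) *\<^sub>R v) + (1 - r * c) *\<^sub>R P"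
    unfolding Q0_eq by (simp add: algebra_simps)
  have rcd: "r * c * d \<noteq> 0" using r c d by simp
  have "(r * c * d) *\<^sub>R v \<in> filtration \<nu> f e i \<longleftrightarrow> v \<in> filtration \<nu> f e i" for e i
    using subspace_mul[OF subspace_filtration, of "(r * c * d) *\<^sub>R v" e i "1 / (r * c * d)"]
      subspace_mul[OF subspace_filtration, of v e i "r * c * d"] rcd by auto
  moreover have "(r * c * d) *\<^sub>R v \<in> tangent \<nu>" using tangent_scale v by simp
  ultimately have "\<forall>e i. pt (X + r *\<^sub>R Q0) \<in> directed_subspace \<kappa> (filtration \<nu> f e i) (pt (X + P)) (pt X) \<longleftrightarrow> v \<in> filtration \<nu> f e i"
    using mem_directed_iff[OF Q u] by simp
  moreover have "pt (X + r *\<^sub>R Q0) \<in> horosphere \<Omega> (pt X) (pt (X + P))"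
    unfolding horosphere_iff[OF P] using Q r by blast
  ultimately show ?thesis by blast
qed

text \<open>Each point of the horosphere other than the base point has one index j: it belongs to F
  i exactly from i = j on, and its rate is that of \<open>e j\<close>. All assertions are read off
  from j.\<close>

lemma horosphere_filtration_growth:
  assumes ex: "exponents \<nu> f p e"
  defines "H \<equiv> horosphere \<Omega> (pt X) (pt (X + P))"
    and "F \<equiv> horosphere_filtration \<Omega> \<kappa> (pt (X + P)) (pt X) \<nu> f e"
  shows "F 0 = {pt (X + P)} \<and> (\<forall>i<p. F i \<subset> F (Suc i)) \<and> F p = H \<and>
    (\<forall>i\<in>{1..p}. F i - F (i - 1) =
      {x \<in> H - {pt (X + P)}.
        ((\<lambda>t. ereal (1 / t * ln (hilbert_dist \<Omega> (radial_flow \<Omega> (pt X) t (pt (X + P))) (radial_flow \<Omega> (pt X) t x))))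
          \<longlongrightarrow> lyapunov_exponent (e i)) at_top})"
proof -
  let ?q = "pt (X + P)"
  have img: "alpha f ` (tangent \<nu> - {0}) = e ` {1..p}" and
    dec: "\<And>i j. i \<in> {1..p} \<Longrightarrow> j \<in> {1..p} \<Longrightarrow> i < j \<Longrightarrow> e j < e i"
    using ex by (auto simp: exponents_def)
  have dec': "e j \<le> e i \<longleftrightarrow> i \<le> j" if "i \<in> {1..p}" "j \<in> {1..p}" for i j
    using dec[of i j] dec[of j i] that by (metis leD linorder_le_less_linear nle_le order_less_imp_le)
  have alpha_e: "\<exists>j\<in>{1..p}. alpha f v = e j" if "v \<in> tangent \<nu> - {0}" for v using img that by blast
  have e_ge: "1 \<le> e i" if "i \<in> {1..p}" for i
  proof -
    have "e i \<in> alpha f ` (tangent \<nu> - {0})" unfolding img using that by (rule imageI)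
    then obtain v where "v \<in> tangent \<nu> - {0}" "e i = alpha f v" by (rule imageE)
    then show ?thesis using log_ratio_tendsto_alpha(2)[OF regular] by simp
  qed
  have F_iff: "x \<in> F i \<longleftrightarrow> x \<in> H \<and> x \<in> directed_subspace \<kappa> (filtration \<nu> f e i) ?q (pt X)" for x i
    by (simp add: F_def H_def horosphere_filtration_def)
  have qF: "?q \<in> F i" for i using base_in_horosphere base_in_directed F_iff H_def by blast
  have mem: "v \<in> filtration \<nu> f e i \<longleftrightarrow> j \<le> i" if "v \<in> tangent \<nu> - {0}" "j \<in> {1..p}" "alpha f v = e j" "i \<le> p" for v i j
    using that dec'[of j i] by (cases "i = 0") (auto simp: filtration_def)
  have dir: "\<exists>v\<in>tangent \<nu> - {0}. \<exists>j\<in>{1..p}. alpha f v = e j \<and> (\<forall>i\<le>p. x \<in> F i \<longleftrightarrow> j \<le> i) \<and>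
      ((\<lambda>t. ereal (1 / t * ln (hilbert_dist \<Omega> (radial_flow \<Omega> (pt X) t ?q) (radial_flow \<Omega> (pt X) t x))))
      \<longlongrightarrow> lyapunov_exponent (e j)) at_top" if x: "x \<in> H" "x \<noteq> ?q" for x
  proof -
    obtain v where v: "v \<in> tangent \<nu> - {0}" and
      vi: "\<And>i. x \<in> directed_subspace \<kappa> (filtration \<nu> f e i) ?q (pt X) \<longleftrightarrow> v \<in> filtration \<nu> f e i" and
      lim: "((\<lambda>t. ereal (1 / t * ln (hilbert_dist \<Omega> (radial_flow \<Omega> (pt X) t ?q) (radial_flow \<Omega> (pt X) t x))))
      \<longlongrightarrow> lyapunov_exponent (alpha f v)) at_top"
      using horosphere_direction[of x] x unfolding H_def by blast
    obtain j where j: "j \<in> {1..p}" "alpha f v = e j" using alpha_e v by blast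
    have "\<forall>i\<le>p. x \<in> F i \<longleftrightarrow> j \<le> i" using F_iff x(1) vi mem[OF v j] by simp
    then show ?thesis using v j lim[unfolded j(2)] by blast
  qed
  have F0: "F 0 = {?q}"
  proof (intro set_eqI iffI)
    fix x assume "x \<in> F 0"
    \<comment> \<open>Indices start at 1, so no point other than the base point is in F 0.\<close>
    then show "x \<in> {?q}" using dir[of x] F_iff by fastforce
  qed (use qF in auto)
  have Fp: "F p = H"
  proof (intro set_eqI iffI)
    fix x assume x: "x \<in> H"
    show "x \<in> F p"
    proof (cases "x = ?q")
      case False
      then show ?thesis using dir[OF x] by fastforce
    qed (simp add: qF)
  qed (use F_iff in auto)
  have strict: "F i \<subset> F (Suc i)" if i: "i < p" for i
  proof
    show "F i \<subseteq> F (Suc i)"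
    proof
      fix x assume x: "x \<in> F i"
      show "x \<in> F (Suc i)"
      proof (cases "x = ?q")
        case False
        then show ?thesis using dir[of x] x F_iff i by fastforce
      qed (simp add: qF)
    qed
    have "Suc i \<in> {1..p}" using i by simp
    then have "e (Suc i) \<in> alpha f ` (tangent \<nu> - {0})" unfolding img by (rule imageI)
    then obtain v where v: "v \<in> tangent \<nu> - {0}" "alpha f v = e (Suc i)" by (metis imageE)
    obtain x where x: "x \<in> H" and
      xi: "\<And>i. x \<in> directed_subspace \<kappa> (filtration \<nu> f e i) ?q (pt X) \<longleftrightarrow> v \<in> filtration \<nu> f e i"
      using ex_horosphere_direction[OF v(1)] unfolding H_def by blast
    have "x \<in> F (Suc i)" "x \<notin> F i" using F_iff x xi mem[OF v(1) \<open>Suc i \<in> {1..p}\<close> v(2)] i by auto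
    then show "F i \<noteq> F (Suc i)" by blast
  qed
  have last: "F i - F (i - 1) =
      {x \<in> H - {?q}.
        ((\<lambda>t. ereal (1 / t * ln (hilbert_dist \<Omega> (radial_flow \<Omega> (pt X) t ?q) (radial_flow \<Omega> (pt X) t x))))
          \<longlongrightarrow> lyapunov_exponent (e i)) at_top}" (is "_ = {x \<in> H - {?q}. ?lim x (e i)}") if i: "i \<in> {1..p}" for i
  proof -
    have "x \<in> F i - F (i - 1) \<longleftrightarrow> ?lim x (e i)" if x: "x \<in> H" "x \<noteq> ?q" for x
    proof -
      obtain j where j: "j \<in> {1..p}" "\<forall>i\<le>p. x \<in> F i \<longleftrightarrow> j \<le> i" "?lim x (e j)" using dir[OF x] by blast
      \<comment> \<open>Since i \<ge> 1, the subtraction is not truncated; for i = 1 it refers to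
        the level 0 above.\<close>
      have "x \<in> F i - F (i - 1) \<longleftrightarrow> j \<le> i \<and> \<not> j \<le> i - 1" using j(2) i by auto
      also have "\<dots> \<longleftrightarrow> i = j" using i j(1) by auto
      also have "\<dots> \<longleftrightarrow> e i = e j" using dec' i j(1) by (metis order_antisym order_refl)
      also have "\<dots> \<longleftrightarrow> lyapunov_exponent (e i) = lyapunov_exponent (e j)"
        using lyapunov_exponent_inject e_ge i j(1) by blast
      also have "\<dots> \<longleftrightarrow> ?lim x (e i)"
        using j(3) tendsto_unique[OF trivial_limit_at_top_linorder j(3), of "lyapunov_exponent (e i)"] by auto
      finally show ?thesis .
    qed
    then show ?thesis using F_iff qF by blast
  qed
  show ?thesis using F0 strict Fp last by blast
qed

end

section \<open>Passage from the projective domain and its charts to cones\<close>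

lemma proper_open_convex_lift:
  assumes \<Omega>: "proper_open_convex (\<Omega> :: ('a::euclidean_space \<times> real) projective set)" and q: "q \<in> \<Omega>"
  shows "\<exists>K l B L. hilbert_cone K l B \<Omega> L \<and> K = {x. 0 < l x \<and> pt x \<in> \<Omega>}"
proof -
  \<comment> \<open>The same choice as in \<open>hilbert_dist\<close>, as the assumption
    \<open>chart\<close> of \<open>hilbert_cone\<close> demands.\<close>
  define \<kappa> where "\<kappa> = (SOME \<kappa>. proper_convex_chart \<Omega> \<kappa>)"
  have \<kappa>: "proper_convex_chart \<Omega> \<kappa>"
    unfolding \<kappa>_def using \<Omega> someI_ex unfolding proper_open_convex_def by metis
  then obtain A :: "'a \<times> real \<Rightarrow> 'a \<times> real" where A: "linear A" "bij A" "\<kappa> = (\<lambda>x. pt (A (x, 1)))"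
    by (auto simp: proper_convex_chart_def affine_chart_def)
  have sub: "\<Omega> \<subseteq> range \<kappa>" and conv: "convex (\<kappa> -` \<Omega>)" and cmp: "compact (closure (\<kappa> -` \<Omega>))"
    using \<kappa> by (auto simp: proper_convex_chart_def)
  define l where "l x = snd (inv A x)" for x
  define L where "L x = fst (inv A x)" for x
  define K where "K = {x. 0 < l x \<and> pt x \<in> \<Omega>}"
  have injA: "inj A" and surjA: "surj A" using A(2) by (auto simp: bij_def)
  have invA: "inv A (A w) = w" "A (inv A x) = x" for w x
    using injA surjA by (auto simp: surj_f_inv_f)
  have linA: "linear (inv A)"
    using A(1) injA surjA by (intro linear_inverse_left[THEN iffD1] inj_linear_imp_inv_linear) auto
  have linl: "linear l" and linL: "linear L"
    using linear_compose[OF linA linear_snd] linear_compose[OF linA linear_fst]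
    by (simp_all add: l_def[abs_def] L_def[abs_def] comp_def)
  have A0: "A w = 0 \<longleftrightarrow> w = 0" for w using A(1) injA by (metis injD linear_0)
  have nz: "A (x, 1) \<noteq> 0" for x unfolding A0 by (simp add: zero_prod_def)
  have pt_chart: "pt x = \<kappa> (L x /\<^sub>R l x)" if "l x \<noteq> 0" for x
  proof -
    have "x = l x *\<^sub>R A (L x /\<^sub>R l x, 1)"
    proof -
      have "l x *\<^sub>R A (L x /\<^sub>R l x, 1) = A (l x *\<^sub>R (L x /\<^sub>R l x, 1))" using A(1) by (simp only: linear_cmul)
      also have "l x *\<^sub>R (L x /\<^sub>R l x, 1) = inv A x" using that by (simp add: l_def L_def prod_eq_iff)
      finally show ?thesis by (simp add: invA)
    qed
    then show ?thesis using that unfolding A(3) by (metis pt_scaleR)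
  qed
  have inj\<kappa>: "inj \<kappa>"
  proof (rule injI)
    fix x y assume "\<kappa> x = \<kappa> y"
    then have "pt (A (x, 1)) = pt (A (y, 1))" by (simp add: A(3))
    then obtain c where "A (x, 1) = c *\<^sub>R A (y, 1)"
      using pt_eq_iff[OF nz nz] by blast
    then have "A (x, 1) = A (c *\<^sub>R (y, 1))" using A(1) by (simp only: linear_cmul)
    then show "x = y" using injA by (auto dest!: injD)
  qed
  have memK: "x \<in> K \<longleftrightarrow> 0 < l x \<and> L x /\<^sub>R l x \<in> \<kappa> -` \<Omega>" for x
    using pt_chart[of x] by (auto simp: K_def)
  have linl_simps: "l (x + y) = l x + l y" "l (c *\<^sub>R x) = c * l x" "l (- x) = - l x" "l 0 = 0" for x y c
    using linl by (auto simp: linear_add linear_cmul linear_neg linear_0)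
  have linL_simps: "L (x + y) = L x + L y" "L (c *\<^sub>R x) = c *\<^sub>R L x" for x y c
    using linL by (auto simp: linear_add linear_cmul)
  have "bounded (\<kappa> -` \<Omega>)" using cmp by (meson bounded_subset closure_subset compact_imp_bounded)
  then obtain b where b: "\<And>x. x \<in> \<kappa> -` \<Omega> \<Longrightarrow> norm x \<le> b" unfolding bounded_iff by blast
  obtain M where M: "0 < M" "\<And>w. norm (A w) \<le> M * norm w" using linear_bounded_pos[OF A(1)] by blast
  obtain z where z: "\<kappa> z \<in> \<Omega>" using sub q by blast
  then have b0: "0 \<le> b" using b[of z] norm_ge_zero[of z] by (meson order_trans vimageI2)
  \<comment> \<open>In homogeneous coordinates of the chart a vector x of \<open>K\<close> has norm
    at most (b + 1) l x, where b bounds the domain and 1 accounts for the last coordinate; M bounds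
    the linear map.\<close>
  have "hilbert_cone K l (M * (b + 1)) \<Omega> L"
  proof unfold_locales
    have "continuous_on UNIV l" using linl linear_continuous_on linear_conv_bounded_linear by blast
    then have "open {x. 0 < l x}" by (intro open_Collect_less continuous_intros) auto
    moreover have "open {v. v \<noteq> 0 \<and> pt v \<in> \<Omega>}"
      using \<Omega> open_projective_iff[of \<Omega>] by (simp add: proper_open_convex_def)
    ultimately have "open ({x. 0 < l x} \<inter> {v. v \<noteq> 0 \<and> pt v \<in> \<Omega>})" by (rule open_Int)
    moreover have "{x. 0 < l x} \<inter> {v. v \<noteq> 0 \<and> pt v \<in> \<Omega>} = K" using linl_simps(4) by (auto simp: K_def)
    ultimately show "open K" by simp
  next
    fix x y assume xy: "x \<in> K" "y \<in> K"
    then have lx: "0 < l x" "0 < l y" by (auto simp: K_def)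
    \<comment> \<open>With these weights the sum of two lifts represents a convex combination in the
      chart.\<close>
    let ?s = "l x / (l x + l y)" and ?t = "l y / (l x + l y)"
    have "?s + ?t = 1" using lx by (simp add: add_divide_distrib[symmetric])
    then have "?s *\<^sub>R (L x /\<^sub>R l x) + ?t *\<^sub>R (L y /\<^sub>R l y) \<in> \<kappa> -` \<Omega>"
      using xy lx memK by (intro convexD[OF conv]) auto
    also have "?s *\<^sub>R (L x /\<^sub>R l x) + ?t *\<^sub>R (L y /\<^sub>R l y) = L (x + y) /\<^sub>R l (x + y)"
    proof -
      have "l x / (l x + l y) * inverse (l x) = inverse (l x + l y)" "l y / (l x + l y) * inverse (l y) = inverse (l x + l y)"
        using lx by (simp_all add: field_simps)
      then show ?thesis unfolding scaleR_scaleR linl_simps linL_simps scaleR_add_right by simp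
    qed
    finally show "x + y \<in> K" using lx by (simp add: memK linl_simps)
  next
    fix c :: real and x assume "0 < c" "x \<in> K"
    then show "c *\<^sub>R x \<in> K" by (simp add: K_def linl_simps)
  next
    show "l (x + y) = l x + l y" "l (r *\<^sub>R x) = r *\<^sub>R l x" for x y r by (simp_all add: linl_simps)
  next
    show "0 < M * (b + 1)" using M b0 by simp
  next
    fix x assume "x \<in> K"
    then have x: "0 < l x" "norm (L x /\<^sub>R l x) \<le> b" using memK b by blast+
    have "norm (L x) \<le> b * l x" using x by (simp add: field_simps)
    have "norm x = norm (A (inv A x))" by (simp add: invA)
    also have "\<dots> \<le> M * norm (inv A x)" by (rule M)
    also have "norm (inv A x) \<le> norm (L x) + norm (l x)"
      using norm_Pair_le[of "L x" "l x"] by (simp add: L_def l_def)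
    then have "M * norm (inv A x) \<le> M * (b * l x + l x)"
      using M x \<open>norm (L x) \<le> b * l x\<close> by (intro mult_left_mono) auto
    finally show "norm x \<le> M * (b + 1) * l x" by (simp add: algebra_simps)
  next
    show "L (x + y) = L x + L y" "L (r *\<^sub>R x) = r *\<^sub>R L x" for x y r by (rule linL_simps)+
  next
    fix x assume "L x = 0" "l x = 0"
    then have "inv A x = 0" by (simp add: L_def l_def prod_eq_iff)
    then show "x = 0" using invA(2)[of x] A0 by metis
  next
    fix x :: "'a \<times> real" assume x: "x \<noteq> 0"
    show "pt x \<in> \<Omega> \<longleftrightarrow> x \<in> K \<or> - x \<in> K"
    proof
      assume px: "pt x \<in> \<Omega>"
      then obtain y where "pt x = pt (A (y, 1))" using sub by (auto simp: A(3))
      then obtain c where c: "c \<noteq> 0" "x = c *\<^sub>R A (y, 1)" using pt_eq_iff[OF x nz] by blast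
      then have "l x = c" by (simp add: linl_simps) (simp add: l_def invA)
      then show "x \<in> K \<or> - x \<in> K" using px c by (auto simp: K_def linl_simps)
    qed (auto simp: K_def)
  next
    fix x assume "l x \<noteq> 0"
    then show "inv (SOME \<kappa>. proper_convex_chart \<Omega> \<kappa>) (pt x) = L x /\<^sub>R l x"
      using pt_chart inv_f_f[OF inj\<kappa>] by (simp flip: \<kappa>_def)
  next
    have "A (z, 1) \<in> K" using z by (simp add: K_def l_def invA A(3))
    then show "K \<noteq> {}" by blast
  qed
  then show ?thesis unfolding K_def by blast
qed

theorem corollary5p4:
  fixes \<Omega> :: "('a::euclidean_space \<times> real) projective set"
    and q xp :: "('a \<times> real) projective"
    and \<kappa> :: "'a \<Rightarrow> ('a \<times> real) projective"
    and \<nu> :: 'a and f :: "'a \<Rightarrow> real"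
    and p :: nat and e :: "nat \<Rightarrow> ereal"
  assumes "DIM('a) \<ge> 2"
    and "proper_open_convex \<Omega>" and "q \<in> \<Omega>" and "xp \<in> frontier \<Omega>"
    and "affine_chart \<kappa>" and "xp \<in> range \<kappa>"
    and "boundary_graph \<Omega> \<kappa> xp \<nu> f"
    and "approx_regular \<nu> f" and "exponents \<nu> f p e"
  defines "\<H> \<equiv> horosphere \<Omega> xp q"
    and "F \<equiv> horosphere_filtration \<Omega> \<kappa> q xp \<nu> f e"
  shows "F 0 = {q} \<and> (\<forall>i<p. F i \<subset> F (Suc i)) \<and> F p = \<H> \<and>
    (\<forall>i\<in>{1..p}. F i - F (i - 1) =
      {x \<in> \<H> - {q}.
        ((\<lambda>t. ereal (1 / t * ln (hilbert_dist \<Omega> (radial_flow \<Omega> xp t q) (radial_flow \<Omega> xp t x))))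
          \<longlongrightarrow> lyapunov_exponent (e i)) at_top})"
proof -
  obtain K l B L where hc: "hilbert_cone K l B \<Omega> L" and K: "K = {x. 0 < l x \<and> pt x \<in> \<Omega>}"
    using proper_open_convex_lift assms(2,3) by blast
  interpret hilbert_cone K l B \<Omega> L by (rule hc)
  define z\<^sub>0 where "z\<^sub>0 = inv \<kappa> xp"
  have \<kappa>z: "\<kappa> z\<^sub>0 = xp" using assms(6) by (simp add: z\<^sub>0_def f_inv_into_f)
  obtain A\<^sub>0 :: "'a \<times> real \<Rightarrow> 'a \<times> real" where A0: "linear A\<^sub>0" "bij A\<^sub>0" "\<kappa> = (\<lambda>x. pt (A\<^sub>0 (x, 1)))"
    using assms(5) unfolding affine_chart_def by blast
  have nz0: "A\<^sub>0 (z, 1) \<noteq> 0" for z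
    using A0(1,2) by (metis bij_is_inj injD linear_0 prod.inject zero_neq_one zero_prod_def)
  have "A\<^sub>0 (z\<^sub>0, 1) \<in> closure K - K \<or> - A\<^sub>0 (z\<^sub>0, 1) \<in> closure K - K"
    using pt_frontier_Omega[OF nz0, of z\<^sub>0] \<kappa>z assms(4) by (simp add: A0(3))
  \<comment> \<open>The linear map behind a chart may be replaced by its negative; the sign is
    chosen so that x+ is lifted into the closure of \<open>K\<close>.\<close>
  then obtain A :: "'a \<times> real \<Rightarrow> 'a \<times> real" where A: "linear A" "bij A" "\<kappa> = (\<lambda>x. pt (A (x, 1)))"
    and Az: "A (z\<^sub>0, 1) \<in> closure K - K"
  proof
    assume "- A\<^sub>0 (z\<^sub>0, 1) \<in> closure K - K"
    moreover have "linear (\<lambda>x. - A\<^sub>0 x)" using A0(1) by (rule linear_compose_neg)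
    moreover have "bij (\<lambda>x. - A\<^sub>0 x)" using bij_comp[OF A0(2) bij_uminus] by (simp add: comp_def)
    ultimately show ?thesis using A0(3) by (intro that[of "\<lambda>x. - A\<^sub>0 x"]) auto
  qed (use A0 that in blast)
  have nz: "A w = 0 \<longleftrightarrow> w = 0" for w using A(1,2) by (metis bij_is_inj injD linear_0)
  \<comment> \<open>The last coordinate 0 makes \<open>J\<close> lift displacements in the chart
    rather than points.\<close>
  define X J where "X = A (z\<^sub>0, 1)" and "J = (\<lambda>h. A (h, 0))"
  have XJ: "c *\<^sub>R X + J h = A (c *\<^sub>R z\<^sub>0 + h, c)" for c h
    using A(1) by (simp add: X_def J_def linear_add[symmetric] linear_cmul[symmetric])
  have xp: "xp = pt X" using \<kappa>z by (simp add: A(3) X_def)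
  obtain \<epsilon> where \<epsilon>: "0 < \<epsilon>" "convex_on (tangent \<nu> \<inter> ball 0 \<epsilon>) f" "\<forall>h\<in>tangent \<nu> \<inter> ball 0 \<epsilon>. 0 \<le> f h"
    and norm_nu: "norm \<nu> = 1" and f0: "f 0 = 0"
    and ev: "\<forall>\<^sub>F z in nhds z\<^sub>0. \<kappa> z \<in> \<Omega> \<longleftrightarrow> f ((z - z\<^sub>0) - ((z - z\<^sub>0) \<bullet> \<nu>) *\<^sub>R \<nu>) < (z - z\<^sub>0) \<bullet> \<nu>"
  proof -
    from assms(7) obtain \<epsilon> where "0 < \<epsilon>" "convex_on (tangent \<nu> \<inter> ball 0 \<epsilon>) f" "\<forall>h\<in>tangent \<nu> \<inter> ball 0 \<epsilon>. 0 \<le> f h"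
      "norm \<nu> = 1" "f 0 = 0" unfolding boundary_graph_def by blast
    moreover have "\<forall>\<^sub>F z in nhds z\<^sub>0. \<kappa> z \<in> \<Omega> \<longleftrightarrow> f ((z - z\<^sub>0) - ((z - z\<^sub>0) \<bullet> \<nu>) *\<^sub>R \<nu>) < (z - z\<^sub>0) \<bullet> \<nu>"
      using assms(7) unfolding boundary_graph_def Let_def z\<^sub>0_def by (auto elim: eventually_mono)
    ultimately show ?thesis by (rule that)
  qed
  have X_nz: "X \<noteq> 0" unfolding X_def nz by (simp add: zero_prod_def)
  have lX: "0 < l X" using l_pos[of X] Az X_nz by (simp add: X_def)
  \<comment> \<open>Near x+ the lift keeps l positive, so a chart point lies in \<Omega> exactly if
    its lift lies in \<open>K\<close>, not in the opposite half.\<close>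
  have "continuous_on UNIV (\<lambda>z. l (A (z, 1)))"
    using A(1) linear_l
    by (intro continuous_on_compose2[OF cont_l] continuous_on_compose2[OF linear_continuous_on[of A]] continuous_intros)
      (auto simp: linear_conv_bounded_linear)
  then have "open {z. 0 < l (A (z, 1))}" by (intro open_Collect_less continuous_intros) auto
  then have "\<forall>\<^sub>F z in nhds z\<^sub>0. 0 < l (A (z, 1))"
    using lX eventually_nhds_in_open[of "{z. 0 < l (A (z, 1))}" z\<^sub>0] by (simp add: X_def)
  with ev have "\<forall>\<^sub>F z in nhds z\<^sub>0. A (z, 1) \<in> K \<longleftrightarrow> f ((z - z\<^sub>0) - ((z - z\<^sub>0) \<bullet> \<nu>) *\<^sub>R \<nu>) < (z - z\<^sub>0) \<bullet> \<nu>"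
    by eventually_elim (simp add: K A(3))
  then obtain d where d: "0 < d" "\<And>z. dist z z\<^sub>0 < d \<Longrightarrow>
      A (z, 1) \<in> K \<longleftrightarrow> f ((z - z\<^sub>0) - ((z - z\<^sub>0) \<bullet> \<nu>) *\<^sub>R \<nu>) < (z - z\<^sub>0) \<bullet> \<nu>"
    unfolding eventually_nhds_metric by blast
  \<comment> \<open>A common radius for the graph description of \<open>K\<close> and for the
    convexity of f.\<close>
  define \<rho> where "\<rho> = min d \<epsilon>"
  interpret graph_cone K l B \<Omega> L X f \<nu> \<rho> J
  proof unfold_locales
    show "X \<in> closure K" "X \<notin> K" "X \<noteq> 0" using Az X_nz by (auto simp: X_def)
    show "0 < \<rho>" using d \<epsilon> by (simp add: \<rho>_def)
    show "0 \<le> f h" if "h \<in> tangent \<nu>" "norm h < \<rho>" for h using that \<epsilon>(3) by (simp add: \<rho>_def)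
    show "convex_on (tangent \<nu> \<inter> ball 0 \<rho>) f"
    proof (rule convex_on_subset[OF \<epsilon>(2)])
      have "convex (tangent \<nu>)" by (auto simp: tangent_def convex_def inner_add_left)
      then show "convex (tangent \<nu> \<inter> ball 0 \<rho>)" by (intro convex_Int convex_ball)
    qed (auto simp: \<rho>_def)
    show "J (x + y) = J x + J y" "J (r *\<^sub>R x) = r *\<^sub>R J x" for x y r
      using A(1) by (simp_all add: J_def linear_add[symmetric] linear_cmul[symmetric])
    show "\<exists>c z. w = c *\<^sub>R X + J z" for w
    proof -
      obtain z c where "w = A (z, c)" using A(2) by (metis bij_pointE prod.collapse)
      then have "w = c *\<^sub>R X + J (z - c *\<^sub>R z\<^sub>0)" by (simp add: XJ)
      then show ?thesis by blast
    qed
    show "c = 0 \<and> z = 0" if "c *\<^sub>R X + J z = 0" for c z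
    proof -
      have "(c *\<^sub>R z\<^sub>0 + z, c) = 0" using that unfolding XJ nz .
      then show ?thesis by (auto simp: zero_prod_def)
    qed
    show "X + J z \<in> K \<longleftrightarrow> f (z - (z \<bullet> \<nu>) *\<^sub>R \<nu>) < z \<bullet> \<nu>" if "norm z < \<rho>" for z
    proof -
      have "X + J z = A (z\<^sub>0 + z, 1)" using XJ[of 1 z] by simp
      then show ?thesis using d(2)[of "z\<^sub>0 + z"] that by (simp add: dist_norm \<rho>_def)
    qed
  qed (rule f0 assms(8) norm_nu)+
  obtain P where P: "P \<in> ends" "q = pt (X + P)" using ex_ends assms(3) by blast
  interpret chart: chart_cone K l B \<Omega> L X f \<nu> \<rho> J P z\<^sub>0 by unfold_locales (rule P)
  have "chart.\<kappa> = \<kappa>"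
  proof
    fix z
    have "X + J (z - z\<^sub>0) = A (z, 1)" using XJ[of 1 "z - z\<^sub>0"] by simp
    then show "chart.\<kappa> z = \<kappa> z" by (simp add: chart.\<kappa>_def A(3))
  qed
  then show ?thesis
    using chart.horosphere_filtration_growth[OF assms(9)] unfolding \<H>_def F_def xp P(2) by simp
qed

end
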